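(* Let $X\subset\mathbb{P}_n$ be an arithmetically Cohen-Macaulay projective subscheme of pure dimension $m\ge1$ and degree $d$, with characteristic sequence $(m_i)_{0\le i\le d-1}$, and let $Y\subset X$ be an ACM hypersurface of $X$ with relative characteristic sequence $(n_i)_{0\le i\le d-1}$. Put $c_i:=\operatorname{card}\{j : m_j\le i\}$ and $d_i:=\operatorname{card}\{j : n_j\le i\}$. Then the sequence $(c_i-d_i)_{i\ge0}$ is a $0$-sequence.
   Context: $k$ is an algebraically closed field of characteristic $0$, $A_n=k[X_0,\dots,X_n]$. A projective subscheme $X\subset\mathbb{P}_n$ is given by its saturated homogeneous ideal $I_X$; $A_X=A_n/I_X$ and $\phi_X(l)=\dim_k A_X(l)$. $B[a](l)=B(a+l)$ denotes the shift of a graded module. $X$ of dimension $m$ is arithmetically Cohen-Macaulay (ACM) if $A_X$ admits a regular sequence of $m+1$ homogeneous polynomials. Characteristic sequence: if $X$ is ACM of pure dimension $m$ and degree $d$, and $Y_0,\dots,Y_m$ are linear forms whose common zero locus does not meet $X$, put $R_m=k[Y_0,\dots,Y_m]$. Then $A_X\simeq\bigoplus_{i=0}^{d-1}R_m[-m_i]$ as graded $R_m$-modules with $0=m_0\le\dots\le m_{d-1}$; the sequence $(m_i)$ depends only on $\phi_X$ and is the characteristic sequence of $X$. Relative characteristic sequence: an ACM hypersurface of $X$ is an ACM closed subscheme $Y\subset X$ of pure dimension $m-1$. The kernel $I_{Y/X}=I_Y/I_X$ of $A_X\to A_Y$ is a graded free $R_m$-module of rank $d$, $I_{Y/X}\simeq\bigoplus_{i=0}^{d-1}R_m[-n_i]$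 with $n_0\le\dots\le n_{d-1}$; $(n_i)$ is the relative characteristic sequence of $Y$ (relative to $X$). $0$-sequences: for integers $c>0$ and $e\ge1$, the $e$-th Macaulay representation of $c$ is the unique expression $c=\binom{k_e}{e}+\binom{k_{e-1}}{e-1}+\dots+\binom{k_\delta}{\delta}$ with $k_e>k_{e-1}>\dots>k_\delta\ge\delta>0$; put $c^{\langle e\rangle}:=\binom{k_e+1}{e+1}+\binom{k_{e-1}+1}{e}+\dots+\binom{k_\delta+1}{\delta+1}$, and $0^{\langle e\rangle}:=0$. A sequence $(a_l)_{l\ge0}$ of nonnegative integers is a $0$-sequence if $a_{l+1}\le a_l^{\langle l\rangle}$ for all $l\ge1$. *)

theory Defs
  imports
    "HOL-Library.Poly_Mapping"
    "HOL-Library.FuncSet"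
    "HOL-Computational_Algebra.Polynomial"
    "HOL-Algebra.QuotRing"
    "HOL-Algebra.Module"
    "HOL-Algebra.Generated_Rings"
    "HOL-Algebra.Embedded_Algebras"
begin

section \<open>The graded polynomial ring\<close>

text \<open>Polynomials in the variables \<open>X\<^sub>0, X\<^sub>1, \<dots>\<close>; exponent vectors are finitely supported maps
  from variable indices to exponents.\<close>

type_synonym 'k mpoly = "(nat \<Rightarrow>\<^sub>0 nat) \<Rightarrow>\<^sub>0 'k"

definition mpoly_ring :: "nat \<Rightarrow> 'k::comm_ring_1 mpoly ring" where
  "mpoly_ring n =
     \<lparr>carrier = {f. \<forall>t \<in> Poly_Mapping.keys f. Poly_Mapping.keys t \<subseteq> {0..n}},
      mult = (*), one = 1, zero = 0, add = (+)\<rparr>"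

definition var :: "nat \<Rightarrow> 'k::comm_ring_1 mpoly" where
  "var i = Poly_Mapping.single (Poly_Mapping.single i 1) 1"

definition constants :: "'k::comm_ring_1 mpoly set" where
  "constants = {Poly_Mapping.single 0 c | c. True}"

definition mon_degree :: "(nat \<Rightarrow>\<^sub>0 nat) \<Rightarrow> nat" where
  "mon_degree t = (\<Sum>i \<in> Poly_Mapping.keys t. Poly_Mapping.lookup t i)"

text \<open>All gradings are indexed by \<^typ>\<open>int\<close>, so that shifts are total; the pieces of negative
  degree are \<open>{0}\<close>.\<close>

definition poly_piece :: "nat \<Rightarrow> int \<Rightarrow> 'k::comm_ring_1 mpoly set" where
  "poly_piece n l =
     {f \<in> carrier (mpoly_ring n). \<forall>t \<in> Poly_Mapping.keys f. int (mon_degree t) = l}"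

definition homogeneous_ideal :: "nat \<Rightarrow> 'k::comm_ring_1 mpoly set \<Rightarrow> bool" where
  "homogeneous_ideal n I \<longleftrightarrow>
     ideal I (mpoly_ring n) \<and> I = Idl\<^bsub>mpoly_ring n\<^esub> {f \<in> I. \<exists>l. f \<in> poly_piece n l}"

definition saturated :: "nat \<Rightarrow> 'k::comm_ring_1 mpoly set \<Rightarrow> bool" where
  "saturated n I \<longleftrightarrow>
     (\<forall>f \<in> carrier (mpoly_ring n). (\<exists>N. \<forall>i \<le> n. var i ^ N * f \<in> I) \<longrightarrow> f \<in> I)"


section \<open>Projective subschemes\<close>

text \<open>A closed subscheme of projective \<open>n\<close>-space is represented throughout by its saturated
  homogeneous ideal; inclusion of subschemes is reverse inclusion of ideals.\<close>

definition subscheme :: "nat \<Rightarrow> 'k::field mpoly set \<Rightarrow> bool" where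
  "subscheme n I \<longleftrightarrow> homogeneous_ideal n I \<and> saturated n I"

text \<open>The points of the scheme: homogeneous primes that contain \<open>I\<close> but not all variables.\<close>

definition scheme_points :: "nat \<Rightarrow> 'k::field mpoly set \<Rightarrow> 'k mpoly set set" where
  "scheme_points n I =
     {P. primeideal P (mpoly_ring n) \<and> homogeneous_ideal n P \<and> I \<subseteq> P \<and> (\<exists>i \<le> n. var i \<notin> P)}"

text \<open>Irreducible closed subsets of a scheme correspond to their generic points, with inclusions
  reversed. So the topological dimension of the scheme, and of the irreducible closed subset with
  generic point \<open>P\<close>, is the maximal number of strict inclusions in a chain of points (of points
  containing \<open>P\<close>, respectively), and the irreducible components correspond to the minimal points.\<close>

definition chain_dimension :: "'a set set \<Rightarrow> nat \<Rightarrow> bool" where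
  "chain_dimension S m \<longleftrightarrow>
     (\<exists>Ps. set Ps \<subseteq> S \<and> sorted_wrt (\<subset>) Ps \<and> length Ps = m + 1) \<and>
     (\<forall>Ps. set Ps \<subseteq> S \<and> sorted_wrt (\<subset>) Ps \<longrightarrow> length Ps \<le> m + 1)"

definition has_dimension :: "nat \<Rightarrow> 'k::field mpoly set \<Rightarrow> nat \<Rightarrow> bool" where
  "has_dimension n I m \<longleftrightarrow> chain_dimension (scheme_points n I) m"

definition has_pure_dimension :: "nat \<Rightarrow> 'k::field mpoly set \<Rightarrow> nat \<Rightarrow> bool" where
  "has_pure_dimension n I m \<longleftrightarrow>
     has_dimension n I m \<and>
     (\<forall>P \<in> scheme_points n I. (\<forall>Q \<in> scheme_points n I. \<not> Q \<subset> P) \<longrightarrow>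
        chain_dimension {Q \<in> scheme_points n I. P \<subseteq> Q} m)"

definition coord_ring :: "nat \<Rightarrow> 'k::field mpoly set \<Rightarrow> 'k mpoly set ring" where
  "coord_ring n I = mpoly_ring n Quot I"

definition coord_piece :: "nat \<Rightarrow> 'k::field mpoly set \<Rightarrow> int \<Rightarrow> 'k mpoly set set" where
  "coord_piece n I l = (\<lambda>f. I +>\<^bsub>mpoly_ring n\<^esub> f) ` poly_piece n l"

definition hilbert_function :: "nat \<Rightarrow> 'k::field mpoly set \<Rightarrow> nat \<Rightarrow> nat" where
  "hilbert_function n I l =
     ring.dim (coord_ring n I) ((\<lambda>c. I +>\<^bsub>mpoly_ring n\<^esub> c) ` constants) (coord_piece n I (int l))"

definition has_degree :: "nat \<Rightarrow> 'k::field mpoly set \<Rightarrow> nat \<Rightarrow> bool" where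
  "has_degree n I d \<longleftrightarrow>
     (\<exists>p :: rat poly.
        (\<forall>\<^sub>F l in sequentially. of_nat (hilbert_function n I l) = poly p (of_nat l)) \<and>
        of_nat d = fact (Polynomial.degree p) * Polynomial.lead_coeff p)"

definition regular_sequence :: "('a, 'b) ring_scheme \<Rightarrow> 'a list \<Rightarrow> bool" where
  "regular_sequence R fs \<longleftrightarrow>
     set fs \<subseteq> carrier R \<and>
     (\<forall>i < length fs. \<forall>x \<in> carrier R.
        fs ! i \<otimes>\<^bsub>R\<^esub> x \<in> Idl\<^bsub>R\<^esub> (set (take i fs)) \<longrightarrow> x \<in> Idl\<^bsub>R\<^esub> (set (take i fs))) \<and>
     Idl\<^bsub>R\<^esub> (set fs) \<noteq> carrier R"

definition ACM :: "nat \<Rightarrow> 'k::field mpoly set \<Rightarrow> bool" where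
  "ACM n I \<longleftrightarrow>
     subscheme n I \<and>
     (\<exists>m fs. has_dimension n I m \<and> length fs = m + 1 \<and>
        (\<forall>f \<in> set fs. \<exists>l. f \<in> coord_piece n I l) \<and> regular_sequence (coord_ring n I) fs)"

definition ACM_hypersurface :: "nat \<Rightarrow> 'k::field mpoly set \<Rightarrow> nat \<Rightarrow> 'k mpoly set \<Rightarrow> bool" where
  "ACM_hypersurface n IX m IY \<longleftrightarrow> ACM n IY \<and> IX \<subseteq> IY \<and> has_pure_dimension n IY (m - 1)"


section \<open>Characteristic sequences\<close>

definition shift :: "(int \<Rightarrow> 'a set) \<Rightarrow> int \<Rightarrow> int \<Rightarrow> 'a set" where
  "shift B a l = B (a + l)"

text \<open>The module \<open>R\<^bsup>d\<^esup>\<close> on functions \<open>{0..<d} \<rightarrow> R\<close>, and the grading that turns it into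
  the direct sum of the \<open>R[-a\<^sub>i]\<close>, where \<open>G\<close> is the grading of \<open>R\<close>. The multiplicative fields of
  the record play no role.\<close>

definition free_module :: "('a, 'b) ring_scheme \<Rightarrow> nat \<Rightarrow> ('a, nat \<Rightarrow> 'a) module" where
  "free_module R d =
     \<lparr>carrier = {..<d} \<rightarrow>\<^sub>E carrier R,
      mult = undefined, one = undefined,
      zero = (\<lambda>i \<in> {..<d}. \<zero>\<^bsub>R\<^esub>),
      add = (\<lambda>u v. \<lambda>i \<in> {..<d}. u i \<oplus>\<^bsub>R\<^esub> v i),
      smult = (\<lambda>r v. \<lambda>i \<in> {..<d}. r \<otimes>\<^bsub>R\<^esub> v i)\<rparr>"

definition free_piece :: "(int \<Rightarrow> 'a set) \<Rightarrow> nat \<Rightarrow> (nat \<Rightarrow> nat) \<Rightarrow> int \<Rightarrow> (nat \<Rightarrow> 'a) set" where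
  "free_piece G d a l = (\<Pi>\<^sub>E i \<in> {..<d}. shift G (- int (a i)) l)"

text \<open>Graded modules over \<open>R\<close> are given by a module together with the family of its graded
  pieces.\<close>

definition graded_isomorphic ::
  "('r, 'x) ring_scheme \<Rightarrow> ('r, 'a) module \<Rightarrow> (int \<Rightarrow> 'a set) \<Rightarrow>
     ('r, 'b) module \<Rightarrow> (int \<Rightarrow> 'b set) \<Rightarrow> bool" where
  "graded_isomorphic R M GM N GN \<longleftrightarrow>
     (\<exists>h \<in> iso (add_monoid M) (add_monoid N).
        (\<forall>r \<in> carrier R. \<forall>x \<in> carrier M. h (r \<odot>\<^bsub>M\<^esub> x) = r \<odot>\<^bsub>N\<^esub> h x) \<and>
        (\<forall>l. h ` GM l = GN l))"

text \<open>Linear forms \<open>Y\<^sub>0, \<dots>, Y\<^sub>m\<close> without common zero on the scheme, and the ring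
  \<open>R\<^sub>m = k[Y\<^sub>0, \<dots>, Y\<^sub>m]\<close>, taken as a subring of the ambient polynomial ring.\<close>

definition avoiding_forms :: "nat \<Rightarrow> 'k::field mpoly set \<Rightarrow> nat \<Rightarrow> (nat \<Rightarrow> 'k mpoly) \<Rightarrow> bool" where
  "avoiding_forms n I m Y \<longleftrightarrow>
     (\<forall>i \<le> m. Y i \<in> poly_piece n 1) \<and> (\<forall>P \<in> scheme_points n I. \<exists>i \<le> m. Y i \<notin> P)"

definition form_ring :: "nat \<Rightarrow> nat \<Rightarrow> (nat \<Rightarrow> 'k::field mpoly) \<Rightarrow> 'k mpoly ring" where
  "form_ring n m Y =
     (mpoly_ring n)\<lparr>carrier := generate_ring (mpoly_ring n) (constants \<union> Y ` {..m})\<rparr>"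

definition form_piece :: "nat \<Rightarrow> nat \<Rightarrow> (nat \<Rightarrow> 'k::field mpoly) \<Rightarrow> int \<Rightarrow> 'k mpoly set" where
  "form_piece n m Y l = carrier (form_ring n m Y) \<inter> poly_piece n l"

text \<open>For ideals \<open>I \<subseteq> J\<close>, the submodule \<open>J/I\<close> of the coordinate ring \<open>A/I\<close>, with polynomials
  acting through their residue classes. For \<open>J = A\<close> this is the coordinate ring itself.\<close>

definition quotient_module ::
  "nat \<Rightarrow> 'k::field mpoly set \<Rightarrow> 'k mpoly set \<Rightarrow> ('k mpoly, 'k mpoly set) module" where
  "quotient_module n I J =
     \<lparr>carrier = (\<lambda>f. I +>\<^bsub>mpoly_ring n\<^esub> f) ` J,
      mult = mult (coord_ring n I), one = one (coord_ring n I),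
      zero = zero (coord_ring n I), add = add (coord_ring n I),
      smult = (\<lambda>r x. (I +>\<^bsub>mpoly_ring n\<^esub> r) \<otimes>\<^bsub>coord_ring n I\<^esub> x)\<rparr>"

definition quotient_piece ::
  "nat \<Rightarrow> 'k::field mpoly set \<Rightarrow> 'k mpoly set \<Rightarrow> int \<Rightarrow> 'k mpoly set set" where
  "quotient_piece n I J l = carrier (quotient_module n I J) \<inter> coord_piece n I l"

text \<open>Sequences \<open>s\<^sub>0, \<dots>, s\<^bsub>d-1\<^esub>\<close> are functions on \<^typ>\<open>nat\<close>, of which only the values
  below \<open>d\<close> matter. The linear forms are existentially quantified since the sequences do not
  depend on them.\<close>

definition characteristic_sequence ::
  "nat \<Rightarrow> 'k::field mpoly set \<Rightarrow> nat \<Rightarrow> nat \<Rightarrow> (nat \<Rightarrow> nat) \<Rightarrow> bool" where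
  "characteristic_sequence n IX m d ms \<longleftrightarrow>
     ms 0 = 0 \<and> mono_on {..<d} ms \<and>
     (\<exists>Y. avoiding_forms n IX m Y \<and>
        graded_isomorphic (form_ring n m Y)
          (quotient_module n IX (carrier (mpoly_ring n)))
          (quotient_piece n IX (carrier (mpoly_ring n)))
          (free_module (form_ring n m Y) d)
          (free_piece (form_piece n m Y) d ms))"

definition relative_characteristic_sequence ::
  "nat \<Rightarrow> 'k::field mpoly set \<Rightarrow> nat \<Rightarrow> nat \<Rightarrow> 'k mpoly set \<Rightarrow> (nat \<Rightarrow> nat) \<Rightarrow> bool" where
  "relative_characteristic_sequence n IX m d IY ns \<longleftrightarrow>
     mono_on {..<d} ns \<and>
     (\<exists>Y. avoiding_forms n IX m Y \<and>
        graded_isomorphic (form_ring n m Y)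
          (quotient_module n IX IY)
          (quotient_piece n IX IY)
          (free_module (form_ring n m Y) d)
          (free_piece (form_piece n m Y) d ns))"


section \<open>Macaulay representations and \<open>0\<close>-sequences\<close>

definition macaulay_rep :: "nat \<Rightarrow> nat \<Rightarrow> nat \<Rightarrow> (nat \<Rightarrow> nat) \<Rightarrow> bool" where
  "macaulay_rep e c \<delta> k \<longleftrightarrow>
     0 < \<delta> \<and> \<delta> \<le> e \<and> \<delta> \<le> k \<delta> \<and> strict_mono_on {\<delta>..e} k \<and>
     c = (\<Sum>i = \<delta>..e. k i choose i)"

definition macaulay_up :: "nat \<Rightarrow> nat \<Rightarrow> nat" where
  "macaulay_up e c =
     (if c = 0 then 0
      else THE b. \<exists>\<delta> k. macaulay_rep e c \<delta> k \<and> b = (\<Sum>i = \<delta>..e. (k i + 1) choose (i + 1)))"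

definition zero_sequence :: "(nat \<Rightarrow> int) \<Rightarrow> bool" where
  "zero_sequence a \<longleftrightarrow>
     (\<forall>l. 0 \<le> a l) \<and> (\<forall>l \<ge> 1. a (l + 1) \<le> int (macaulay_up l (nat (a l))))"

end

(* Write HS for Hilbert series. The generating function of (c_i - d_i) is
   (sum_j T^(m_j) - sum_j T^(n_j)) / (1 - T), which equals HS(A_Y) * (1 - T)^m once R_m is known to
   be a polynomial ring in m + 1 variables. Both copies of R_m are: an algebraic relation between the
   forms would make the Hilbert function of A_X (respectively I_{Y/X}) grow with order at most m - 1,
   whereas the regular sequence of length m + 1 forces order m for A_X, and then also for its nonzero
   ideal I_{Y/X}, since A_X is torsion-free over R_m.
   As A_Y has depth m, there are m linear forms that are regular on A_Y. They are exchanged one by one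
   for the given homogeneous regular sequence: modulo all but one of its members the Hilbert function
   is bounded, and there a linear nonzerodivisor is found by perturbing linear forms. So (c_i - d_i)
   is the Hilbert function of a standard graded algebra, and Macaulay's bound applies. The bound is
   deduced from Green's theorem on the restriction to a generic hyperplane. *)
theory Submission
  imports
    Defs
    "HOL-Computational_Algebra.Formal_Power_Series"
begin

text \<open>The given regular sequence on \<open>A_Y\<close> may have members of any degrees e_1,
  ..., e_m. Cutting by them yields S times the product of the polynomials 1 + T + ... + T^(e_i - 1),
  where S is the series of (c_i - d_i); only linear cuts yield S itself. S is a polynomial, because
  both counts end at d. Hence, after all members but one have been cut out, the series times 1 - T
  is still a polynomial, and this is where boundedness comes from. Boundedness replaces prime
  avoidance: a linear form h and a degree are chosen so that the codimension of J : h^infinity is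
  maximal, and a class killed by a power of h would permit a perturbation h + t X_i with larger
  codimension. Homogeneous members of positive degree may be permuted, so the new linear form moves
  to the front and the induction continues modulo it. Genericity is always a statement about lines u
  + t v: a rank drops for finitely many t only, since bad values of t come from eigenvalues of one
  operator, and characteristic 0 supplies infinitely many t.\<close>

section \<open>Macaulay representations\<close>

text \<open>\<open>mac_up e c\<close> is \<open>c\<^sup>\<langle>\<^sup>e\<^sup>\<rangle>\<close>, read off the greedy Macaulay representation
  \<open>c = binom(k\<^sub>e, e) + \<dots>\<close>, and \<open>mac_low e c\<close> is Green's \<open>binom(k\<^sub>e - 1, e) + \<dots>\<close>. The value
  \<open>mac_low 0 c = c\<close> lets the restriction theorem start in degree \<open>0\<close>.\<close>

fun mac_low :: "nat \<Rightarrow> nat \<Rightarrow> nat" where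
  "mac_low 0 c = c"
| "mac_low (Suc e) c = (if c = 0 then 0 else
     let k = (GREATEST k. k choose Suc e \<le> c)
     in ((k - 1) choose Suc e) + mac_low e (c - (k choose Suc e)))"

fun mac_up :: "nat \<Rightarrow> nat \<Rightarrow> nat" where
  "mac_up 0 c = 0"
| "mac_up (Suc e) c = (if c = 0 then 0 else
     let k = (GREATEST k. k choose Suc e \<le> c)
     in ((k + 1) choose (e + 2)) + mac_up e (c - (k choose Suc e)))"

declare mac_low.simps(2) [simp del] mac_up.simps(2) [simp del]

lemma binomial_pascal:
  "0 < k \<Longrightarrow> k choose Suc e = ((k - 1) choose Suc e) + ((k - 1) choose e)"
  by (cases k) auto

lemma binomial_pascal2:
  "1 < k \<Longrightarrow> (k - 1) choose Suc e = ((k - 2) choose Suc e) + ((k - 2) choose e)"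
  using binomial_pascal[of "k - 1"] by (simp add: numeral_2_eq_2)

text \<open>Bounds the candidates for \<open>GREATEST\<close>: \<open>k choose Suc e \<le> c\<close>
  forces \<open>k \<le> c + e\<close>.\<close>

lemma binomial_ge_diff: "k - e \<le> k choose Suc e"
proof (induction k)
  case (Suc k)
  show ?case
  proof (cases "e \<le> k")
    case True
    then have "1 \<le> k choose e" by (simp add: Suc_leI)
    then show ?thesis using Suc by simp
  qed simp
qed simp

lemma Greatest_binomial:
  assumes "r < k choose e" "e < k"
  shows "(GREATEST j. j choose Suc e \<le> (k choose Suc e) + r) = k"
proof (rule Greatest_equality)
  fix j assume j: "j choose Suc e \<le> (k choose Suc e) + r"
  show "j \<le> k"
  proof (rule ccontr)
    assume "\<not> j \<le> k"
    then have "Suc k choose Suc e \<le> j choose Suc e" by (intro binomial_right_mono) simp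
    with j assms show False by simp
  qed
qed simp

text \<open>Maximality of \<open>k\<close> gives \<open>c < Suc k choose Suc e\<close>, which
  Pascal's rule turns into \<open>r < k choose e\<close>. The bound \<open>e < k\<close> holds
  because \<open>Suc e choose Suc e = 1 \<le> c\<close>.\<close>

lemma binomial_decomposition:
  assumes "0 < c"
  obtains k r where "c = (k choose Suc e) + r" "r < k choose e" "e < k"
proof -
  let ?P = "\<lambda>k. k choose Suc e \<le> c"
  have P: "?P (Suc e)" using assms by simp
  have b: "\<And>y. ?P y \<Longrightarrow> y \<le> c + e"
    using binomial_ge_diff[of _ e] by (meson le_diff_conv le_trans)
  define k where "k = (GREATEST k. ?P k)"
  have k: "?P k" unfolding k_def using GreatestI_nat[of ?P, OF P b] by blast
  have ge: "Suc e \<le> k" unfolding k_def using Greatest_le_nat[of ?P "Suc e", OF P b] by blast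
  have "\<not> ?P (Suc k)" using Greatest_le_nat[of ?P "Suc k", OF _ b] unfolding k_def by fastforce
  then have "c - (k choose Suc e) < k choose e" using k by simp
  with k ge show thesis by (intro that[of k "c - (k choose Suc e)"]) auto
qed

lemma mac_low_0_right [simp]: "mac_low e 0 = 0"
  by (cases e) (auto simp: mac_low.simps(2))

lemma mac_up_0_right [simp]: "mac_up e 0 = 0"
  by (cases e) (auto simp: mac_up.simps(2))

lemma mac_low_Suc_binomial_lt:
  assumes "r < k choose e" "e < k"
  shows "mac_low (Suc e) ((k choose Suc e) + r) = ((k - 1) choose Suc e) + mac_low e r"
  using assms by (simp add: mac_low.simps(2) Greatest_binomial Let_def zero_less_binomial_iff)

lemma mac_up_Suc_binomial_lt:
  assumes "r < k choose e" "e < k"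
  shows "mac_up (Suc e) ((k choose Suc e) + r) = ((k + 1) choose (e + 2)) + mac_up e r"
  using assms by (simp del: binomial_Suc_Suc add: mac_up.simps(2) Greatest_binomial Let_def zero_less_binomial_iff)

lemma mac_low_binomial: "e < k \<Longrightarrow> mac_low e (k choose e) = (k - 1) choose e"
proof (cases e)
  case (Suc e')
  assume "e < k"
  then show ?thesis using Suc mac_low_Suc_binomial_lt[of 0 k e'] by (simp add: zero_less_binomial_iff)
qed simp

lemma mac_low_binomial': "e \<le> k \<Longrightarrow> 0 < e \<Longrightarrow> mac_low e (k choose e) = (k - 1) choose e"
  using mac_low_Suc_binomial_lt[of 0 k "e - 1"] by (cases e) (auto simp add: zero_less_binomial_iff)

lemma mac_up_binomial: "e \<le> k \<Longrightarrow> 0 < e \<Longrightarrow> mac_up e (k choose e) = (k + 1) choose (e + 1)"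
  using mac_up_Suc_binomial_lt[of 0 k "e - 1"] 
  by (cases e) (auto simp del: binomial_Suc_Suc simp add: zero_less_binomial_iff)

text \<open>The recursion remains valid at the boundary \<open>r = binom(k, e)\<close>, where the greedy choice
  of \<open>k\<close> jumps.\<close>

lemma mac_low_Suc_binomial:
  assumes "r \<le> k choose e" "e < k"
  shows "mac_low (Suc e) ((k choose Suc e) + r) = ((k - 1) choose Suc e) + mac_low e r"
proof (cases "r = k choose e")
  case True
  then have "(k choose Suc e) + r = Suc k choose Suc e" by simp
  then have "mac_low (Suc e) ((k choose Suc e) + r) = k choose Suc e"
    using mac_low_binomial[of "Suc e" "Suc k"] assms by (simp del: binomial_Suc_Suc)
  also have "\<dots> = ((k - 1) choose Suc e) + ((k - 1) choose e)"
    using assms by (cases k) auto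
  also have "\<dots> = ((k - 1) choose Suc e) + mac_low e r"
    using True mac_low_binomial[of e k] assms by simp
  finally show ?thesis .
qed (use assms mac_low_Suc_binomial_lt in auto)

text \<open>The boundary case fails for \<open>e = 0\<close>, \<open>r = 1\<close>: the left side is
  then \<open>(k + 2) choose 2\<close>, while \<open>mac_up 0 1 = 0\<close>. For
  \<open>mac_low\<close> the value \<open>mac_low 0 1 = 1\<close> repairs this.\<close>

lemma mac_up_Suc_binomial:
  assumes "r \<le> k choose e" "e < k" "0 < e"
  shows "mac_up (Suc e) ((k choose Suc e) + r) = ((k + 1) choose (e + 2)) + mac_up e r"
proof (cases "r = k choose e")
  case True
  then have "(k choose Suc e) + r = Suc k choose Suc e" by simp
  then have "mac_up (Suc e) ((k choose Suc e) + r) = Suc (Suc k) choose Suc (Suc e)"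
    using mac_up_binomial[of "Suc e" "Suc k"] assms by (simp del: binomial_Suc_Suc)
  also have "\<dots> = (Suc k choose Suc (Suc e)) + (Suc k choose Suc e)" by simp
  also have "\<dots> = ((k + 1) choose (e + 2)) + mac_up e r"
    using True mac_up_binomial[of e k] assms by (simp del: binomial_Suc_Suc)
  finally show ?thesis .
qed (use assms mac_up_Suc_binomial_lt in auto)

lemma mac_low_Suc_0: "mac_low (Suc 0) c = c - 1"
proof (cases c)
  case (Suc c')
  then show ?thesis using mac_low_Suc_binomial_lt[of 0 c 0] by simp
qed simp

lemma mac_up_Suc_0: "mac_up (Suc 0) c = (c + 1) choose 2"
proof (cases c)
  case (Suc c')
  then show ?thesis using mac_up_Suc_binomial_lt[of 0 c 0] by (simp add: numeral_2_eq_2)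
qed simp

text \<open>Passing from \<open>c\<close> to \<open>Suc c\<close> turns \<open>r\<close> into
  \<open>Suc r \<le> k choose e\<close>. The recursion is valid up to this boundary, so
  \<open>k\<close> stays and the claim descends to degree \<open>e\<close>.\<close>

lemma mac_low_step: "mac_low e c \<le> mac_low e (Suc c) \<and> mac_low e (Suc c) \<le> Suc (mac_low e c)"
proof (induction e arbitrary: c)
  case (Suc e)
  show ?case
  proof (cases "c = 0")
    case True
    have "mac_low (Suc e) 1 = 0" using mac_low_binomial'[of "Suc e" "Suc e"] by simp
    then show ?thesis using True by simp
  next
    case False
    then obtain k r where kr: "c = (k choose Suc e) + r" "r < k choose e" "e < k"
      using binomial_decomposition by blast
    have "mac_low (Suc e) c = ((k - 1) choose Suc e) + mac_low e r"
      using kr mac_low_Suc_binomial[of r k e] by simp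
    moreover have "mac_low (Suc e) (Suc c) = ((k - 1) choose Suc e) + mac_low e (Suc r)"
      using kr mac_low_Suc_binomial[of "Suc r" k e] by simp
    ultimately show ?thesis using Suc by simp
  qed
qed simp

lemma mac_low_mono: "a \<le> b \<Longrightarrow> mac_low e a \<le> mac_low e b"
  using mac_low_step lift_Suc_mono_le[of "mac_low e"] by blast

lemma diff_mac_low_mono: "a \<le> b \<Longrightarrow> int a - mac_low e a \<le> int b - mac_low e b"
proof (rule lift_Suc_mono_le[of "\<lambda>c. int c - mac_low e c"])
  show "int c - mac_low e c \<le> int (Suc c) - mac_low e (Suc c)" for c
    using mac_low_step[of e c] by linarith
qed

lemma mac_low_le: "mac_low e c \<le> c"
  using diff_mac_low_mono[of 0 c e] by simp

lemma mac_low_less: "0 < e \<Longrightarrow> 0 < c \<Longrightarrow> mac_low e c < c"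
proof -
  assume "0 < e" "0 < c"
  moreover have "mac_low e 1 = 0" using mac_low_binomial'[of e e] \<open>0 < e\<close> by simp
  ultimately show ?thesis using diff_mac_low_mono[of 1 c e] by simp
qed

text \<open>By monotonicity only the largest \<open>r\<close>, one below \<open>k choose e\<close>,
  has to be treated. Its expansion starts with \<open>k - 1\<close> and leaves a remainder that is
  again one below a binomial coefficient.\<close>

lemma mac_low_less_binomial:
  assumes "r < k choose e" "e < k"
  shows "mac_low e r < (k - 1) choose e"
  using assms
proof (induction e arbitrary: k r)
  case (Suc e)
  have k1: "(k - 1) choose Suc e = ((k - 2) choose Suc e) + ((k - 2) choose e)"
    using Suc.prems by (intro binomial_pascal2) simp
  have k: "k choose Suc e = ((k - 1) choose Suc e) + ((k - 1) choose e)"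
    using Suc.prems by (cases k) auto
  have pos: "0 < (k - 1) choose e" using Suc.prems by (simp add: zero_less_binomial_iff)
  define q where "q = ((k - 1) choose e) - 1"
  have "r \<le> ((k - 1) choose Suc e) + q" using Suc.prems k pos q_def by linarith
  then have "mac_low (Suc e) r \<le> mac_low (Suc e) (((k - 1) choose Suc e) + q)" by (rule mac_low_mono)
  also have "\<dots> = ((k - 2) choose Suc e) + mac_low e q"
    using mac_low_Suc_binomial[of q "k - 1" e] Suc.prems q_def by (simp add: numeral_2_eq_2)
  also have "\<dots> < ((k - 2) choose Suc e) + ((k - 2) choose e)"
    using Suc.IH[of q "k - 1"] Suc.prems q_def pos by (simp add: numeral_2_eq_2)
  finally show ?case using k1 by simp
qed simp

lemma mac_up_mono_step: "mac_up (Suc e) c \<le> mac_up (Suc e) (Suc c)"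
proof (induction e arbitrary: c)
  case 0
  show ?case by (simp add: mac_up_Suc_0 binomial_right_mono)
next
  case (Suc e)
  have mono: "mac_up (Suc e) a \<le> mac_up (Suc e) b" if "a \<le> b" for a b
    using Suc lift_Suc_mono_le[of "mac_up (Suc e)"] that by blast
  show ?case
  proof (cases "c = 0")
    case False
    then obtain k r where kr: "c = (k choose Suc (Suc e)) + r" "r < k choose Suc e" "Suc e < k"
      using binomial_decomposition by blast
    have "mac_up (Suc (Suc e)) c = ((k + 1) choose (Suc e + 2)) + mac_up (Suc e) r"
      using kr mac_up_Suc_binomial[of r k "Suc e"] by simp
    moreover have "mac_up (Suc (Suc e)) (Suc c) = ((k + 1) choose (Suc e + 2)) + mac_up (Suc e) (Suc r)"
      using kr mac_up_Suc_binomial[of "Suc r" k "Suc e"] by simp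
    ultimately show ?thesis using mono by simp
  qed simp
qed

lemma mac_up_mono: "a \<le> b \<Longrightarrow> mac_up e a \<le> mac_up e b"
  using mac_up_mono_step lift_Suc_mono_le[of "mac_up e"] by (cases e) auto

text \<open>The numerical half of the restriction theorem: \<open>a\<close> is the codimension of a generic
  hyperplane section.\<close>

lemma mac_low_add_mac_low_less:
  assumes "mac_low (Suc e) c < a" "a \<le> c"
  shows "mac_low (Suc e) a + mac_low e (c - a) < a"
  using assms
proof (induction e arbitrary: c a)
  case 0
  then show ?case by (simp add: mac_low_Suc_0)
next
  case (Suc e)
  let ?d = "Suc (Suc e)"
  \<comment> \<open>The smallest admissible \<open>a\<close> suffices: as \<open>a\<close> grows,
    \<open>a - mac_low ?d a\<close> does not decrease and \<open>mac_low (Suc e) (c - a)\<close>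
    does not increase.\<close>
  define a0 where "a0 = Suc (mac_low ?d c)"
  have a0: "a0 \<le> a" "mac_low ?d c < a0" "a0 \<le> c" using Suc.prems a0_def by auto
  obtain k r where kr: "c = (k choose ?d) + r" "r < k choose Suc e" "Suc e < k"
    using binomial_decomposition[of c "Suc e"] a0 by auto
  have lc: "mac_low ?d c = ((k - 1) choose ?d) + mac_low (Suc e) r"
    using kr mac_low_Suc_binomial[of r k "Suc e"] by simp
  have kd: "k choose ?d = ((k - 1) choose ?d) + ((k - 1) choose Suc e)"
    using kr by (cases k) auto
  have ke: "k choose Suc e = ((k - 1) choose Suc e) + ((k - 1) choose e)"
    using kr by (cases k) auto
  have "mac_low ?d a0 + mac_low (Suc e) (c - a0) < a0"
  proof (cases "k = ?d")
    case True
    have c: "c = Suc r" using kr True by simp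
    have lr: "mac_low (Suc e) r = 0"
      using mac_low_less_binomial[of r k "Suc e"] kr True by simp
    have "a0 = 1" using a0_def lc lr True by simp
    moreover have "mac_low ?d 1 = 0" using mac_low_binomial'[of ?d ?d] by simp
    ultimately show ?thesis using c lr by simp
  next
    case False
    then have k: "?d < k" using kr by simp
    have k2: "(k - 1) choose ?d = ((k - 2) choose ?d) + ((k - 2) choose Suc e)"
      using k by (intro binomial_pascal2) simp
    \<comment> \<open>\<open>b\<close> is for \<open>r\<close>, one degree lower, what
      \<open>a0\<close> is for \<open>c\<close>. Pascal's rule splits the leading terms off
      \<open>a0\<close> and \<open>c - a0\<close>.\<close>
    define b where "b = Suc (mac_low (Suc e) r)"
    have ab: "a0 = ((k - 1) choose ?d) + b" using a0_def lc b_def by simp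
    have ble: "b \<le> (k - 1) choose Suc e"
      using mac_low_less_binomial[of r k "Suc e"] kr b_def by simp
    have la: "mac_low ?d a0 = ((k - 2) choose ?d) + mac_low (Suc e) b"
      using mac_low_Suc_binomial[of b "k - 1" "Suc e"] ble k ab by (simp add: numeral_2_eq_2)
    show ?thesis
    proof (cases "r = 0")
      \<comment> \<open>Here \<open>b = 1 > r\<close>, so the induction hypothesis does not apply to
        \<open>r\<close> and \<open>b\<close>. Strictness comes from \<open>c - a0\<close>, which is
        one below \<open>(k - 1) choose Suc e\<close>.\<close>
      case True
      then have b1: "b = 1" using b_def by simp
      have "c - a0 = ((k - 1) choose Suc e) - 1" using kr True ab kd b1 by simp
      moreover have "0 < (k - 1) choose Suc e" using k by (simp add: zero_less_binomial_iff)
      ultimately have "mac_low (Suc e) (c - a0) < (k - 2) choose Suc e"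
        using mac_low_less_binomial[of "c - a0" "k - 1" "Suc e"] k by (simp add: numeral_2_eq_2)
      then show ?thesis using la ab k2 b1 mac_low_le[of "Suc e" 1] by simp
    next
      case False
      have br: "b \<le> r" using mac_low_less[of "Suc e" r] False b_def by simp
      have "int r - mac_low (Suc e) r \<le> int (k choose Suc e) - mac_low (Suc e) (k choose Suc e)"
        using diff_mac_low_mono kr by simp
      then have rb: "r - b \<le> (k - 1) choose e"
        using mac_low_binomial[of "Suc e" k] kr(3) ke b_def by linarith
      have "c - a0 = ((k - 1) choose Suc e) + (r - b)" using kr ab kd br by simp
      then have "mac_low (Suc e) (c - a0) = ((k - 2) choose Suc e) + mac_low e (r - b)"
        using mac_low_Suc_binomial[of "r - b" "k - 1" e] rb k by (simp add: numeral_2_eq_2)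
      moreover have "mac_low (Suc e) b + mac_low e (r - b) < b"
        using Suc.IH[of r b] br b_def by simp
      ultimately show ?thesis using la ab k2 by simp
    qed
  qed
  moreover have "int a0 - mac_low ?d a0 \<le> int a - mac_low ?d a" using diff_mac_low_mono a0 by blast
  moreover have "mac_low (Suc e) (c - a) \<le> mac_low (Suc e) (c - a0)" by (intro mac_low_mono) (use a0 in simp)
  ultimately show ?case by linarith
qed

text \<open>Turns the restriction inequality into Macaulay's bound. Let
  \<open>d = Suc (Suc e)\<close> in the induction step. Comparing leading terms leaves
  \<open>c \<ge> ((k - 1) choose d) + s\<close> with \<open>s = r - mac_low d r\<close>. Under
  \<open>mac_up\<close> the first summand becomes \<open>k choose Suc d\<close>, and the induction
  hypothesis bounds \<open>r\<close> by \<open>mac_up (Suc e) s\<close>.\<close>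

lemma le_mac_up_of_le_add_mac_low:
  assumes "c' \<le> c + mac_low (Suc (Suc e)) c'"
  shows "c' \<le> mac_up (Suc e) c"
  using assms
proof (induction e arbitrary: c c')
  case 0
  show ?case
  proof (cases "c' = 0")
    case False
    then obtain k r where kr: "c' = (k choose 2) + r" "r < k" "1 < k"
      using binomial_decomposition[of c' 1] by (auto simp: numeral_2_eq_2)
    have "mac_low (Suc (Suc 0)) c' = ((k - 1) choose 2) + mac_low (Suc 0) r"
      using mac_low_Suc_binomial[of r k 1] kr by (simp add: numeral_2_eq_2)
    moreover have "k choose 2 = ((k - 1) choose 2) + (k - 1)"
      using kr by (cases k) (auto simp: numeral_2_eq_2)
    ultimately have "c \<ge> k - 1 + (r - mac_low (Suc 0) r)"
      using 0 kr mac_low_le[of "Suc 0" r] by linarith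
    \<comment> \<open>\<open>r - mac_low (Suc 0) r\<close> is 0 for \<open>r = 0\<close> and 1
      otherwise.\<close>
    then have "c + 1 \<ge> k + (if r = 0 then 0 else 1)"
      using kr by (cases r) (auto simp: mac_low_Suc_0)
    then have "(c + 1) choose 2 \<ge> (k + (if r = 0 then 0 else 1)) choose 2"
      by (rule binomial_right_mono)
    moreover have "(k + (if r = 0 then 0 else 1)) choose 2 \<ge> c'"
      using kr by (auto simp: numeral_2_eq_2)
    ultimately show ?thesis by (simp add: mac_up_Suc_0)
  qed simp
next
  case (Suc e)
  let ?d = "Suc (Suc e)"
  show ?case
  proof (cases "c' = 0")
    case False
    then obtain k r where kr: "c' = (k choose Suc ?d) + r" "r < k choose ?d" "?d < k"
      using binomial_decomposition[of c' ?d] by auto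
    have l: "mac_low (Suc ?d) c' = ((k - 1) choose Suc ?d) + mac_low ?d r"
      using mac_low_Suc_binomial[of r k ?d] kr by simp
    have kd: "k choose Suc ?d = ((k - 1) choose Suc ?d) + ((k - 1) choose ?d)"
      using kr by (cases k) auto
    have ke: "k choose ?d = ((k - 1) choose ?d) + ((k - 1) choose Suc e)"
      using kr by (cases k) auto
    define s where "s = r - mac_low ?d r"
    have c: "((k - 1) choose ?d) + s \<le> c"
      using Suc.prems kr l kd s_def mac_low_le[of ?d r] by linarith
    have "int r - mac_low ?d r \<le> int (k choose ?d) - mac_low ?d (k choose ?d)"
      using diff_mac_low_mono kr by simp
    \<comment> \<open>This is exactly the range, boundary included, in which
      \<open>mac_up_Suc_binomial\<close> applies.\<close>
    then have s: "s \<le> (k - 1) choose Suc e"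
      using mac_low_binomial[of ?d k] kr(3) ke s_def by linarith
    have "r \<le> s + mac_low ?d r" using s_def by simp
    then have "r \<le> mac_up (Suc e) s" by (rule Suc.IH)
    moreover have "mac_up ?d (((k - 1) choose ?d) + s) = (k choose Suc ?d) + mac_up (Suc e) s"
      using mac_up_Suc_binomial[of s "k - 1" "Suc e"] s kr by simp
    ultimately have "c' \<le> mac_up ?d (((k - 1) choose ?d) + s)" using kr by simp
    also have "\<dots> \<le> mac_up ?d c" using c by (rule mac_up_mono)
    finally show ?thesis .
  qed simp
qed

section \<open>Agreement of the greedy recursion with \<open>macaulay_rep\<close>\<close>

lemma macaulay_rep_less:
  assumes "macaulay_rep e c \<delta> k"
  shows "c < Suc (k e) choose e"
  using assms
proof (induction e arbitrary: c)
  case (Suc e)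
  note rep = Suc.prems[unfolded macaulay_rep_def]
  show ?case
  proof (cases "\<delta> = Suc e")
    case True
    then show ?thesis using rep by (auto simp: zero_less_binomial_iff)
  next
    case False
    then have de: "\<delta> \<le> e" using rep by simp
    define c' where "c' = (\<Sum>i = \<delta>..e. k i choose i)"
    have "macaulay_rep e c' \<delta> k"
      using rep de c'_def by (auto simp: macaulay_rep_def strict_mono_on_def)
    then have "c' < Suc (k e) choose e" by (rule Suc.IH)
    also have "\<dots> \<le> k (Suc e) choose e"
      using rep de by (intro binomial_right_mono) (auto simp: strict_mono_on_def Suc_le_eq)
    finally show ?thesis using rep de c'_def by simp
  qed
qed (auto simp: macaulay_rep_def)

lemma macaulay_rep_ge: "macaulay_rep e c \<delta> k \<Longrightarrow> e \<le> k e"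
proof (induction e arbitrary: c)
  case (Suc e)
  note rep = Suc.prems[unfolded macaulay_rep_def]
  show ?case
  proof (cases "\<delta> = Suc e")
    case False
    then have de: "\<delta> \<le> e" using rep by simp
    then have "macaulay_rep e (\<Sum>i = \<delta>..e. k i choose i) \<delta> k"
      using rep by (auto simp: macaulay_rep_def strict_mono_on_def)
    then have "e \<le> k e" by (rule Suc.IH)
    also have "k e < k (Suc e)" using rep de by (auto simp: strict_mono_on_def)
    finally show ?thesis by simp
  qed (use rep in auto)
qed simp

text \<open>Every representation is greedy: by \<open>macaulay_rep_less\<close> the terms below the
  top one add up to less than \<open>k (Suc e) choose e\<close>, so \<open>k (Suc e)\<close> is the
  number that \<open>GREATEST\<close> selects. This is the uniqueness behind \<open>THE\<close> in
  \<open>macaulay_up\<close>.\<close>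

lemma macaulay_rep_mac_up:
  "macaulay_rep e c \<delta> k \<Longrightarrow> (\<Sum>i = \<delta>..e. (k i + 1) choose (i + 1)) = mac_up e c"
proof (induction e arbitrary: c)
  case 0
  then show ?case by (auto simp: macaulay_rep_def)
next
  case (Suc e)
  note rep = Suc.prems[unfolded macaulay_rep_def]
  have kge: "Suc e \<le> k (Suc e)" using macaulay_rep_ge[OF Suc.prems] .
  show ?case
  proof (cases "\<delta> = Suc e")
    case True
    then show ?thesis
      using rep mac_up_binomial[of "Suc e" "k (Suc e)"] by (simp del: binomial_Suc_Suc)
  next
    case False
    then have de: "\<delta> \<le> e" using rep by simp
    define c' where "c' = (\<Sum>i = \<delta>..e. k i choose i)"
    have rep': "macaulay_rep e c' \<delta> k"
      using rep de c'_def by (auto simp: macaulay_rep_def strict_mono_on_def)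
    have "c' < Suc (k e) choose e" using macaulay_rep_less[OF rep'] .
    also have "\<dots> \<le> k (Suc e) choose e"
      using rep de by (intro binomial_right_mono) (auto simp: strict_mono_on_def Suc_le_eq)
    finally have "c' < k (Suc e) choose e" .
    moreover have "c = (k (Suc e) choose Suc e) + c'" using rep de c'_def by simp
    ultimately have "mac_up (Suc e) c = ((k (Suc e) + 1) choose (e + 2)) + mac_up e c'"
      using kge mac_up_Suc_binomial_lt by simp
    then show ?thesis using Suc.IH[OF rep'] de by simp
  qed
qed

lemma macaulay_rep_exists:
  assumes "0 < c" "0 < e"
  shows "\<exists>\<delta> k. macaulay_rep e c \<delta> k"
  using assms
proof (induction e arbitrary: c)
  case (Suc e)
  obtain k r where kr: "c = (k choose Suc e) + r" "r < k choose e" "e < k"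
    using binomial_decomposition[of c e] Suc.prems by auto
  show ?case
  proof (cases "r = 0")
    case True
    then have "macaulay_rep (Suc e) c (Suc e) (\<lambda>_. k)"
      using kr by (simp add: macaulay_rep_def strict_mono_on_def)
    then show ?thesis by blast
  next
    case False
    have "e \<noteq> 0" using kr False by (cases e) auto
    then obtain \<delta> k' where rep': "macaulay_rep e r \<delta> k'" using Suc.IH[of r] False by auto
    note rep = rep'[unfolded macaulay_rep_def]
    have "k' e choose e \<le> r"
      using rep by (auto intro!: member_le_sum[of e "{\<delta>..e}" "\<lambda>i. k' i choose i"])
    then have "k' e < k"
      using kr binomial_right_mono[of k "k' e" e] by (meson le_trans not_le)
    moreover have "k' i \<le> k' e" if "i \<in> {\<delta>..e}" for i
      using rep that by (cases "i = e") (auto simp: strict_mono_on_def intro!: less_imp_le)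
    ultimately have lt: "k' i < k" if "i \<in> {\<delta>..e}" for i
      using that by fastforce
    let ?k = "k'(Suc e := k)"
    have "strict_mono_on {\<delta>..Suc e} ?k"
      using rep lt by (auto simp: strict_mono_on_def)
    moreover have "c = (\<Sum>i = \<delta>..Suc e. ?k i choose i)"
      using rep kr by simp
    ultimately have "macaulay_rep (Suc e) c \<delta> ?k"
      using rep by (simp add: macaulay_rep_def)
    then show ?thesis by blast
  qed
qed simp

lemma macaulay_up_eq_mac_up:
  assumes "0 < e"
  shows "macaulay_up e c = mac_up e c"
proof (cases "c = 0")
  case False
  then obtain \<delta> k where "macaulay_rep e c \<delta> k" using macaulay_rep_exists assms by blast
  moreover from this have "mac_up e c = (\<Sum>i = \<delta>..e. (k i + 1) choose (i + 1))"
    by (rule macaulay_rep_mac_up[symmetric])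
  ultimately have "(THE b. \<exists>\<delta> k. macaulay_rep e c \<delta> k \<and>
      b = (\<Sum>i = \<delta>..e. (k i + 1) choose (i + 1))) = mac_up e c"
  proof (intro the_equality)
    fix b
    assume "\<exists>\<delta> k. macaulay_rep e c \<delta> k \<and> b = (\<Sum>i = \<delta>..e. (k i + 1) choose (i + 1))"
    then show "b = mac_up e c" by (metis macaulay_rep_mac_up)
  qed blast
  then show ?thesis using False by (simp add: macaulay_up_def)
qed (simp add: macaulay_up_def)

section \<open>Finite-dimensional subspaces\<close>

context vector_space
begin

lemma finite_basis_exists:
  assumes "V \<subseteq> span W" "finite W"
  obtains B where "B \<subseteq> V" "independent B" "V \<subseteq> span B" "finite B" "card B = dim V"
proof -
  obtain B where B: "B \<subseteq> V" "independent B" "V \<subseteq> span B" "card B = dim V"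
    using basis_exists[of V] by blast
  moreover have "finite B"
    using independent_span_bound[OF assms(2) B(2)] B(1) assms(1) by blast
  ultimately show thesis using that by blast
qed

lemma dim_mono_finite:
  assumes "A \<subseteq> span B" "B \<subseteq> span W" "finite W"
  shows "dim A \<le> dim B"
proof -
  obtain C where C: "C \<subseteq> B" "independent C" "B \<subseteq> span C" "finite C" "card C = dim B"
    using finite_basis_exists[OF assms(2,3)] by blast
  have "A \<subseteq> span C" using assms(1) C(3) span_minimal[OF _ subspace_span] by blast
  then show ?thesis using dim_le_card C by metis
qed

lemma card_le_dim_finite:
  assumes "C \<subseteq> V" "independent C" "V \<subseteq> span W" "finite W"
  shows "finite C" "card C \<le> dim V"
proof -
  have "C \<subseteq> span W" using assms(1,3) by (rule subset_trans)
  then show "finite C" using independent_span_bound[OF assms(4,2)] by simp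
  have "C \<subseteq> span V" using assms(1) span_superset by (rule subset_trans)
  then have "dim C \<le> dim V" using assms(3,4) by (rule dim_mono_finite)
  then show "card C \<le> dim V" by (simp only: dim_eq_card_independent[OF assms(2)])
qed

lemma dim_eq_imp_eq:
  assumes "subspace A" "A \<subseteq> B" "B \<subseteq> span W" "finite W" "dim B \<le> dim A"
  shows "A = B"
proof (rule ccontr)
  assume "A \<noteq> B"
  then obtain x where x: "x \<in> B" "x \<notin> A" using assms(2) by blast
  have "A \<subseteq> span W" using assms(2,3) by (rule subset_trans)
  then obtain C where C: "C \<subseteq> A" "independent C" "A \<subseteq> span C" "finite C" "card C = dim A"
    using finite_basis_exists[OF _ assms(4)] by blast
  have "span C \<subseteq> A" using C assms(1) by (simp add: span_minimal)
  then have xC: "x \<notin> span C" using x(2) by blast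
  then have "independent (insert x C)" using C by (simp add: independent_insertI)
  moreover have "insert x C \<subseteq> B" using C(1) x(1) assms(2) by blast
  ultimately have "card (insert x C) \<le> dim B" using card_le_dim_finite(2) assms(3,4) by simp
  moreover have "x \<notin> C" using xC span_base by blast
  ultimately show False using C assms(5) by simp
qed

text \<open>A family and not a set, because perturbed vectors may coincide and a set would hide that
  dependence.\<close>

definition family_independent :: "'i set \<Rightarrow> ('i \<Rightarrow> 'b) \<Rightarrow> bool" where
  "family_independent I v \<longleftrightarrow>
     (\<forall>a. (\<Sum>i\<in>I. a i *s v i) = 0 \<longrightarrow> (\<forall>i\<in>I. a i = 0))"

lemma family_independentD:
  assumes "local.family_independent I v" "finite I"
  shows "inj_on v I" "independent (v ` I)"
proof -
  show inj: "inj_on v I"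
  proof (rule inj_onI, rule ccontr)
    fix i j assume ij: "i \<in> I" "j \<in> I" "v i = v j" "i \<noteq> j"
    let ?a = "\<lambda>k. if k = i then (1::'a) else if k = j then -1 else 0"
    have "(\<Sum>k\<in>I. ?a k *s v k) = (\<Sum>k\<in>{i, j}. ?a k *s v k)"
      using assms(2) ij by (intro sum.mono_neutral_right) auto
    also have "\<dots> = 0" using ij by simp
    finally have "?a i = 0" using assms(1)[unfolded local.family_independent_def, rule_format, of ?a i] ij(1) by blast
    then show False by simp
  qed
  show "independent (v ` I)"
  proof (rule independent_if_scalars_zero)
    show "finite (v ` I)" using assms(2) by simp
    fix f x assume f: "(\<Sum>x\<in>v ` I. f x *s x) = 0" and x: "x \<in> v ` I"
    have "(\<Sum>i\<in>I. f (v i) *s v i) = 0" using f inj by (simp add: sum.reindex)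
    then show "f x = 0"
      using assms(1)[unfolded local.family_independent_def, rule_format, of "\<lambda>i. f (v i)"] x by auto
  qed
qed

lemma family_independentI:
  assumes "independent B" "finite B"
  shows "local.family_independent B (\<lambda>b. b)"
  using independentD[OF assms subset_refl] unfolding local.family_independent_def by blast

lemma independent_eigenvectors:
  assumes B: "Vector_Spaces.linear scale scale B" and "finite X"
    and "\<And>x. x \<in> X \<Longrightarrow> x \<noteq> 0 \<and> B x = \<mu> x *s x" and "inj_on \<mu> X"
  shows "independent X"
  using assms(2-)
proof (induction X rule: finite_induct)
  case (insert y X)
  interpret B: Vector_Spaces.linear scale scale B by fact
  have ind: "independent X" using insert by simp
  have "y \<notin> span X"
  proof
    assume "y \<in> span X"
    then obtain c where c: "y = (\<Sum>x\<in>X. c x *s x)" using insert(1) by (auto simp: span_finite)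
    have "B y = (\<Sum>x\<in>X. c x *s \<mu> x *s x)"
      using insert.prems by (simp add: c B.sum B.scale)
    moreover have "B y = \<mu> y *s (\<Sum>x\<in>X. c x *s x)"
      using insert.prems(1)[of y] c by simp
    ultimately have "(\<Sum>x\<in>X. (c x * (\<mu> x - \<mu> y)) *s x) = 0"
      by (simp add: algebra_simps sum_subtractf scale_sum_right)
    then have "c x * (\<mu> x - \<mu> y) = 0" if "x \<in> X" for x
      using independentD[OF ind insert(1) subset_refl, of "\<lambda>x. c x * (\<mu> x - \<mu> y)"] that by blast
    moreover have "\<mu> x \<noteq> \<mu> y" if "x \<in> X" for x
      using insert.prems(2) insert(2) that by (auto simp: inj_on_def)
    ultimately have "y = 0" using c by simp
    then show False using insert.prems by blast
  qed
  then show ?case using ind by (rule independent_insertI)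
qed (simp add: independent_empty)

text \<open>After projection to the span of the \<open>v i\<close>, a value \<open>t\<close> at which independence is lost
  gives the eigenvalue \<open>- 1 / t\<close> of a fixed operator on that span.\<close>

lemma finite_dependent_perturbations:
  assumes ind: "local.family_independent I v" and I: "finite I"
  shows "finite {t. \<not> local.family_independent I (\<lambda>i. v i + t *s w i)}" (is "finite ?T")
proof (rule ccontr)
  assume "infinite ?T"
  then have "infinite (?T - {0})" by simp
  from infinite_arbitrarily_large[OF this, of "Suc (card I)"]
  \<comment> \<open>One value more than there are vectors \<open>v i\<close>: the eigenvectors for
    these values would be independent in a span of smaller dimension.\<close>
  obtain T where T: "finite T" "T \<subseteq> ?T - {0}" "card T = Suc (card I)"
    by (elim exE conjE) (rule that)
  interpret vp: vector_space_pair scale scale by unfold_locales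
  note vI = family_independentD[OF ind I]
  \<comment> \<open>\<open>\<pi>\<close> fixes the \<open>v i\<close>, and \<open>B\<close> sends
    \<open>v i\<close> to \<open>\<pi> (w i)\<close>. Applied to a relation with coefficients
    \<open>a i\<close> at the value \<open>t\<close>, \<open>\<pi>\<close> gives
    \<open>x + t B x = 0\<close> for the combination \<open>x\<close> of the \<open>v i\<close> with
    the same coefficients.\<close>
  define \<pi> where "\<pi> = vp.construct (v ` I) id"
  define B where "B = vp.construct (v ` I) (\<lambda>u. \<pi> (w (inv_into I v u)))"
  interpret \<pi>: Vector_Spaces.linear scale scale \<pi> unfolding \<pi>_def by (rule vp.linear_construct[OF vI(2)])
  have B_lin: "Vector_Spaces.linear scale scale B" unfolding B_def by (rule vp.linear_construct[OF vI(2)])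
  interpret B: Vector_Spaces.linear scale scale B by (rule B_lin)
  have \<pi>v: "\<pi> (v i) = v i" if "i \<in> I" for i
    unfolding \<pi>_def using vp.construct_basis[OF vI(2)] that by simp
  have Bv: "B (v i) = \<pi> (w i)" if "i \<in> I" for i
    unfolding B_def using vp.construct_basis[OF vI(2)] that vI(1) by simp
  have "\<exists>x. x \<in> span (v ` I) \<and> x \<noteq> 0 \<and> B x = (- 1 / t) *s x" if t: "t \<in> T" for t
  proof -
    have "t \<noteq> 0" and "\<not> local.family_independent I (\<lambda>i. v i + t *s w i)" using T t by auto
    then obtain a i where a: "(\<Sum>i\<in>I. a i *s (v i + t *s w i)) = 0" "i \<in> I" "a i \<noteq> 0"
      unfolding local.family_independent_def by blast
    define x where "x = (\<Sum>i\<in>I. a i *s v i)"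
    have "0 = \<pi> (\<Sum>i\<in>I. a i *s (v i + t *s w i))" using a(1) \<pi>.zero by simp
    also have "\<dots> = (\<Sum>i\<in>I. a i *s v i + t *s a i *s B (v i))"
      by (simp add: \<pi>.sum \<pi>.scale \<pi>.add \<pi>v Bv scale_right_distrib mult.commute)
    also have "\<dots> = x + t *s B x"
      by (simp add: x_def B.sum B.scale sum.distrib scale_sum_right)
    finally have "t *s B x = - x" by (simp add: add_eq_0_iff)
    then have "(1 / t) *s t *s B x = (1 / t) *s (- x)" by (rule arg_cong)
    then have "B x = (- 1 / t) *s x" using \<open>t \<noteq> 0\<close> by simp
    moreover have "x \<noteq> 0" using ind[unfolded local.family_independent_def, rule_format, of a i] a(2,3) x_def by metis
    moreover have "x \<in> span (v ` I)" unfolding x_def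
      by (intro span_sum span_scale span_base) auto
    ultimately show ?thesis by blast
  qed
  then have "\<forall>t\<in>T. \<exists>x. x \<in> span (v ` I) \<and> x \<noteq> 0 \<and> B x = (- 1 / t) *s x"
    by blast
  from bchoice[OF this] obtain x
    where x: "\<And>t. t \<in> T \<Longrightarrow> x t \<in> span (v ` I) \<and> x t \<noteq> 0 \<and> B (x t) = (- 1 / t) *s x t"
    by blast
  have inj: "inj_on x T"
  proof (rule inj_onI)
    fix s t assume st: "s \<in> T" "t \<in> T" "x s = x t"
    have "(- 1 / s) *s x s = (- 1 / t) *s x s"
      using x[OF st(1)] x[OF st(2)] unfolding st(3) by argo
    then have "- 1 / s = - 1 / t" using x[OF st(1)] by (simp only: scale_cancel_right) blast
    then show "s = t" by simp
  qed
  have "independent (x ` T)"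
  proof (rule independent_eigenvectors[OF B_lin, where \<mu> = "\<lambda>y. - 1 / inv_into T x y"])
    show "inj_on (\<lambda>y. - 1 / inv_into T x y) (x ` T)"
      by (rule inj_onI) (auto simp: inj)
    fix y assume "y \<in> x ` T"
    then obtain t where t: "t \<in> T" "y = x t" by blast
    then show "y \<noteq> 0 \<and> B y = (- 1 / inv_into T x y) *s y" using x inj by simp
  qed (use T in simp)
  moreover have "x ` T \<subseteq> span (v ` I)" using x by blast
  ultimately have "card (x ` T) \<le> card (v ` I)"
    using independent_span_bound[of "v ` I" "x ` T"] I by simp
  then show False using T card_image[OF inj] card_image[OF vI(1)] by simp
qed

end

context vector_space_pair
begin

text \<open>Rank-nullity for a map that is additive only on \<open>U\<close>. The coordinate
  functions in \<open>dim_free_quotient\<close> are of this kind, as nothing is known of them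
  outside an ideal.\<close>

lemma dim_kernel_plus_dim_image:
  assumes U: "vs1.subspace U" "U \<subseteq> vs1.span W" "finite W"
    and add: "\<And>x y. x \<in> U \<Longrightarrow> y \<in> U \<Longrightarrow> f (x + y) = f x + f y"
    and scale: "\<And>c x. x \<in> U \<Longrightarrow> f (c *a x) = c *b f x"
  shows "vs1.dim U = vs1.dim {x \<in> U. f x = 0} + vs2.dim (f ` U)"
proof -
  let ?K = "{x \<in> U. f x = 0}"
  obtain K where K: "K \<subseteq> ?K" "vs1.independent K" "?K \<subseteq> vs1.span K" "finite K" "card K = vs1.dim ?K"
    using vs1.finite_basis_exists[of ?K W] assms by blast
  obtain B where B: "K \<subseteq> B" "B \<subseteq> U" "vs1.independent B" "U \<subseteq> vs1.span B"
    using vs1.maximal_independent_subset_extend[of K U] K by blast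
  have fB: "finite B" using vs1.card_le_dim_finite(1)[OF B(2,3) U(2,3)] .
  have cB: "card B = vs1.dim U" using B vs1.basis_card_eq_dim by blast
  have f0: "f 0 = 0" using scale[of 0 0] U(1) vs1.subspace_0 by simp
  have fsum: "f (\<Sum>b\<in>A. a b *a b) = (\<Sum>b\<in>A. a b *b f b)" if "finite A" "A \<subseteq> U" for A a
    using that
  proof (induction A rule: finite_induct)
    case (insert x A)
    then have "(\<Sum>b\<in>A. a b *a b) \<in> U"
      using U(1) by (auto intro!: vs1.subspace_sum vs1.subspace_scale)
    then show ?case using insert U(1) by (simp add: add scale vs1.subspace_scale)
  qed (simp add: f0)
  have fam: "vs2.family_independent (B - K) f"
    unfolding vs2.family_independent_def
  proof (intro allI impI ballI)
    fix a b assume a: "(\<Sum>b\<in>B - K. a b *b f b) = 0" and b: "b \<in> B - K"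
    let ?x = "\<Sum>b\<in>B - K. a b *a b"
    have "f ?x = 0" using a fsum[of "B - K" a] fB B(2) by auto
    moreover have "?x \<in> U" using U(1) B(2) by (auto intro!: vs1.subspace_sum vs1.subspace_scale)
    ultimately have "?x \<in> vs1.span K" using K(3) by blast
    then obtain c where c: "?x = (\<Sum>b\<in>K. c b *a b)" using K(4) by (auto simp: vs1.span_finite)
    let ?d = "\<lambda>b. if b \<in> K then - c b else a b"
    have "(\<Sum>b\<in>B. ?d b *a b) = (\<Sum>b\<in>B - K. ?d b *a b) + (\<Sum>b\<in>K. ?d b *a b)"
      by (rule sum.subset_diff[OF B(1) fB])
    also have "\<dots> = 0" by (simp add: c vs1.scale_minus_left sum_negf)
    finally have "?d b = 0"
      using vs1.independentD[OF B(3) fB subset_refl, of ?d b] b by blast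
    then show "a b = 0" using b by simp
  qed
  have fBK: "finite (B - K)" using fB by simp
  note ind = vs2.family_independentD[OF fam fBK]
  have "f ` U \<subseteq> vs2.span (f ` (B - K))"
  proof
    fix y assume "y \<in> f ` U"
    then obtain x where x: "x \<in> U" "y = f x" by blast
    then obtain c where "x = (\<Sum>b\<in>B. c b *a b)" using B(4) fB by (auto simp: vs1.span_finite)
    then have "y = (\<Sum>b\<in>B. c b *b f b)" using x fsum[OF fB B(2)] by simp
    also have "\<dots> = (\<Sum>b\<in>B - K. c b *b f b) + (\<Sum>b\<in>K. c b *b f b)"
      by (rule sum.subset_diff[OF B(1) fB])
    also have "(\<Sum>b\<in>K. c b *b f b) = 0" using K(1) by (intro sum.neutral) auto
    finally have "y = (\<Sum>b\<in>B - K. c b *b f b)" by simp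
    then show "y \<in> vs2.span (f ` (B - K))"
      by (simp only:) (intro vs2.span_sum vs2.span_scale vs2.span_base imageI)
  qed
  then have dim_image: "card (f ` (B - K)) = vs2.dim (f ` U)"
    using ind B(2) by (intro vs2.basis_card_eq_dim) auto
  have "card (f ` (B - K)) = card B - card K"
    using card_image[OF ind(1)] card_Diff_subset[OF K(4) B(1)] by simp
  then have "card B = card K + card (f ` (B - K))"
    using card_mono[OF fB B(1)] by simp
  then show ?thesis by (simp only: cB K(5) dim_image)
qed

end

section \<open>Forms\<close>

definition scl :: "'k::field \<Rightarrow> 'k mpoly \<Rightarrow> 'k mpoly" where
  "scl c f = Poly_Mapping.single 0 c * f"

interpretation mp: vector_space scl
  by unfold_locales (simp_all add: scl_def distrib_left distrib_right single_add mult_single flip: mult.assoc)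

interpretation mpp: vector_space_pair scl scl ..

lemma scl_mult_left: "scl c f * g = scl c (f * g)"
  by (simp add: scl_def mult.assoc)

lemma scl_mult_right: "f * scl c g = scl c (f * g)"
  by (simp add: scl_def mult.left_commute)

lemma lookup_scl: "Poly_Mapping.lookup (scl c f) t = c * Poly_Mapping.lookup f t"
proof -
  have "Poly_Mapping.lookup (scl c f) t = Sum_any (\<lambda>l::nat \<Rightarrow>\<^sub>0 nat. if l = 0 then c * Poly_Mapping.lookup f t else 0)"
    unfolding scl_def Poly_Mapping.lookup_mult
    by (intro arg_cong[where f = Sum_any] ext) (auto simp: lookup_single when_def)
  also have "\<dots> = c * Poly_Mapping.lookup f t"
    using Sum_any_when_equal[of "\<lambda>_. c * Poly_Mapping.lookup f t" "0::nat \<Rightarrow>\<^sub>0 nat"] by (simp add: when_def)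
  finally show ?thesis .
qed

lemma keys_scl: "Poly_Mapping.keys (scl c f) \<subseteq> Poly_Mapping.keys f"
  by (auto simp: in_keys_iff lookup_scl)

lemma poly_mapping_sum_single:
  "f = (\<Sum>t\<in>Poly_Mapping.keys f. Poly_Mapping.single t (Poly_Mapping.lookup f t))"
proof (rule poly_mapping_eqI)
  fix s
  show "Poly_Mapping.lookup f s = Poly_Mapping.lookup (\<Sum>t\<in>Poly_Mapping.keys f. Poly_Mapping.single t (Poly_Mapping.lookup f t)) s"
    by (simp add: lookup_sum lookup_single when_def in_keys_iff)
qed

lemma single_eq_scl: "Poly_Mapping.single t c = scl c (Poly_Mapping.single t 1)"
  by (simp add: scl_def mult_single)

lemma mon_degree_superset:
  assumes "finite A" "Poly_Mapping.keys t \<subseteq> A"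
  shows "mon_degree t = (\<Sum>i\<in>A. Poly_Mapping.lookup t i)"
  unfolding mon_degree_def using assms by (intro sum.mono_neutral_left) (auto simp: in_keys_iff)

lemma mon_degree_add: "mon_degree (s + t) = mon_degree s + mon_degree t"
proof -
  let ?A = "Poly_Mapping.keys s \<union> Poly_Mapping.keys t"
  have "mon_degree (s + t) = (\<Sum>i\<in>?A. Poly_Mapping.lookup (s + t) i)"
    by (rule mon_degree_superset) (simp_all add: keys_add)
  also have "\<dots> = (\<Sum>i\<in>?A. Poly_Mapping.lookup s i) + (\<Sum>i\<in>?A. Poly_Mapping.lookup t i)"
    by (simp add: lookup_add sum.distrib)
  also have "\<dots> = mon_degree s + mon_degree t"
    by (simp add: mon_degree_superset[of ?A])
  finally show ?thesis .
qed

lemma mon_degree_0 [simp]: "mon_degree 0 = 0"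
  by (simp add: mon_degree_def)

lemma mon_degree_single [simp]: "mon_degree (Poly_Mapping.single i k) = k"
  by (simp add: mon_degree_def)

definition monomials :: "nat \<Rightarrow> nat \<Rightarrow> (nat \<Rightarrow>\<^sub>0 nat) set" where
  "monomials n l = {t. Poly_Mapping.keys t \<subseteq> {0..n} \<and> mon_degree t = l}"

definition forms :: "nat \<Rightarrow> nat \<Rightarrow> 'k::field mpoly set" where
  "forms n l = {f. Poly_Mapping.keys f \<subseteq> monomials n l}"

lemma finite_monomials: "finite (monomials n l)"
proof -
  have "monomials n l \<subseteq> (\<lambda>g. Abs_poly_mapping (\<lambda>i. if i \<in> {0..n} then g i else 0)) `
      ({0..n} \<rightarrow>\<^sub>E {0..l})"
  proof
    fix t assume t: "t \<in> monomials n l"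
    let ?g = "\<lambda>i\<in>{0..n}. Poly_Mapping.lookup t i"
    have "Poly_Mapping.lookup t i \<le> l" for i
    proof (cases "i \<in> Poly_Mapping.keys t")
      case True
      then have "Poly_Mapping.lookup t i \<le> mon_degree t"
        unfolding mon_degree_def by (intro member_le_sum) auto
      then show ?thesis using t by (simp add: monomials_def)
    qed (simp add: in_keys_iff)
    then have "?g \<in> {0..n} \<rightarrow>\<^sub>E {0..l}" by auto
    moreover have "t = Abs_poly_mapping (\<lambda>i. if i \<in> {0..n} then ?g i else 0)"
    proof -
      have "(\<lambda>i. if i \<in> {0..n} then ?g i else 0) = Poly_Mapping.lookup t"
        using t by (auto simp: monomials_def fun_eq_iff in_keys_iff)
      then show ?thesis by (simp add: lookup_inverse)
    qed
    ultimately show "t \<in> (\<lambda>g. Abs_poly_mapping (\<lambda>i. if i \<in> {0..n} then g i else 0)) `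
      ({0..n} \<rightarrow>\<^sub>E {0..l})" by blast
  qed
  then show ?thesis by (rule finite_subset) (intro finite_imageI finite_PiE, auto)
qed

lemma single_in_forms: "t \<in> monomials n l \<Longrightarrow> Poly_Mapping.single t c \<in> forms n l"
  by (simp add: forms_def)

lemma subspace_forms: "mp.subspace (forms n l)"
proof (rule mp.subspaceI)
  show "f + g \<in> forms n l" if "f \<in> forms n l" "g \<in> forms n l" for f g :: "'a mpoly"
    using that keys_add[of f g] by (auto simp: forms_def)
  show "scl c f \<in> forms n l" if "f \<in> forms n l" for c and f :: "'a mpoly"
    using that keys_scl[of c f] by (auto simp: forms_def)
qed (simp add: forms_def)

lemma forms_eq_span: "forms n l = mp.span ((\<lambda>t. Poly_Mapping.single t 1) ` monomials n l)"
proof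
  show "forms n l \<subseteq> mp.span ((\<lambda>t. Poly_Mapping.single t (1::'a)) ` monomials n l)"
  proof
    fix f :: "'a mpoly" assume f: "f \<in> forms n l"
    have "(\<Sum>t\<in>Poly_Mapping.keys f. scl (Poly_Mapping.lookup f t) (Poly_Mapping.single t 1))
        \<in> mp.span ((\<lambda>t. Poly_Mapping.single t 1) ` monomials n l)"
      using f by (intro mp.span_sum mp.span_scale mp.span_base) (auto simp: forms_def)
    then show "f \<in> mp.span ((\<lambda>t. Poly_Mapping.single t 1) ` monomials n l)"
      by (subst poly_mapping_sum_single) (simp only: single_eq_scl[symmetric])
  qed
  show "mp.span ((\<lambda>t. Poly_Mapping.single t 1) ` monomials n l) \<subseteq> (forms n l :: 'a mpoly set)"
    by (rule mp.span_minimal[OF _ subspace_forms]) (auto simp: forms_def)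
qed

definition mono_basis :: "nat \<Rightarrow> nat \<Rightarrow> 'k::field mpoly set" where
  "mono_basis n l = (\<lambda>t. Poly_Mapping.single t 1) ` monomials n l"

lemma finite_mono_basis: "finite (mono_basis n l)"
  by (simp add: mono_basis_def finite_monomials)

lemma forms_subset_span: "forms n l \<subseteq> mp.span (mono_basis n l)"
  by (simp add: forms_eq_span mono_basis_def)

lemma dim_forms: "mp.dim (forms n l :: 'k::field mpoly set) = card (monomials n l)"
proof -
  have fam: "mp.family_independent (monomials n l) (\<lambda>t. Poly_Mapping.single t (1::'k))"
    unfolding mp.family_independent_def
  proof (intro allI impI ballI)
    fix a :: "(nat \<Rightarrow>\<^sub>0 nat) \<Rightarrow> 'k" and t
    assume a: "(\<Sum>t\<in>monomials n l. scl (a t) (Poly_Mapping.single t 1)) = 0"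
      and t: "t \<in> monomials n l"
    have "Poly_Mapping.lookup (\<Sum>t\<in>monomials n l. scl (a t) (Poly_Mapping.single t 1)) t = a t"
      using t finite_monomials
      by (simp add: lookup_sum single_eq_scl[symmetric] lookup_single when_def)
    then show "a t = 0" using a by simp
  qed
  note ind = mp.family_independentD[OF fam finite_monomials]
  show ?thesis
    unfolding forms_eq_span mp.dim_span mp.dim_eq_card_independent[OF ind(2)]
    using card_image[OF ind(1)] by simp
qed

lemma mult_in_forms:
  assumes "f \<in> forms n a" "g \<in> forms n b"
  shows "f * g \<in> forms n (a + b)"
  unfolding forms_def
proof (intro CollectI subsetI)
  fix t assume "t \<in> Poly_Mapping.keys (f * g)"
  then obtain r s where rs: "t = r + s" "r \<in> Poly_Mapping.keys f" "s \<in> Poly_Mapping.keys g"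
    using keys_mult by blast
  then have "r \<in> monomials n a" "s \<in> monomials n b" using assms by (auto simp: forms_def)
  then show "t \<in> monomials n (a + b)"
    using keys_add[of r s] rs(1) by (auto simp: monomials_def mon_degree_add)
qed

lemma zero_in_forms [simp]: "0 \<in> forms n l"
  by (simp add: forms_def)

lemma one_in_forms: "1 \<in> forms n 0"
  by (simp add: forms_def monomials_def)

lemma var_in_forms: "i \<le> n \<Longrightarrow> var i \<in> forms n 1"
  unfolding var_def by (rule single_in_forms) (simp add: monomials_def)

lemma power_in_forms: "f \<in> forms n a \<Longrightarrow> f ^ j \<in> forms n (j * a)"
  by (induction j) (simp_all add: one_in_forms mult_in_forms)

lemma forms_0: "f \<in> forms n 0 \<Longrightarrow> \<exists>c. f = Poly_Mapping.single 0 c"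
proof -
  assume f: "f \<in> forms n 0"
  have "t = 0" if "t \<in> Poly_Mapping.keys f" for t
  proof -
    have "mon_degree t = 0" using f that by (auto simp: forms_def monomials_def)
    then show "t = 0" by (auto simp: mon_degree_def in_keys_iff intro!: poly_mapping_eqI)
  qed
  then have "f = Poly_Mapping.single 0 (Poly_Mapping.lookup f 0)"
    by (intro poly_mapping_eqI) (auto simp: lookup_single when_def in_keys_iff)
  then show ?thesis by blast
qed

lemma monomial_Suc_split:
  assumes "t \<in> monomials n (Suc l)"
  obtains i s where "i \<le> n" "s \<in> monomials n l" "t = Poly_Mapping.single i 1 + s"
proof -
  have "Poly_Mapping.keys t \<noteq> {}" using assms by (auto simp: monomials_def mon_degree_def)
  then obtain i where i: "i \<in> Poly_Mapping.keys t" by blast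
  let ?s = "t - Poly_Mapping.single i 1"
  have t: "t = Poly_Mapping.single i 1 + ?s"
    using i by (intro poly_mapping_eqI) (auto simp: lookup_add lookup_minus lookup_single when_def in_keys_iff)
  have "Poly_Mapping.keys ?s \<subseteq> Poly_Mapping.keys t"
    by (auto simp: in_keys_iff lookup_minus)
  moreover have "mon_degree t = 1 + mon_degree ?s"
    by (subst t) (simp add: mon_degree_add)
  ultimately have "?s \<in> monomials n l" using assms by (auto simp: monomials_def)
  moreover have "i \<le> n" using i assms by (auto simp: monomials_def)
  ultimately show thesis using t that by blast
qed

lemma forms_Suc_subset:
  assumes "mp.subspace V" "\<And>i g. i \<le> n \<Longrightarrow> g \<in> forms n l \<Longrightarrow> var i * g \<in> V"
  shows "forms n (Suc l) \<subseteq> V"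
  unfolding forms_eq_span
proof (rule mp.span_minimal[OF _ assms(1)], rule image_subsetI)
  fix t assume "t \<in> monomials n (Suc l)"
  then obtain i s where split: "i \<le> n" "s \<in> monomials n l" "t = Poly_Mapping.single i 1 + s"
    by (rule monomial_Suc_split)
  have "var i * Poly_Mapping.single s 1 \<in> V" using split by (intro assms(2) single_in_forms)
  then show "Poly_Mapping.single t 1 \<in> V" by (simp add: var_def mult_single split(3))
qed

subsection \<open>Multiplication by a form, modulo a subspace\<close>

text \<open>Hilbert functions of quotients are treated as codimensions of subspaces of the polynomial
  ring, so that no quotient spaces are needed.\<close>

definition codim :: "nat \<Rightarrow> nat \<Rightarrow> 'k::field mpoly set \<Rightarrow> nat" where
  "codim n d V = mp.dim (forms n d :: 'k mpoly set) - mp.dim V"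

text \<open>The cofactors that a form of degree \<open>e\<close> can have in degree
  \<open>d\<close>. Since \<open>d - e\<close> is truncated, constants would slip in for
  \<open>d < e\<close> without the case distinction.\<close>

definition lower_forms :: "nat \<Rightarrow> nat \<Rightarrow> nat \<Rightarrow> 'k::field mpoly set" where
  "lower_forms n e d = (if e \<le> d then forms n (d - e) else {0})"

text \<open>If \<open>V\<close> is the piece of degree \<open>d\<close> of a homogeneous ideal J,
  then \<open>adjoin\<close> is the piece of degree \<open>d\<close> of J + (h), and
  \<open>colon\<close> the piece of degree \<open>d - e\<close> of J : h.\<close>

definition adjoin :: "nat \<Rightarrow> nat \<Rightarrow> 'k::field mpoly \<Rightarrow> nat \<Rightarrow> 'k mpoly set \<Rightarrow> 'k mpoly set" where
  "adjoin n e h d V = {x + h * y |x y. x \<in> V \<and> y \<in> lower_forms n e d}"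

definition colon :: "nat \<Rightarrow> nat \<Rightarrow> 'k::field mpoly \<Rightarrow> nat \<Rightarrow> 'k mpoly set \<Rightarrow> 'k mpoly set" where
  "colon n e h d V = {y \<in> lower_forms n e d. h * y \<in> V}"

lemma subset_forms_span: "V \<subseteq> forms n d \<Longrightarrow> V \<subseteq> mp.span (mono_basis n d)"
  by (rule subset_trans[OF _ forms_subset_span])

lemma dim_mono_forms:
  assumes "V \<subseteq> W" "W \<subseteq> forms n d"
  shows "mp.dim V \<le> mp.dim W"
  by (rule mp.dim_mono_finite[OF subset_trans[OF assms(1) mp.span_superset]
        subset_forms_span[OF assms(2)] finite_mono_basis])

lemma dim_le_dim_forms:
  fixes V :: "'k::field mpoly set"
  assumes "V \<subseteq> forms n d"
  shows "mp.dim V \<le> mp.dim (forms n d :: 'k mpoly set)"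
  by (rule dim_mono_forms[OF assms subset_refl])

lemma dim_eq_imp_eq_forms:
  assumes "mp.subspace V" "V \<subseteq> W" "W \<subseteq> forms n d" "mp.dim W \<le> mp.dim V"
  shows "V = W"
  by (rule mp.dim_eq_imp_eq[OF assms(1,2) subset_forms_span[OF assms(3)] finite_mono_basis assms(4)])

lemma codim_antimono: "V \<subseteq> W \<Longrightarrow> W \<subseteq> forms n d \<Longrightarrow> codim n d W \<le> codim n d V"
  unfolding codim_def by (intro diff_le_mono2 dim_mono_forms)

lemma subspace_lower_forms: "mp.subspace (lower_forms n e d)"
  by (simp add: lower_forms_def subspace_forms mp.subspace_single_0)

lemma lower_forms_subset: "lower_forms n e d \<subseteq> forms n (d - e)"
  by (simp add: lower_forms_def)

lemma mult_lower_forms: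
  assumes "h \<in> forms n e" "y \<in> lower_forms n e d"
  shows "h * y \<in> forms n d"
proof (cases "e \<le> d")
  case True
  then show ?thesis using mult_in_forms[OF assms(1), of y "d - e"] assms(2)
    by (simp add: lower_forms_def)
qed (use assms(2) in \<open>simp add: lower_forms_def\<close>)

lemma subspace_adjoin:
  assumes "mp.subspace V"
  shows "mp.subspace (adjoin n e h d V)"
  unfolding mp.subspace_def
proof (intro conjI ballI allI)
  show "0 \<in> adjoin n e h d V"
    unfolding adjoin_def using mp.subspace_0[OF assms] mp.subspace_0[OF subspace_lower_forms]
    by (intro CollectI exI[of _ 0]) simp
next
  fix a b assume "a \<in> adjoin n e h d V" "b \<in> adjoin n e h d V"
  then obtain x y x' y' where xy: "a = x + h * y" "x \<in> V" "y \<in> lower_forms n e d"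
    "b = x' + h * y'" "x' \<in> V" "y' \<in> lower_forms n e d"
    unfolding adjoin_def by blast
  have "a + b = (x + x') + h * (y + y')" using xy by (simp add: algebra_simps)
  then show "a + b \<in> adjoin n e h d V"
    unfolding adjoin_def using xy mp.subspace_add[OF assms] mp.subspace_add[OF subspace_lower_forms]
    by blast
next
  fix c a assume "a \<in> adjoin n e h d V"
  then obtain x y where xy: "a = x + h * y" "x \<in> V" "y \<in> lower_forms n e d"
    unfolding adjoin_def by blast
  have "scl c a = scl c x + h * scl c y" using xy by (simp add: mp.scale_right_distrib scl_mult_right)
  then show "scl c a \<in> adjoin n e h d V"
    unfolding adjoin_def using xy mp.subspace_scale[OF assms] mp.subspace_scale[OF subspace_lower_forms]
    by blast
qed

lemma subset_adjoin: "V \<subseteq> adjoin n e h d V"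
proof
  fix x assume "x \<in> V"
  then show "x \<in> adjoin n e h d V"
    unfolding adjoin_def using mp.subspace_0[OF subspace_lower_forms]
    by (intro CollectI exI[of _ x] exI[of _ 0]) simp
qed

lemma mult_in_adjoin: "mp.subspace V \<Longrightarrow> y \<in> lower_forms n e d \<Longrightarrow> h * y \<in> adjoin n e h d V"
  unfolding adjoin_def using mp.subspace_0[of V]
  by (intro CollectI exI[of _ 0] exI[of _ y]) simp

lemma adjoin_subset:
  assumes "mp.subspace W" "V \<subseteq> W" "\<And>y. y \<in> lower_forms n e d \<Longrightarrow> h * y \<in> W"
  shows "adjoin n e h d V \<subseteq> W"
  unfolding adjoin_def using assms mp.subspace_add[OF assms(1)] by blast

lemma adjoin_subset_forms:
  assumes "V \<subseteq> forms n d" "h \<in> forms n e"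
  shows "adjoin n e h d V \<subseteq> forms n d"
  using adjoin_subset[OF subspace_forms assms(1)] mult_lower_forms[OF assms(2)] by blast

lemma adjoin_commute:
  "adjoin n e h d (adjoin n e' h' d V) = adjoin n e' h' d (adjoin n e h d V)"
proof -
  have "adjoin n e h d (adjoin n e' h' d V) \<subseteq> adjoin n e' h' d (adjoin n e h d V)"
    for e h e' h'
  proof
    fix z assume "z \<in> adjoin n e h d (adjoin n e' h' d V)"
    then obtain x y y' where "z = (x + h' * y') + h * y" "x \<in> V" "y \<in> lower_forms n e d"
      "y' \<in> lower_forms n e' d"
      unfolding adjoin_def by blast
    moreover from this have "z = (x + h * y) + h' * y'" by (simp add: algebra_simps)
    ultimately show "z \<in> adjoin n e' h' d (adjoin n e h d V)" unfolding adjoin_def by blast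
  qed
  then show ?thesis by blast
qed

lemma subspace_colon:
  assumes "mp.subspace V"
  shows "mp.subspace (colon n e h d V)"
  unfolding mp.subspace_def colon_def
  using mp.subspace_0[OF assms] mp.subspace_add[OF assms] mp.subspace_scale[OF assms]
    mp.subspace_0[OF subspace_lower_forms] mp.subspace_add[OF subspace_lower_forms]
    mp.subspace_scale[OF subspace_lower_forms]
  by (auto simp: distrib_left scl_mult_right)

lemma colon_subset: "colon n e h d V \<subseteq> lower_forms n e d"
  by (auto simp: colon_def)

text \<open>\<open>\<pi>\<close> stands in for the quotient map modulo \<open>V\<close>, with values
  in the polynomial ring itself.\<close>

lemma exists_linear_with_kernel:
  assumes "mp.subspace V"
  obtains \<pi> where "Vector_Spaces.linear scl scl \<pi>" "{x. \<pi> x = 0} = V"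
proof -
  obtain B where B: "B \<subseteq> V" "mp.independent B" "V \<subseteq> mp.span B"
    using mp.maximal_independent_subset[of V] by blast
  have V: "mp.span B = V" using B assms mp.span_minimal by blast
  define E where "E = mp.extend_basis B"
  have E: "mp.independent E" "B \<subseteq> E" "mp.span E = UNIV"
    unfolding E_def using mp.independent_extend_basis[OF B(2)] mp.extend_basis_superset[OF B(2)]
      mp.span_extend_basis[OF B(2)] by auto
  define \<pi> where "\<pi> = mpp.construct E (\<lambda>b. if b \<in> B then 0 else b)"
  have lin: "Vector_Spaces.linear scl scl \<pi>" unfolding \<pi>_def by (rule mpp.linear_construct[OF E(1)])
  interpret \<pi>: Vector_Spaces.linear scl scl \<pi> by (rule lin)
  have \<pi>b: "\<pi> b = (if b \<in> B then 0 else b)" if "b \<in> E" for b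
    unfolding \<pi>_def using mpp.construct_basis[OF E(1) that] .
  have "{x. \<pi> x = 0} = V"
  proof
    have "\<pi> x = 0" if "x \<in> mp.span B" for x
      by (rule \<pi>.eq_0_on_span[OF _ that]) (use \<pi>b E(2) in auto)
    then show "V \<subseteq> {x. \<pi> x = 0}" using V by blast
    show "{x. \<pi> x = 0} \<subseteq> V"
    proof safe
      fix x assume x: "\<pi> x = 0"
      have "x \<in> mp.span E" using E(3) by simp
      then obtain F c where F: "finite F" "F \<subseteq> E" "x = (\<Sum>b\<in>F. scl (c b) b)"
        unfolding mp.span_explicit by blast
      have "\<pi> x = (\<Sum>b\<in>F. scl (c b) (if b \<in> B then 0 else b))"
        using F \<pi>b by (simp add: \<pi>.sum \<pi>.scale subset_iff)
      also have "\<dots> = (\<Sum>b\<in>F - B. scl (c b) b)"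
        using F(1) by (intro sum.mono_neutral_cong_right) auto
      finally have "(\<Sum>b\<in>F - B. scl (c b) b) = 0" using x by simp
      then have c0: "c b = 0" if "b \<in> F - B" for b
        using mp.independentD[OF E(1), of "F - B" c b] F(1,2) that by blast
      have "x = (\<Sum>b\<in>F \<inter> B. scl (c b) b)"
        unfolding F(3) using F(1) c0 by (intro sum.mono_neutral_right) auto
      moreover have "(\<Sum>b\<in>F \<inter> B. scl (c b) b) \<in> mp.span B"
        by (intro mp.span_sum mp.span_scale mp.span_base) blast
      ultimately have "x \<in> mp.span B" by (simp only:)
      then show "x \<in> V" using V by simp
    qed
  qed
  with lin show thesis by (rule that)
qed

text \<open>Multiplication by \<open>h\<close> identifies cofactors modulo \<open>colon\<close> with
  \<open>adjoin\<close> modulo \<open>V\<close>. In the proof both quotients appear as the same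
  image under \<open>\<pi>\<close>.\<close>

lemma dim_adjoin:
  fixes V :: "'k::field mpoly set"
  assumes V: "mp.subspace V" "V \<subseteq> forms n d" and h: "h \<in> forms n e"
  shows "mp.dim (adjoin n e h d V) + mp.dim (colon n e h d V) = mp.dim V + mp.dim (lower_forms n e d :: 'k mpoly set)"
proof -
  obtain \<pi> where lin: "Vector_Spaces.linear scl scl \<pi>" and ker: "{x. \<pi> x = 0} = V"
    using exists_linear_with_kernel[OF V(1)] .
  interpret \<pi>: Vector_Spaces.linear scl scl \<pi> by (rule lin)
  let ?A = "adjoin n e h d V" and ?L = "lower_forms n e d :: 'k mpoly set"
  have A: "?A \<subseteq> mp.span (mono_basis n d)"
    using adjoin_subset_forms[OF V(2) h] forms_subset_span by blast
  have L: "?L \<subseteq> mp.span (mono_basis n (d - e))"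
    using lower_forms_subset forms_subset_span by blast
  have 1: "mp.dim ?A = mp.dim {x \<in> ?A. \<pi> x = 0} + mp.dim (\<pi> ` ?A)"
    by (rule mpp.dim_kernel_plus_dim_image[OF subspace_adjoin[OF V(1)] A finite_mono_basis])
      (simp_all add: \<pi>.add \<pi>.scale)
  have 2: "mp.dim ?L = mp.dim {y \<in> ?L. \<pi> (h * y) = 0} + mp.dim ((\<lambda>y. \<pi> (h * y)) ` ?L)"
    by (rule mpp.dim_kernel_plus_dim_image[OF subspace_lower_forms L finite_mono_basis])
      (simp_all add: distrib_left scl_mult_right \<pi>.add \<pi>.scale)
  have "{x \<in> ?A. \<pi> x = 0} = V"
    using ker subset_adjoin[of V n e h d] by (auto simp del: mp.subspace_0)
  moreover have "{y \<in> ?L. \<pi> (h * y) = 0} = colon n e h d V" using ker by (auto simp: colon_def)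
  moreover have "\<pi> ` ?A = (\<lambda>y. \<pi> (h * y)) ` ?L"
  proof
    have "\<pi> (x + h * y) = \<pi> (h * y)" if "x \<in> V" for x y using ker that by (auto simp: \<pi>.add)
    then show "\<pi> ` ?A \<subseteq> (\<lambda>y. \<pi> (h * y)) ` ?L" unfolding adjoin_def by blast
    show "(\<lambda>y. \<pi> (h * y)) ` ?L \<subseteq> \<pi> ` ?A"
      using mult_in_adjoin[OF V(1), of _ n e d h] by (auto intro!: imageI)
  qed
  ultimately have "mp.dim ?A = mp.dim V + mp.dim (\<pi> ` ?A)"
    "mp.dim ?L = mp.dim (colon n e h d V) + mp.dim (\<pi> ` ?A)"
    using 1 2 by (simp_all only:)
  then show ?thesis by linarith
qed

lemma codim_split:
  fixes V :: "'k::field mpoly set"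
  assumes V: "mp.subspace V" "V \<subseteq> forms n d" and h: "h \<in> forms n e"
  shows "codim n d V + mp.dim (colon n e h d V) = codim n d (adjoin n e h d V) + mp.dim (lower_forms n e d :: 'k mpoly set)"
  using dim_adjoin[OF assms] dim_le_dim_forms[OF adjoin_subset_forms[OF V(2) h]]
    dim_le_dim_forms[OF V(2)] dim_mono_forms[OF subset_adjoin adjoin_subset_forms[OF V(2) h]]
  unfolding codim_def by linarith

text \<open>The dimension count for the exact sequence from S/(V : h), shifted by one, through S/V
  to S/(V + hS).\<close>

lemma codim_split_linear:
  fixes V :: "'k::field mpoly set"
  assumes V: "mp.subspace V" "V \<subseteq> forms n (Suc d)" and h: "h \<in> forms n 1"
  shows "codim n (Suc d) V = codim n (Suc d) (adjoin n 1 h (Suc d) V) + codim n d (colon n 1 h (Suc d) V)"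
proof -
  have "lower_forms n 1 (Suc d) = (forms n d :: 'k mpoly set)" by (simp add: lower_forms_def)
  then show ?thesis
    using codim_split[OF assms] dim_le_dim_forms[of "colon n 1 h (Suc d) V" n d]
      colon_subset[of n 1 h "Suc d" V] unfolding codim_def[of n d] by simp
qed

section \<open>Generic linear forms\<close>

text \<open>A substitute for Zariski open sets of linear forms: such sets are detected on lines.\<close>

definition generic :: "nat \<Rightarrow> 'k::field mpoly set \<Rightarrow> bool" where
  "generic n U \<longleftrightarrow> U \<subseteq> forms n 1 \<and> U \<noteq> {} \<and>
     (\<forall>u\<in>U. \<forall>v\<in>forms n 1. finite {t. u + scl t v \<notin> U}) \<and>
     (\<forall>u\<in>U. \<forall>c. c \<noteq> 0 \<longrightarrow> scl c u \<in> U)"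

lemma generic_forms: "generic n (forms n 1)"
proof -
  have line: "u + scl t v \<in> forms n 1" if "u \<in> forms n 1" "v \<in> forms n 1" for u v :: "'a mpoly" and t
    using that mp.subspace_add[OF subspace_forms] mp.subspace_scale[OF subspace_forms] by blast
  show ?thesis
    unfolding generic_def
  proof (intro conjI ballI allI impI)
    show "finite {t. u + scl t v \<notin> forms n 1}"
      if "u \<in> forms n 1" "v \<in> forms n 1" for u v :: "'a mpoly"
      using line[OF that] by simp
    show "forms n 1 \<noteq> {}" using zero_in_forms by blast
  qed (auto intro: mp.subspace_scale[OF subspace_forms])
qed

text \<open>On the line through \<open>u\<close> in \<open>A\<close> and \<open>v\<close> in
  \<open>B\<close>, almost every \<open>u + t v\<close> lies in \<open>A\<close>. For nonzero
  \<open>t\<close> it is \<open>t\<close> times \<open>v + (1/t) u\<close>, which lies in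
  \<open>B\<close> for almost every \<open>t\<close>; closure under scaling brings the two together,
  and an infinite field leaves a common \<open>t\<close>.\<close>

lemma generic_Int:
  fixes A B :: "'k::field_char_0 mpoly set"
  assumes A: "generic n A" and B: "generic n B"
  shows "generic n (A \<inter> B)"
proof -
  obtain u v where u: "u \<in> A" and v: "v \<in> B" using A B unfolding generic_def by blast
  have forms: "u \<in> forms n 1" "v \<in> forms n 1" using A B u v unfolding generic_def by blast+
  have fu: "finite {t. u + scl t v \<notin> A}" using A u forms unfolding generic_def by blast
  have "finite {s. v + scl s u \<notin> B}" using B v forms unfolding generic_def by blast
  then have "finite (inverse ` {s. v + scl s u \<notin> B})" by simp
  then have "finite (insert 0 (inverse ` {s. v + scl s u \<notin> B} \<union> {t. u + scl t v \<notin> A}))"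
    using fu by simp
  then obtain t where t: "t \<notin> insert 0 (inverse ` {s. v + scl s u \<notin> B} \<union> {t. u + scl t v \<notin> A})"
    using ex_new_if_finite[OF infinite_UNIV_char_0[where 'a = 'k]] by blast
  have t0: "t \<noteq> 0" and tA: "u + scl t v \<in> A" using t by auto
  have "v + scl (inverse t) u \<in> B"
  proof (rule ccontr)
    assume "v + scl (inverse t) u \<notin> B"
    then have "inverse (inverse t) \<in> inverse ` {s. v + scl s u \<notin> B}" by blast
    then show False using t by simp
  qed
  then have "scl t (v + scl (inverse t) u) \<in> B" using B t0 unfolding generic_def by blast
  then have "u + scl t v \<in> B" using t0 by (simp add: mp.scale_right_distrib add.commute)
  then have ne: "A \<inter> B \<noteq> {}" using tA by blast
  have line: "finite {t. w + scl t z \<notin> A \<inter> B}" if "w \<in> A \<inter> B" "z \<in> forms n 1" for w z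
  proof -
    have "{t. w + scl t z \<notin> A \<inter> B} = {t. w + scl t z \<notin> A} \<union> {t. w + scl t z \<notin> B}" by blast
    moreover have "finite {t. w + scl t z \<notin> A}" "finite {t. w + scl t z \<notin> B}"
      using A B that unfolding generic_def by blast+
    ultimately show ?thesis by simp
  qed
  show ?thesis
    unfolding generic_def
  proof (intro conjI ballI allI impI)
    show "A \<inter> B \<subseteq> forms n 1" using A unfolding generic_def by blast
    show "A \<inter> B \<noteq> {}" by (rule ne)
    show "finite {t. w + scl t z \<notin> A \<inter> B}" if "w \<in> A \<inter> B" "z \<in> forms n 1" for w z
      using line that by blast
    show "scl c w \<in> A \<inter> B" if "w \<in> A \<inter> B" "c \<noteq> 0" for c w
      using A B that unfolding generic_def by blast
  qed
qed

lemma adjoin_scl: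
  assumes "c \<noteq> 0"
  shows "adjoin n e (scl c h) d V = adjoin n e h d V"
proof -
  have sub: "adjoin n e (scl c h) d V \<subseteq> adjoin n e h d V" for c h
  proof
    fix z assume "z \<in> adjoin n e (scl c h) d V"
    then obtain x y where "z = x + scl c h * y" "x \<in> V" "y \<in> lower_forms n e d"
      unfolding adjoin_def by blast
    then have "z = x + h * scl c y" "scl c y \<in> lower_forms n e d"
      by (simp_all add: scl_mult_left scl_mult_right mp.subspace_scale[OF subspace_lower_forms])
    then show "z \<in> adjoin n e h d V" using \<open>x \<in> V\<close> unfolding adjoin_def by blast
  qed
  have "h = scl (inverse c) (scl c h)" using assms by simp
  then have "adjoin n e h d V \<subseteq> adjoin n e (scl c h) d V" using sub by metis
  then show ?thesis using sub by blast
qed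

text \<open>Semicontinuity of rank along a line. A basis of the space for \<open>u\<close> consists
  of vectors \<open>b = x + u y\<close>; replacing \<open>u\<close> by \<open>u + t v\<close>
  perturbs them to \<open>b + t (v y)\<close>, which stay independent for almost all
  \<open>t\<close>.\<close>

lemma finite_dim_adjoin_drop:
  fixes V :: "'k::field mpoly set"
  assumes V: "mp.subspace V" "V \<subseteq> forms n d" and u: "u \<in> forms n e" and v: "v \<in> forms n e"
  shows "finite {t. mp.dim (adjoin n e (u + scl t v) d V) < mp.dim (adjoin n e u d V)}"
proof -
  let ?A = "\<lambda>h. adjoin n e h d V"
  have Aspan: "?A h \<subseteq> mp.span (mono_basis n d)" if "h \<in> forms n e" for h
    using subset_forms_span[OF adjoin_subset_forms[OF V(2) that]] .
  obtain B where B: "B \<subseteq> ?A u" "mp.independent B" "?A u \<subseteq> mp.span B" "finite B"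
    "card B = mp.dim (?A u)"
    by (rule mp.finite_basis_exists[OF Aspan[OF u] finite_mono_basis])
  have "\<forall>b\<in>B. \<exists>p. fst p \<in> V \<and> snd p \<in> lower_forms n e d \<and> b = fst p + u * snd p"
    using B(1) unfolding adjoin_def by fastforce
  from bchoice[OF this] obtain p
    where p: "\<And>b. b \<in> B \<Longrightarrow> fst (p b) \<in> V \<and> snd (p b) \<in> lower_forms n e d \<and> b = fst (p b) + u * snd (p b)"
    by blast
  let ?w = "\<lambda>b. v * snd (p b)"
  have "finite {t. \<not> mp.family_independent B (\<lambda>b. b + scl t (?w b))}"
    by (rule mp.finite_dependent_perturbations[OF mp.family_independentI[OF B(2,4)] B(4)])
  moreover have "{t. mp.dim (?A (u + scl t v)) < mp.dim (?A u)}
      \<subseteq> {t. \<not> mp.family_independent B (\<lambda>b. b + scl t (?w b))}"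
  proof safe
    fix t
    assume lt: "mp.dim (?A (u + scl t v)) < mp.dim (?A u)"
      and fam: "mp.family_independent B (\<lambda>b. b + scl t (?w b))"
    note ind = mp.family_independentD[OF fam B(4)]
    have uv: "u + scl t v \<in> forms n e"
      using u v mp.subspace_add[OF subspace_forms] mp.subspace_scale[OF subspace_forms] by blast
    have "(\<lambda>b. b + scl t (?w b)) ` B \<subseteq> ?A (u + scl t v)"
    proof (rule image_subsetI)
      fix b assume b: "b \<in> B"
      have "b + scl t (?w b) = fst (p b) + u * snd (p b) + scl t (?w b)"
        using p[OF b] by argo
      also have "\<dots> = fst (p b) + (u + scl t v) * snd (p b)"
        by (simp add: distrib_right scl_mult_left)
      finally show "b + scl t (?w b) \<in> ?A (u + scl t v)"
        unfolding adjoin_def using p[OF b] by blast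
    qed
    then have "card ((\<lambda>b. b + scl t (?w b)) ` B) \<le> mp.dim (?A (u + scl t v))"
      by (rule mp.card_le_dim_finite(2)[OF _ ind(2) Aspan[OF uv] finite_mono_basis])
    then show False using lt card_image[OF ind(1)] B(5) by simp
  qed
  ultimately show ?thesis by (rule finite_subset[rotated])
qed

definition maximizers :: "nat \<Rightarrow> nat \<Rightarrow> 'k::field mpoly set \<Rightarrow> 'k mpoly set" where
  "maximizers n d V =
     {h \<in> forms n 1. \<forall>h'\<in>forms n 1. mp.dim (adjoin n 1 h' d V) \<le> mp.dim (adjoin n 1 h d V)}"

text \<open>The dimensions are bounded by that of \<open>forms n d\<close>, so a maximum exists, and
  by semicontinuity it is lost on a line through a maximizer for finitely many \<open>t\<close>
  only.\<close>

lemma generic_maximizers: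
  fixes V :: "'k::field mpoly set"
  assumes V: "mp.subspace V" "V \<subseteq> forms n d"
  shows "generic n (maximizers n d V)"
  unfolding generic_def
proof (intro conjI ballI allI impI)
  let ?dim = "\<lambda>h. mp.dim (adjoin n 1 h d V)"
  show "maximizers n d V \<subseteq> forms n 1" by (auto simp: maximizers_def)
  have le: "?dim h \<le> mp.dim (forms n d :: 'k mpoly set)" if "h \<in> forms n 1" for h
    by (rule dim_le_dim_forms[OF adjoin_subset_forms[OF V(2) that]])
  have "\<exists>h. h \<in> forms n 1 \<and> (\<forall>h'. h' \<in> forms n 1 \<longrightarrow> ?dim h' \<le> ?dim h)"
    by (rule ex_has_greatest_nat[of _ 0 _ "Suc (mp.dim (forms n d :: 'k mpoly set))"])
      (use le in \<open>auto simp: less_Suc_eq_le\<close>)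
  then show "maximizers n d V \<noteq> {}" unfolding maximizers_def by blast
  fix u assume u: "u \<in> maximizers n d V"
  then have uf: "u \<in> forms n 1" and umax: "\<And>h. h \<in> forms n 1 \<Longrightarrow> ?dim h \<le> ?dim u"
    by (auto simp: maximizers_def)
  show "finite {t. u + scl t v \<notin> maximizers n d V}" if v: "v \<in> forms n 1" for v
  proof (rule finite_subset[OF _ finite_dim_adjoin_drop[OF V uf v]], rule subsetI, rule CollectI, rule ccontr)
    fix t assume t: "t \<in> {t. u + scl t v \<notin> maximizers n d V}" "\<not> ?dim (u + scl t v) < ?dim u"
    have "u + scl t v \<in> forms n 1"
      using uf v mp.subspace_add[OF subspace_forms] mp.subspace_scale[OF subspace_forms] by blast
    moreover have "?dim h \<le> ?dim (u + scl t v)" if "h \<in> forms n 1" for h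
      using umax[OF that] t(2) by linarith
    ultimately have "u + scl t v \<in> maximizers n d V" unfolding maximizers_def by blast
    then show False using t(1) by blast
  qed
  show "scl c u \<in> maximizers n d V" if c: "c \<noteq> 0" for c
    unfolding maximizers_def
  proof (intro CollectI conjI ballI)
    show "scl c u \<in> forms n 1" using uf by (rule mp.subspace_scale[OF subspace_forms])
    show "?dim h \<le> ?dim (scl c u)" if "h \<in> forms n 1" for h
      unfolding adjoin_scl[OF c] using umax[OF that] .
  qed
qed

section \<open>Restriction to a generic hyperplane and Macaulay's bound\<close>

lemma codim_maximizers:
  assumes "h \<in> maximizers n d V" "h' \<in> maximizers n d V"
  shows "codim n d (adjoin n 1 h d V) = codim n d (adjoin n 1 h' d V)"
proof -
  have "mp.dim (adjoin n 1 h d V) = mp.dim (adjoin n 1 h' d V)"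
    using assms unfolding maximizers_def by (intro antisym) blast+
  then show ?thesis by (simp only: codim_def)
qed

text \<open>If a maximizer adds nothing to \<open>V\<close>, no linear form does. In particular
  \<open>V\<close> contains all multiples of every variable, hence all forms of degree
  \<open>Suc d\<close>.\<close>

lemma generic_restriction_drops:
  fixes V :: "'k::field mpoly set"
  assumes V: "mp.subspace V" "V \<subseteq> forms n (Suc d)" and c: "0 < codim n (Suc d) V"
    and h: "h \<in> maximizers n (Suc d) V"
  shows "codim n (Suc d) (adjoin n 1 h (Suc d) V) < codim n (Suc d) V"
proof (rule ccontr)
  let ?A = "\<lambda>h. adjoin n 1 h (Suc d) V"
  assume "\<not> codim n (Suc d) (?A h) < codim n (Suc d) V"
  moreover have hf: "h \<in> forms n 1" using h by (simp add: maximizers_def)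
  moreover have "mp.dim V \<le> mp.dim (forms n (Suc d) :: 'k mpoly set)" by (rule dim_le_dim_forms[OF V(2)])
  ultimately have dim_h: "mp.dim (?A h) \<le> mp.dim V" using c unfolding codim_def by linarith
  have "forms n (Suc d) \<subseteq> V"
  proof (rule forms_Suc_subset[OF V(1)])
    fix i and g :: "'k mpoly" assume i: "i \<le> n" and g: "g \<in> forms n d"
    have "mp.dim (?A (var i)) \<le> mp.dim (?A h)"
      using h var_in_forms[OF i] unfolding maximizers_def by blast
    then have "mp.dim (?A (var i)) \<le> mp.dim V" using dim_h by (rule le_trans)
    then have "V = ?A (var i)"
      by (rule dim_eq_imp_eq_forms[OF V(1) subset_adjoin adjoin_subset_forms[OF V(2) var_in_forms[OF i]]])
    moreover have "var i * g \<in> ?A (var i)"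
      by (rule mult_in_adjoin[OF V(1)]) (simp add: lower_forms_def g)
    ultimately show "var i * g \<in> V" by blast
  qed
  then have "V = forms n (Suc d)" using V(2) by blast
  then show False using c by (simp add: codim_def)
qed

text \<open>Green's restriction theorem. With a second generic form \<open>h'\<close>, the sequence
  \<open>S/(V : h) \<rightarrow> S/V \<rightarrow> S/(V + h S)\<close> restricted to \<open>h' = 0\<close> is still right exact.\<close>

theorem generic_restriction:
  fixes V :: "'k::field_char_0 mpoly set"
  assumes "mp.subspace V" "V \<subseteq> forms n d"
  shows "\<exists>U. generic n U \<and> (\<forall>h\<in>U. codim n d (adjoin n 1 h d V) \<le> mac_low d (codim n d V))"
  using assms
proof (induction d arbitrary: V)
  case 0
  \<comment> \<open>No cofactor exists in degree 0, so \<open>mac_low 0 c = c\<close> is the correct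
    bound there.\<close>
  have "adjoin n 1 h 0 V = V" for h
    by (auto simp: adjoin_def lower_forms_def)
  then show ?case using generic_forms by (intro exI[of _ "forms n 1"]) auto
next
  case (Suc d)
  note IH_degree = Suc.IH
  from Suc.prems show ?case
  proof (induction "codim n (Suc d) V" arbitrary: V rule: less_induct)
    \<comment> \<open>Outer induction on the degree serves V : h, inner induction on the codimension
      serves V + hS, which is strictly larger than \<open>V\<close>.\<close>
    case less
    note V = less.prems
    let ?c = "codim n (Suc d) V"
    let ?M = "maximizers n (Suc d) V"
    let ?A = "\<lambda>h. adjoin n 1 h (Suc d) V"
    note gM = generic_maximizers[OF V]
    obtain h where h: "h \<in> ?M" using gM unfolding generic_def by blast
    then have hf: "h \<in> forms n 1" by (simp add: maximizers_def)
    let ?a = "codim n (Suc d) (?A h)"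
    have "?a \<le> mac_low (Suc d) ?c"
    proof (cases "?c = 0")
      case True
      have "?a \<le> ?c" by (rule codim_antimono[OF subset_adjoin adjoin_subset_forms[OF V(2) hf]])
      then show ?thesis using True by simp
    next
      case False
      then have lt: "?a < ?c" using generic_restriction_drops[OF V _ h] by simp
      have Ah: "mp.subspace (?A h)" "?A h \<subseteq> forms n (Suc d)"
        using subspace_adjoin[OF V(1)] adjoin_subset_forms[OF V(2) hf] by blast+
      obtain U1 where U1: "generic n U1"
        "\<And>h'. h' \<in> U1 \<Longrightarrow> codim n (Suc d) (adjoin n 1 h' (Suc d) (?A h)) \<le> mac_low (Suc d) ?a"
        using less.hyps[OF lt Ah] by blast
      let ?C = "colon n 1 h (Suc d) V"
      have C: "mp.subspace ?C" "?C \<subseteq> forms n d"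
        using subspace_colon[OF V(1)] colon_subset[of n 1 h "Suc d" V] by (auto simp: lower_forms_def)
      obtain U2 where U2: "generic n U2"
        "\<And>h'. h' \<in> U2 \<Longrightarrow> codim n d (adjoin n 1 h' d ?C) \<le> mac_low d (codim n d ?C)"
        using IH_degree[OF C] by blast
      \<comment> \<open>With \<open>h\<close> fixed, \<open>h'\<close> has to be generic for
        \<open>V\<close>, for V + hS and for V : h simultaneously.\<close>
      have "generic n (?M \<inter> (U1 \<inter> U2))"
        using gM U1(1) U2(1) by (intro generic_Int)
      then obtain h' where h': "h' \<in> ?M" "h' \<in> U1" "h' \<in> U2" unfolding generic_def by blast
      then have h'f: "h' \<in> forms n 1" by (simp add: maximizers_def)
      have W: "mp.subspace (?A h')" "?A h' \<subseteq> forms n (Suc d)"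
        using subspace_adjoin[OF V(1)] adjoin_subset_forms[OF V(2) h'f] by blast+
      let ?CW = "colon n 1 h (Suc d) (?A h')"
      \<comment> \<open>The inclusion of (V : h) + h'S in (V + h'S) : h is all that is needed of
        right exactness.\<close>
      have "adjoin n 1 h' d ?C \<subseteq> ?CW"
      proof (rule adjoin_subset[OF subspace_colon[OF W(1)]])
        show "?C \<subseteq> ?CW" using subset_adjoin[of V n 1 h' "Suc d"] unfolding colon_def by blast
        fix y :: "'k mpoly" assume y: "y \<in> lower_forms n 1 d"
        have "h * (h' * y) = h' * (h * y)" by (simp add: ac_simps)
        moreover have "h * y \<in> lower_forms n 1 (Suc d)"
          using mult_lower_forms[OF hf y] by (simp add: lower_forms_def)
        ultimately have "h * (h' * y) \<in> ?A h'"
          using mult_in_adjoin[OF V(1), of "h * y" n 1 "Suc d" h'] by (simp only:)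
        moreover have "h' * y \<in> lower_forms n 1 (Suc d)"
          using mult_lower_forms[OF h'f y] by (simp add: lower_forms_def)
        ultimately show "h' * y \<in> ?CW" unfolding colon_def by blast
      qed
      moreover have "?CW \<subseteq> forms n d"
        using colon_subset[of n 1 h "Suc d" "?A h'"] by (simp add: lower_forms_def)
      ultimately have "codim n d ?CW \<le> codim n d (adjoin n 1 h' d ?C)"
        by (rule codim_antimono)
      moreover have "\<dots> \<le> mac_low d (codim n d ?C)" using U2(2) h' by blast
      moreover have "codim n d ?C = ?c - ?a" using codim_split_linear[OF V hf] by simp
      moreover have "codim n (Suc d) (?A h') = ?a" by (rule codim_maximizers[OF h'(1) h])
      moreover have "codim n (Suc d) (?A h')
          = codim n (Suc d) (adjoin n 1 h (Suc d) (?A h')) + codim n d ?CW"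
        by (rule codim_split_linear[OF W hf])
      \<comment> \<open>\<open>V\<close> with \<open>h'\<close> and then \<open>h\<close> adjoined
        is also V + hS restricted by \<open>h'\<close>, which the inner hypothesis controls.\<close>
      moreover have "codim n (Suc d) (adjoin n 1 h (Suc d) (?A h')) \<le> mac_low (Suc d) ?a"
        using U1(2)[OF h'(2)] by (simp only: adjoin_commute)
      ultimately have "?a \<le> mac_low (Suc d) ?a + mac_low d (?c - ?a)" by simp
      then show ?thesis using mac_low_add_mac_low_less[of d ?c ?a] lt by linarith
    qed
    then have "codim n (Suc d) (?A h') \<le> mac_low (Suc d) ?c" if "h' \<in> ?M" for h'
      using codim_maximizers[OF that h] by simp
    with gM show ?case by blast
  qed
qed

text \<open>A homogeneous ideal as the family of its graded pieces. \<open>pieces\<close> and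
  \<open>total\<close> pass from ideals of \<open>mpoly_ring n\<close> to such families and
  back.\<close>

definition graded_ideal :: "nat \<Rightarrow> (nat \<Rightarrow> 'k::field mpoly set) \<Rightarrow> bool" where
  "graded_ideal n J \<longleftrightarrow> (\<forall>l. mp.subspace (J l) \<and> J l \<subseteq> forms n l) \<and>
     (\<forall>k l. \<forall>f\<in>forms n k. \<forall>g\<in>J l. f * g \<in> J (k + l))"

lemma graded_idealD:
  assumes "graded_ideal n J"
  shows "mp.subspace (J l)" "J l \<subseteq> forms n l"
    "f \<in> forms n k \<Longrightarrow> g \<in> J l \<Longrightarrow> f * g \<in> J (k + l)"
  using assms unfolding graded_ideal_def by blast+

text \<open>For generic \<open>h\<close>, \<open>J d\<close> lies in the colon of
  \<open>J (Suc d)\<close> by \<open>h\<close>. The exact sequence and the restriction theorem then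
  give the hypothesis of \<open>le_mac_up_of_le_add_mac_low\<close>.\<close>

theorem macaulay_bound:
  fixes J :: "nat \<Rightarrow> 'k::field_char_0 mpoly set"
  assumes J: "graded_ideal n J" and d: "0 < d"
  shows "codim n (Suc d) (J (Suc d)) \<le> mac_up d (codim n d (J d))"
proof -
  let ?V = "J (Suc d)"
  note V = graded_idealD(1,2)[OF J, of "Suc d"]
  obtain U where U: "generic n U"
    "\<And>h. h \<in> U \<Longrightarrow> codim n (Suc d) (adjoin n 1 h (Suc d) ?V) \<le> mac_low (Suc d) (codim n (Suc d) ?V)"
    using generic_restriction[OF V] by blast
  obtain h where h: "h \<in> U" and hf: "h \<in> forms n 1" using U(1) unfolding generic_def by blast
  have "J d \<subseteq> colon n 1 h (Suc d) ?V"
    using graded_idealD(3)[OF J hf, of _ d] graded_idealD(2)[OF J, of d]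
    by (auto simp: colon_def lower_forms_def)
  moreover have "colon n 1 h (Suc d) ?V \<subseteq> forms n d"
    using colon_subset[of n 1 h "Suc d" ?V] by (simp add: lower_forms_def)
  ultimately have "codim n d (colon n 1 h (Suc d) ?V) \<le> codim n d (J d)"
    by (rule codim_antimono)
  then have "codim n (Suc d) ?V \<le> codim n d (J d) + mac_low (Suc d) (codim n (Suc d) ?V)"
    using codim_split_linear[OF V hf] U(2)[OF h] by linarith
  then show ?thesis using le_mac_up_of_le_add_mac_low[of _ _ "d - 1"] d by simp
qed

section \<open>Regular sequences\<close>

definition adjoin_ideal ::
  "nat \<Rightarrow> nat \<Rightarrow> 'k::field mpoly \<Rightarrow> (nat \<Rightarrow> 'k mpoly set) \<Rightarrow> nat \<Rightarrow> 'k mpoly set" where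
  "adjoin_ideal n e f J d = adjoin n e f d (J d)"

definition nonzerodivisor ::
  "nat \<Rightarrow> (nat \<Rightarrow> 'k::field mpoly set) \<Rightarrow> nat \<Rightarrow> 'k mpoly \<Rightarrow> bool" where
  "nonzerodivisor n J e f \<longleftrightarrow>
     f \<in> forms n e \<and> (\<forall>l. \<forall>x\<in>forms n l. f * x \<in> J (e + l) \<longrightarrow> x \<in> J l)"

lemma nonzerodivisorD:
  assumes "nonzerodivisor n J e f"
  shows "f \<in> forms n e" "x \<in> forms n l \<Longrightarrow> f * x \<in> J (e + l) \<Longrightarrow> x \<in> J l"
  using assms unfolding nonzerodivisor_def by blast+

lemma adjoin_idealE:
  assumes "z \<in> adjoin_ideal n e f J d"
  obtains x y where "z = x + f * y" "x \<in> J d" "y \<in> lower_forms n e d"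
  using assms unfolding adjoin_ideal_def adjoin_def by blast

lemma adjoin_idealI:
  "x \<in> J d \<Longrightarrow> y \<in> lower_forms n e d \<Longrightarrow> x + f * y \<in> adjoin_ideal n e f J d"
  unfolding adjoin_ideal_def adjoin_def by blast

lemma subset_adjoin_ideal: "J d \<subseteq> adjoin_ideal n e f J d"
  unfolding adjoin_ideal_def by (rule subset_adjoin)

lemma adjoin_ideal_commute:
  "adjoin_ideal n e f (adjoin_ideal n e' f' J) = adjoin_ideal n e' f' (adjoin_ideal n e f J)"
  unfolding adjoin_ideal_def by (rule ext) (rule adjoin_commute)

lemma graded_ideal_adjoin:
  fixes J :: "nat \<Rightarrow> 'k::field mpoly set"
  assumes J: "graded_ideal n J" and f: "f \<in> forms n e"
  shows "graded_ideal n (adjoin_ideal n e f J)"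
  unfolding graded_ideal_def
proof (intro conjI allI ballI)
  fix l
  show "mp.subspace (adjoin_ideal n e f J l)"
    unfolding adjoin_ideal_def by (rule subspace_adjoin[OF graded_idealD(1)[OF J]])
  show "adjoin_ideal n e f J l \<subseteq> forms n l"
    unfolding adjoin_ideal_def by (rule adjoin_subset_forms[OF graded_idealD(2)[OF J] f])
next
  fix k l and g z :: "'k mpoly" assume g: "g \<in> forms n k" and z: "z \<in> adjoin_ideal n e f J l"
  obtain x y where xy: "z = x + f * y" "x \<in> J l" "y \<in> lower_forms n e l"
    using z by (rule adjoin_idealE)
  have "g * y \<in> lower_forms n e (k + l)"
  proof (cases "e \<le> l")
    case True
    then have "y \<in> forms n (l - e)" using xy(3) by (simp add: lower_forms_def)
    then have "g * y \<in> forms n (k + (l - e))" by (rule mult_in_forms[OF g])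
    then show ?thesis using True by (simp add: lower_forms_def)
  next
    case False
    then have "y = 0" using xy(3) by (simp add: lower_forms_def)
    then show ?thesis by (simp add: mp.subspace_0[OF subspace_lower_forms])
  qed
  moreover have "g * x \<in> J (k + l)" using graded_idealD(3)[OF J g xy(2)] .
  ultimately have "g * x + f * (g * y) \<in> adjoin_ideal n e f J (k + l)" by (rule adjoin_idealI[rotated])
  then show "g * z \<in> adjoin_ideal n e f J (k + l)" by (simp add: xy(1) algebra_simps)
qed

text \<open>The first claim is a graded Nakayama argument: from \<open>g x\<close> in J one gets
  \<open>x = j + f y\<close> with \<open>g y\<close> in J, and \<open>y\<close> has smaller degree
  because \<open>0 < e\<close>. For the second, \<open>f x = j + g y\<close> and
  \<open>y = j' + f z\<close> give \<open>f (x - g z)\<close> in J, hence \<open>x - g z\<close> in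
  J.\<close>

lemma nonzerodivisor_swap:
  fixes J :: "nat \<Rightarrow> 'k::field mpoly set"
  assumes J: "graded_ideal n J" and e: "0 < e" and f: "nonzerodivisor n J e f"
    and g: "nonzerodivisor n (adjoin_ideal n e f J) e' g"
  shows "nonzerodivisor n J e' g" "nonzerodivisor n (adjoin_ideal n e' g J) e f"
proof -
  note ff = nonzerodivisorD(1)[OF f] and gf = nonzerodivisorD(1)[OF g]
  note sub = graded_idealD(1)[OF J]
  have g_inj: "x \<in> J l" if "x \<in> forms n l" "g * x \<in> J (e' + l)" for x l
    using that
  proof (induction l arbitrary: x rule: less_induct)
    case (less l)
    have "g * x \<in> adjoin_ideal n e f J (e' + l)" using less.prems(2) subset_adjoin_ideal by blast
    then have "x \<in> adjoin_ideal n e f J l" by (rule nonzerodivisorD(2)[OF g less.prems(1)])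
    then obtain j y where jy: "x = j + f * y" "j \<in> J l" "y \<in> lower_forms n e l"
      by (rule adjoin_idealE)
    show ?case
    proof (cases "e \<le> l")
      case False
      then show ?thesis using jy by (simp add: lower_forms_def)
    next
      case True
      then have y: "y \<in> forms n (l - e)" using jy(3) by (simp add: lower_forms_def)
      have "f * (g * y) = g * x - g * j" by (simp add: jy(1) algebra_simps)
      also have "\<dots> \<in> J (e' + l)"
        by (rule mp.subspace_diff[OF sub less.prems(2) graded_idealD(3)[OF J gf jy(2)]])
      also have "e' + l = e + (e' + (l - e))" using True by simp
      finally have "g * y \<in> J (e' + (l - e))"
        by (rule nonzerodivisorD(2)[OF f mult_in_forms[OF gf y]])
      then have "y \<in> J (l - e)" using less.IH[of "l - e" y] y e True by simp
      then have "f * y \<in> J (e + (l - e))" by (rule graded_idealD(3)[OF J ff])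
      then have "f * y \<in> J l" using True by simp
      then show ?thesis unfolding jy(1) by (rule mp.subspace_add[OF sub jy(2)])
    qed
  qed
  then show "nonzerodivisor n J e' g" using gf unfolding nonzerodivisor_def by blast
  have "x \<in> adjoin_ideal n e' g J l"
    if x: "x \<in> forms n l" and fx: "f * x \<in> adjoin_ideal n e' g J (e + l)" for x l
  proof -
    obtain j y where jy: "f * x = j + g * y" "j \<in> J (e + l)" "y \<in> lower_forms n e' (e + l)"
      using fx by (rule adjoin_idealE)
    have mem: "x \<in> adjoin_ideal n e' g J l" if "f * x \<in> J (e + l)"
      using nonzerodivisorD(2)[OF f x that] subset_adjoin_ideal by blast
    show ?thesis
    proof (cases "e' \<le> e + l")
      case False
      then have "f * x \<in> J (e + l)" using jy by (simp add: lower_forms_def)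
      then show ?thesis by (rule mem)
    next
      case True
      then have y: "y \<in> forms n (e + l - e')" using jy(3) by (simp add: lower_forms_def)
      have "- j + f * x \<in> adjoin_ideal n e f J (e + l)"
        by (rule adjoin_idealI[of "- j" J "e + l" x n e f, OF mp.subspace_neg[OF sub jy(2)]])
          (simp add: lower_forms_def x)
      then have "g * y \<in> adjoin_ideal n e f J (e' + (e + l - e'))" using jy(1) True by simp
      then have "y \<in> adjoin_ideal n e f J (e + l - e')" by (rule nonzerodivisorD(2)[OF g y])
      then obtain j' z where jz: "y = j' + f * z" "j' \<in> J (e + l - e')" "z \<in> lower_forms n e (e + l - e')"
        by (rule adjoin_idealE)
      have "g * j' \<in> J (e' + (e + l - e'))" by (rule graded_idealD(3)[OF J gf jz(2)])
      then have "j + g * j' \<in> J (e + l)" using mp.subspace_add[OF sub jy(2)] True by simp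
      moreover have "f * (x - g * z) = j + g * j'" using jy(1) by (simp add: jz(1) algebra_simps)
      ultimately have fxz: "f * (x - g * z) \<in> J (e + l)" by simp
      show ?thesis
      proof (cases "e' \<le> l")
        case False
        \<comment> \<open>The degree of \<open>z\<close> would be \<open>l - e'\<close>, which is
          negative.\<close>
        then have "z = 0" using jz(3) True by (auto simp: lower_forms_def split: if_splits)
        then show ?thesis using fxz by (intro mem) simp
      next
        case True
        then have "e \<le> e + l - e'" "e + l - e' - e = l - e'" by linarith+
        then have z: "z \<in> forms n (l - e')" using jz(3) by (simp add: lower_forms_def)
        have "g * z \<in> forms n l" using mult_in_forms[OF gf z] True by simp
        then have "x - g * z \<in> forms n l" by (rule mp.subspace_diff[OF subspace_forms x])
        then have "x - g * z \<in> J l" using fxz by (rule nonzerodivisorD(2)[OF f])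
        then have "x - g * z + g * z \<in> adjoin_ideal n e' g J l"
          by (rule adjoin_idealI) (simp add: lower_forms_def True z)
        then show ?thesis by simp
      qed
    qed
  qed
  then show "nonzerodivisor n (adjoin_ideal n e' g J) e f" using ff unfolding nonzerodivisor_def by blast
qed

text \<open>Members carry their degrees because \<open>adjoin_ideal\<close> depends on them.
  Properness of the quotient is expressed separately, as \<open>0 < codim n 0 (J 0)\<close>.\<close>

fun regular :: "nat \<Rightarrow> (nat \<Rightarrow> 'k::field mpoly set) \<Rightarrow> (nat \<times> 'k mpoly) list \<Rightarrow> bool" where
  "regular n J [] \<longleftrightarrow> True"
| "regular n J ((e, f) # fs) \<longleftrightarrow>
     0 < e \<and> nonzerodivisor n J e f \<and> regular n (adjoin_ideal n e f J) fs"

fun adjoin_list ::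
  "nat \<Rightarrow> (nat \<times> 'k::field mpoly) list \<Rightarrow> (nat \<Rightarrow> 'k mpoly set) \<Rightarrow> nat \<Rightarrow> 'k mpoly set" where
  "adjoin_list n [] J = J"
| "adjoin_list n ((e, f) # fs) J = adjoin_list n fs (adjoin_ideal n e f J)"

lemma regular_append:
  "regular n J (fs @ gs) \<longleftrightarrow> regular n J fs \<and> regular n (adjoin_list n fs J) gs"
  by (induction n J fs rule: regular.induct) auto

lemma graded_ideal_adjoin_list:
  "graded_ideal n J \<Longrightarrow> regular n J fs \<Longrightarrow> graded_ideal n (adjoin_list n fs J)"
  by (induction n J fs rule: regular.induct) (auto intro: graded_ideal_adjoin nonzerodivisorD(1))

text \<open>The last member travels to the front by successive swaps, each performed modulo the
  members that precede the pair.\<close>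

lemma regular_rotate:
  "graded_ideal n J \<Longrightarrow> regular n J (gs @ [(e, f)]) \<Longrightarrow> regular n J ((e, f) # gs)"
proof (induction gs arbitrary: J)
  case (Cons a gs)
  obtain e' g where a: "a = (e', g)" by (cases a)
  have g: "0 < e'" "nonzerodivisor n J e' g" "regular n (adjoin_ideal n e' g J) (gs @ [(e, f)])"
    using Cons.prems a by auto
  have "graded_ideal n (adjoin_ideal n e' g J)"
    by (rule graded_ideal_adjoin[OF Cons.prems(1) nonzerodivisorD(1)[OF g(2)]])
  then have "regular n (adjoin_ideal n e' g J) ((e, f) # gs)" using g(3) by (rule Cons.IH)
  then have f: "0 < e" "nonzerodivisor n (adjoin_ideal n e' g J) e f"
    "regular n (adjoin_ideal n e f (adjoin_ideal n e' g J)) gs" by auto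
  then show ?case
    using nonzerodivisor_swap[OF Cons.prems(1) g(1,2) f(2)] a g(1)
    by (simp add: adjoin_ideal_commute[of n e' g])
qed simp

section \<open>Hilbert series\<close>

definition hilbert_series :: "nat \<Rightarrow> (nat \<Rightarrow> 'k::field mpoly set) \<Rightarrow> int fps" where
  "hilbert_series n J = Abs_fps (\<lambda>l. int (codim n l (J l)))"

lemma hilbert_series_nth [simp]: "fps_nth (hilbert_series n J) l = int (codim n l (J l))"
  by (simp add: hilbert_series_def)

text \<open>For a nonzerodivisor the colon space is \<open>J (d - e)\<close> itself, so
  \<open>codim_split\<close> becomes a recursion for the Hilbert function.\<close>

lemma codim_adjoin_nonzerodivisor:
  fixes J :: "nat \<Rightarrow> 'k::field mpoly set"
  assumes J: "graded_ideal n J" and f: "nonzerodivisor n J e f"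
  shows "codim n d (J d) =
    codim n d (adjoin_ideal n e f J d) + (if e \<le> d then codim n (d - e) (J (d - e)) else 0)"
proof -
  note V = graded_idealD(1,2)[OF J, of d]
  note ff = nonzerodivisorD(1)[OF f]
  note split = codim_split[OF V ff]
  show ?thesis
  proof (cases "e \<le> d")
    case True
    have "colon n e f d (J d) = J (d - e)"
    proof
      show "colon n e f d (J d) \<subseteq> J (d - e)"
        using nonzerodivisorD(2)[OF f, of _ "d - e"] True by (auto simp: colon_def lower_forms_def)
      show "J (d - e) \<subseteq> colon n e f d (J d)"
        using graded_idealD(2)[OF J, of "d - e"] graded_idealD(3)[OF J ff, of _ "d - e"] True
        by (auto simp: colon_def lower_forms_def)
    qed
    then show ?thesis
      using split True dim_le_dim_forms[OF graded_idealD(2)[OF J], of "d - e"]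
      by (simp add: lower_forms_def adjoin_ideal_def codim_def[of n "d - e"])
  next
    case False
    have "colon n e f d (J d) = {0}"
      using False mp.subspace_0[OF V(1)] by (auto simp: colon_def lower_forms_def)
    then show ?thesis using split False by (simp add: lower_forms_def adjoin_ideal_def)
  qed
qed

lemma hilbert_series_adjoin:
  assumes "graded_ideal n J" "nonzerodivisor n J e f"
  shows "hilbert_series n (adjoin_ideal n e f J) = hilbert_series n J * (1 - fps_X ^ e)"
proof (rule fps_ext)
  fix d
  show "fps_nth (hilbert_series n (adjoin_ideal n e f J)) d
      = fps_nth (hilbert_series n J * (1 - fps_X ^ e)) d"
    using codim_adjoin_nonzerodivisor[OF assms, of d]
    by (auto simp: right_diff_distrib fps_X_power_mult_right_nth not_le)
qed

lemma hilbert_series_adjoin_list: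
  "graded_ideal n J \<Longrightarrow> regular n J fs \<Longrightarrow>
    hilbert_series n (adjoin_list n fs J) = hilbert_series n J * (\<Prod>(e, f)\<leftarrow>fs. 1 - fps_X ^ e)"
  by (induction n J fs rule: regular.induct)
    (auto simp: hilbert_series_adjoin graded_ideal_adjoin nonzerodivisorD(1) mult.assoc)

definition finite_support :: "int fps \<Rightarrow> bool" where
  "finite_support F \<longleftrightarrow> (\<exists>N. \<forall>k\<ge>N. fps_nth F k = 0)"

lemma finite_support_mult:
  assumes "finite_support F" "finite_support G"
  shows "finite_support (F * G)"
proof -
  obtain N M where N: "\<And>k. N \<le> k \<Longrightarrow> fps_nth F k = 0" and M: "\<And>k. M \<le> k \<Longrightarrow> fps_nth G k = 0"
    using assms unfolding finite_support_def by blast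
  have "fps_nth (F * G) k = 0" if "N + M \<le> k" for k
    unfolding fps_mult_nth
  proof (rule sum.neutral, rule ballI)
    fix i
    show "fps_nth F i * fps_nth G (k - i) = 0"
      using that N[of i] M[of "k - i"] by (cases "N \<le> i") auto
  qed
  then show ?thesis unfolding finite_support_def by blast
qed

lemma finite_support_geometric: "finite_support (\<Sum>i<e. fps_X ^ i)"
  unfolding finite_support_def
  by (intro exI[of _ e]) (auto simp: fps_sum_nth fps_X_power_nth intro!: sum.neutral)

lemma finite_support_prod_geometric:
  "finite_support (\<Prod>(e, f)\<leftarrow>fs. \<Sum>i<e. fps_X ^ i)"
proof (induction fs)
  case Nil
  then show ?case by (auto simp: finite_support_def intro!: exI[of _ 1])
next
  case (Cons a fs)
  then show ?case by (cases a) (simp add: finite_support_mult finite_support_geometric)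
qed

lemma prod_one_minus_power:
  "(\<Prod>(e, f)\<leftarrow>fs. 1 - fps_X ^ e :: int fps)
    = (1 - fps_X) ^ length fs * (\<Prod>(e, f)\<leftarrow>fs. \<Sum>i<e. fps_X ^ i)"
  by (induction fs) (auto simp: one_diff_power_eq algebra_simps)

text \<open>The coefficients of \<open>F * (1 - fps_X)\<close> are the successive differences of
  those of \<open>F\<close>, which is therefore eventually constant.\<close>

lemma bounded_of_finite_support:
  assumes "finite_support (F * (1 - fps_X))"
  shows "\<exists>D. \<forall>k. fps_nth F k \<le> D"
proof -
  obtain N where N: "\<And>k. N \<le> k \<Longrightarrow> fps_nth (F * (1 - fps_X)) k = 0"
    using assms unfolding finite_support_def by blast
  have step: "fps_nth F (Suc k) = fps_nth F k" if "N \<le> Suc k" for k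
    using N[OF that] by (simp add: right_diff_distrib)
  have const: "fps_nth F (N + k) = fps_nth F N" for k
    by (induction k) (simp_all add: step)
  have "fps_nth F k \<le> Max (fps_nth F ` {..N})" for k
  proof (cases "k \<le> N")
    case False
    then have "fps_nth F k = fps_nth F N" using const[of "k - N"] by simp
    then show ?thesis by simp
  qed simp
  then show ?thesis by blast
qed

section \<open>Linear nonzerodivisors\<close>

text \<open>The saturation J : h^infinity, modulo which \<open>h\<close> is a nonzerodivisor by
  construction.\<close>

definition torsion :: "nat \<Rightarrow> (nat \<Rightarrow> 'k::field mpoly set) \<Rightarrow> 'k mpoly \<Rightarrow> nat \<Rightarrow> 'k mpoly set" where
  "torsion n J h l = {x \<in> forms n l. \<exists>j. h ^ j * x \<in> J (j + l)}"

lemma power_linear_in_forms: "h \<in> forms n 1 \<Longrightarrow> h ^ j \<in> forms n j"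
  using power_in_forms[of h n 1 j] by simp

lemma power_mult_in_ideal_mono:
  assumes "graded_ideal n J" "h \<in> forms n 1" "h ^ i * x \<in> J (i + l)" "i \<le> j"
  shows "h ^ j * x \<in> J (j + l)"
proof -
  have "h ^ (j - i) * (h ^ i * x) \<in> J ((j - i) + (i + l))"
    by (rule graded_idealD(3)[OF assms(1) power_linear_in_forms[OF assms(2)] assms(3)])
  moreover have "h ^ (j - i) * (h ^ i * x) = h ^ j * x"
    using assms(4) by (simp add: mult.assoc[symmetric] flip: power_add)
  moreover have "(j - i) + (i + l) = j + l" using assms(4) by simp
  ultimately show ?thesis by (simp only:)
qed

lemma graded_ideal_torsion:
  fixes J :: "nat \<Rightarrow> 'k::field mpoly set"
  assumes J: "graded_ideal n J" and h: "h \<in> forms n 1"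
  shows "graded_ideal n (torsion n J h)"
  unfolding graded_ideal_def
proof (intro conjI allI ballI)
  fix l
  show "mp.subspace (torsion n J h l)"
  proof (rule mp.subspaceI)
    show "0 \<in> torsion n J h l"
      using mp.subspace_0[OF graded_idealD(1)[OF J]] by (simp add: torsion_def)
    show "x + y \<in> torsion n J h l" if xy: "x \<in> torsion n J h l" "y \<in> torsion n J h l" for x y
    proof -
      obtain i j where ij: "h ^ i * x \<in> J (i + l)" "h ^ j * y \<in> J (j + l)"
        using xy unfolding torsion_def by blast
      have "h ^ max i j * x \<in> J (max i j + l)" "h ^ max i j * y \<in> J (max i j + l)"
        using power_mult_in_ideal_mono[OF J h ij(1)] power_mult_in_ideal_mono[OF J h ij(2)] by simp_all
      then have "h ^ max i j * (x + y) \<in> J (max i j + l)"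
        unfolding distrib_left by (rule mp.subspace_add[OF graded_idealD(1)[OF J]])
      moreover have "x + y \<in> forms n l"
        using xy mp.subspace_add[OF subspace_forms] unfolding torsion_def by blast
      ultimately show ?thesis unfolding torsion_def by blast
    qed
    show "scl c x \<in> torsion n J h l" if x: "x \<in> torsion n J h l" for c x
    proof -
      obtain i where "h ^ i * x \<in> J (i + l)" using x unfolding torsion_def by blast
      then have "h ^ i * scl c x \<in> J (i + l)"
        unfolding scl_mult_right by (rule mp.subspace_scale[OF graded_idealD(1)[OF J]])
      moreover have "scl c x \<in> forms n l"
        using x mp.subspace_scale[OF subspace_forms] unfolding torsion_def by blast
      ultimately show ?thesis unfolding torsion_def by blast
    qed
  qed
  show "torsion n J h l \<subseteq> forms n l" unfolding torsion_def by blast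
next
  fix k l and f g :: "'k mpoly" assume f: "f \<in> forms n k" and g: "g \<in> torsion n J h l"
  obtain j where "g \<in> forms n l" "h ^ j * g \<in> J (j + l)" using g unfolding torsion_def by blast
  then have "f * g \<in> forms n (k + l)" "f * (h ^ j * g) \<in> J (k + (j + l))"
    using mult_in_forms[OF f] graded_idealD(3)[OF J f] by blast+
  moreover have "f * (h ^ j * g) = h ^ j * (f * g)" "k + (j + l) = j + (k + l)"
    by (simp_all add: ac_simps)
  ultimately show "f * g \<in> torsion n J h (k + l)" unfolding torsion_def by auto
qed

lemma subset_torsion: "graded_ideal n J \<Longrightarrow> J l \<subseteq> torsion n J h l"
  using graded_idealD(2)[of n J l] by (auto simp: torsion_def intro!: exI[of _ 0])

lemma nonzerodivisor_torsion:
  assumes "h \<in> forms n 1"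
  shows "nonzerodivisor n (torsion n J h) 1 h"
  unfolding nonzerodivisor_def
proof (intro conjI allI ballI impI)
  fix l x assume x: "x \<in> forms n l" and "h * x \<in> torsion n J h (1 + l)"
  then obtain j where "h ^ j * (h * x) \<in> J (j + (1 + l))" unfolding torsion_def by blast
  then have "h ^ Suc j * x \<in> J (Suc j + l)" by (simp add: ac_simps)
  then show "x \<in> torsion n J h l" using x unfolding torsion_def by blast
qed (rule assms)

lemma nonzerodivisor_power:
  assumes f: "nonzerodivisor n J e f"
  shows "x \<in> forms n l \<Longrightarrow> f ^ j * x \<in> J (j * e + l) \<Longrightarrow> x \<in> J l"
proof (induction j)
  case (Suc j)
  have "f ^ j * x \<in> forms n (j * e + l)"
    by (rule mult_in_forms[OF power_in_forms[OF nonzerodivisorD(1)[OF f]] Suc.prems(1)])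
  moreover have "f * (f ^ j * x) \<in> J (e + (j * e + l))" using Suc.prems(2) by (simp add: ac_simps)
  ultimately have "f ^ j * x \<in> J (j * e + l)" by (rule nonzerodivisorD(2)[OF f])
  then show ?case by (rule Suc.IH[OF Suc.prems(1)])
qed simp

lemma var_power: "var i ^ j = Poly_Mapping.single (Poly_Mapping.single i j) 1"
  by (induction j) (simp_all add: var_def mult_single flip: single_add)

text \<open>Pigeonhole: a monomial of degree at least \<open>(n + 1) * N\<close> in
  \<open>n + 1\<close> variables contains some variable to the power \<open>N\<close>.\<close>

lemma all_forms_nilpotent:
  fixes J :: "nat \<Rightarrow> 'k::field mpoly set"
  assumes J: "graded_ideal n J" and x: "\<And>i. i \<le> n \<Longrightarrow> var i ^ N * x \<in> J (N + l)"
    and d: "(n + 1) * N \<le> d" and f: "f \<in> forms n d" and N: "0 < N"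
  shows "f * x \<in> J (d + l)"
proof -
  let ?V = "{f. f * x \<in> J (d + l)}"
  have "forms n d \<subseteq> ?V"
    unfolding forms_eq_span
  proof (rule mp.span_minimal)
    show "mp.subspace ?V"
      using graded_idealD(1)[OF J, of "d + l"]
      by (intro mp.subspaceI)
        (simp_all add: mp.subspace_0 distrib_right mp.subspace_add scl_mult_left mp.subspace_scale)
    show "(\<lambda>t. Poly_Mapping.single t 1) ` monomials n d \<subseteq> ?V"
    proof (rule image_subsetI)
      fix t assume t: "t \<in> monomials n d"
      have "\<exists>i\<in>{0..n}. N \<le> Poly_Mapping.lookup t i"
      proof (rule ccontr)
        assume "\<not> ?thesis"
        then have "\<forall>i\<in>{0..n}. Poly_Mapping.lookup t i < N" by (simp add: not_le)
        then have "(\<Sum>i\<in>{0..n}. Poly_Mapping.lookup t i) < (\<Sum>i\<in>{0..n}. N)"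
          by (intro sum_strict_mono) auto
        moreover have "mon_degree t = (\<Sum>i\<in>{0..n}. Poly_Mapping.lookup t i)"
          using t by (intro mon_degree_superset) (auto simp: monomials_def)
        ultimately show False using t d by (simp add: monomials_def)
      qed
      then obtain i where i: "i \<le> n" "N \<le> Poly_Mapping.lookup t i" by auto
      let ?s = "t - Poly_Mapping.single i N"
      have ts: "t = ?s + Poly_Mapping.single i N"
        using i(2) by (intro poly_mapping_eqI) (auto simp: lookup_add lookup_minus lookup_single when_def)
      have "Poly_Mapping.keys ?s \<subseteq> Poly_Mapping.keys t"
        by (auto simp: in_keys_iff lookup_minus)
      moreover have deg: "mon_degree t = mon_degree ?s + N"
        by (subst ts) (simp add: mon_degree_add)
      ultimately have "?s \<in> monomials n (d - N)" using t by (auto simp: monomials_def)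
      then have "Poly_Mapping.single ?s 1 * (var i ^ N * x) \<in> J ((d - N) + (N + l))"
        by (intro graded_idealD(3)[OF J] single_in_forms x i(1))
      moreover have "Poly_Mapping.single ?s 1 * (var i ^ N * x) = Poly_Mapping.single t 1 * x"
        by (subst (2) ts) (simp add: var_power mult_single flip: mult.assoc)
      moreover have "(d - N) + (N + l) = d + l" using t deg by (simp add: monomials_def)
      ultimately show "Poly_Mapping.single t 1 \<in> ?V" by (simp only: mem_Collect_eq)
    qed
  qed
  then show ?thesis using f by blast
qed

text \<open>If every variable were nilpotent on the class of \<open>x\<close>, all forms of large
  degree would annihilate it, among them a power of \<open>f\<close>.\<close>

lemma exists_nonnilpotent_variable:
  fixes J :: "nat \<Rightarrow> 'k::field mpoly set"
  assumes J: "graded_ideal n J" and f: "nonzerodivisor n J e f" and e: "0 < e"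
    and x: "x \<in> forms n l" "x \<notin> J l"
  shows "\<exists>i\<le>n. \<forall>j. var i ^ j * x \<notin> J (j + l)"
proof (rule ccontr)
  assume "\<not> ?thesis"
  then have "\<forall>i\<in>{0..n}. \<exists>j. var i ^ j * x \<in> J (j + l)" by auto
  from bchoice[OF this] obtain j where "\<forall>i\<in>{0..n}. var i ^ j i * x \<in> J (j i + l)" by blast
  then have j: "\<And>i. i \<le> n \<Longrightarrow> var i ^ j i * x \<in> J (j i + l)" by simp
  define N where "N = Suc (\<Sum>i\<in>{0..n}. j i)"
  have "var i ^ N * x \<in> J (N + l)" if i: "i \<le> n" for i
  proof (rule power_mult_in_ideal_mono[OF J var_in_forms[OF i] j[OF i]])
    have "j i \<le> (\<Sum>i\<in>{0..n}. j i)" using i by (intro member_le_sum) auto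
    then show "j i \<le> N" by (simp add: N_def)
  qed
  then have "f ^ ((n + 1) * N) * x \<in> J ((n + 1) * N * e + l)"
    by (rule all_forms_nilpotent[OF J _ _ power_in_forms[OF nonzerodivisorD(1)[OF f]]])
      (use e mult_le_mono2[of 1 e "(n + 1) * N"] in \<open>simp_all add: N_def\<close>)
  then show False using nonzerodivisor_power[OF f x(1)] x(2) by blast
qed

text \<open>Each term of the binomial expansion contains \<open>u\<close> at least \<open>a\<close>
  times or \<open>v\<close> at least \<open>b\<close> times.\<close>

lemma sum_nilpotent:
  fixes J :: "nat \<Rightarrow> 'k::field mpoly set"
  assumes J: "graded_ideal n J" and u: "u \<in> forms n 1" "u ^ a * x \<in> J (a + l)"
    and v: "v \<in> forms n 1" "v ^ b * x \<in> J (b + l)"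
  shows "(u + v) ^ (a + b) * x \<in> J ((a + b) + l)"
proof -
  have "u ^ k * v ^ (a + b - k) * x \<in> J ((a + b) + l)" if k: "k \<le> a + b" for k
  proof (cases "a \<le> k")
    case True
    have "v ^ (a + b - k) * (u ^ k * x) \<in> J ((a + b - k) + (k + l))"
      by (rule graded_idealD(3)[OF J power_linear_in_forms[OF v(1)]
            power_mult_in_ideal_mono[OF J u True]])
    then show ?thesis using k by (simp add: ac_simps)
  next
    case False
    then have "b \<le> a + b - k" by simp
    then have "u ^ k * (v ^ (a + b - k) * x) \<in> J (k + ((a + b - k) + l))"
      by (rule graded_idealD(3)[OF J power_linear_in_forms[OF u(1)]
            power_mult_in_ideal_mono[OF J v]])
    then show ?thesis using k by (simp add: ac_simps)
  qed
  then have summand: "of_nat (a + b choose k) * u ^ k * v ^ (a + b - k) * x \<in> J ((a + b) + l)"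
    if "k \<le> a + b" for k
    using mp.subspace_scale[OF graded_idealD(1)[OF J], of _ "(a + b) + l" "of_nat (a + b choose k)"] that
    by (simp add: scl_def mult.assoc)
  have "(u + v) ^ (a + b) * x
      = (\<Sum>k\<le>a + b. of_nat (a + b choose k) * u ^ k * v ^ (a + b - k) * x)"
    by (simp only: binomial_ring sum_distrib_right)
  also have "\<dots> \<in> J ((a + b) + l)"
    by (rule mp.subspace_sum[OF graded_idealD(1)[OF J]]) (use summand in simp)
  finally show ?thesis .
qed

lemma codim_mono_nonzerodivisor:
  assumes K: "graded_ideal n K" and h: "nonzerodivisor n K 1 h" and "a \<le> b"
  shows "codim n a (K a) \<le> codim n b (K b)"
  by (rule lift_Suc_mono_le[of "\<lambda>l. codim n l (K l)", OF _ assms(3)])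
    (simp add: codim_adjoin_nonzerodivisor[OF K h])

text \<open>On a quotient of eventually constant Hilbert function, a linear nonzerodivisor is eventually
  bijective, and stays so after a small perturbation.\<close>

lemma nonzerodivisor_perturb:
  fixes K :: "nat \<Rightarrow> 'k::field_char_0 mpoly set"
  assumes K: "graded_ideal n K" and h: "nonzerodivisor n K 1 h" and g: "g \<in> forms n 1"
    and const: "\<And>l. l0 \<le> l \<Longrightarrow> codim n l (K l) = codim n l0 (K l0)"
  shows "\<exists>t. t \<noteq> 0 \<and> nonzerodivisor n K 1 (h + scl t g)"
proof -
  note hf = nonzerodivisorD(1)[OF h]
  note sub = graded_idealD(1)[OF K] and Kf = graded_idealD(2)[OF K]
  \<comment> \<open>Only the rank in degree \<open>Suc l0\<close> is controlled by the choice of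
    \<open>t\<close>; every other degree is reduced to this one.\<close>
  have "finite (insert 0 {t. mp.dim (adjoin n 1 (h + scl t g) (Suc l0) (K (Suc l0)))
      < mp.dim (adjoin n 1 h (Suc l0) (K (Suc l0)))})"
    using finite_dim_adjoin_drop[OF sub Kf hf g] by simp
  from ex_new_if_finite[OF infinite_UNIV_char_0[where 'a = 'k] this]
  obtain t where t: "t \<noteq> 0" and
    tdim: "mp.dim (adjoin n 1 h (Suc l0) (K (Suc l0)))
      \<le> mp.dim (adjoin n 1 (h + scl t g) (Suc l0) (K (Suc l0)))"
    by (auto simp: not_less)
  let ?h = "h + scl t g"
  have h'f: "?h \<in> forms n 1"
    using hf g mp.subspace_add[OF subspace_forms] mp.subspace_scale[OF subspace_forms] by blast
  have onto: "forms n (Suc l) \<subseteq> adjoin n 1 h (Suc l) (K (Suc l))" if l: "l0 \<le> l" for l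
  proof -
    have "codim n (Suc l) (adjoin n 1 h (Suc l) (K (Suc l))) = 0"
      using codim_adjoin_nonzerodivisor[OF K h, of "Suc l"] const[of l] const[of "Suc l"] l
      by (simp add: adjoin_ideal_def)
    then have "mp.dim (forms n (Suc l) :: 'k mpoly set) \<le> mp.dim (adjoin n 1 h (Suc l) (K (Suc l)))"
      by (simp add: codim_def)
    then show ?thesis
      using dim_eq_imp_eq_forms[OF subspace_adjoin[OF sub] adjoin_subset_forms[OF Kf hf] subset_refl]
      by blast
  qed
  \<comment> \<open>In degree \<open>l0\<close> the new form is onto between quotients of equal
    dimension, hence injective.\<close>
  have base: "y \<in> K l0" if y: "y \<in> forms n l0" "?h * y \<in> K (Suc l0)" for y
  proof -
    let ?C = "colon n 1 ?h (Suc l0) (K (Suc l0))"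
    have "codim n (Suc l0) (adjoin n 1 ?h (Suc l0) (K (Suc l0)))
        \<le> codim n (Suc l0) (adjoin n 1 h (Suc l0) (K (Suc l0)))"
      unfolding codim_def using tdim by simp
    also have "\<dots> = 0"
      using codim_adjoin_nonzerodivisor[OF K h, of "Suc l0"] const[of "Suc l0"]
      by (simp add: adjoin_ideal_def)
    finally have cC: "codim n l0 ?C = codim n l0 (K l0)"
      using codim_split_linear[OF sub Kf h'f, of l0] const[of "Suc l0"] by simp
    have Cf: "?C \<subseteq> forms n l0"
      using colon_subset[of n 1 ?h "Suc l0" "K (Suc l0)"] by (simp add: lower_forms_def)
    have KC: "K l0 \<subseteq> ?C"
      using Kf[of l0] graded_idealD(3)[OF K h'f, of _ l0] by (auto simp: colon_def lower_forms_def)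
    have "mp.dim ?C \<le> mp.dim (K l0)"
      using cC dim_le_dim_forms[OF Cf] dim_le_dim_forms[OF Kf[of l0]] unfolding codim_def by linarith
    then have "K l0 = ?C" by (rule dim_eq_imp_eq_forms[OF sub KC Cf])
    then show ?thesis using y by (auto simp: colon_def lower_forms_def)
  qed
  \<comment> \<open>Multiplication by a power of \<open>h\<close> is injective modulo K, commutes
    with the new form and leads up to degree \<open>l0\<close>.\<close>
  have below: "y \<in> K l" if y: "y \<in> forms n l" "?h * y \<in> K (1 + l)" and l: "l \<le> l0" for y l
  proof -
    let ?p = "h ^ (l0 - l)"
    note pf = power_linear_in_forms[OF hf, of "l0 - l"]
    have "?p * (?h * y) \<in> K ((l0 - l) + (1 + l))" by (rule graded_idealD(3)[OF K pf y(2)])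
    then have "?h * (?p * y) \<in> K (Suc l0)" using l by (simp add: ac_simps)
    moreover have "?p * y \<in> forms n l0" using mult_in_forms[OF pf y(1)] l by simp
    ultimately have "?p * y \<in> K l0" by (intro base)
    then have "?p * y \<in> K ((l0 - l) * 1 + l)" using l by simp
    then show ?thesis by (rule nonzerodivisor_power[OF h y(1)])
  qed
  \<comment> \<open>Since \<open>h\<close> is onto in these degrees, \<open>y\<close> is
    \<open>h z\<close> modulo K. Cancelling \<open>h\<close> passes the problem to \<open>z\<close>,
    one degree lower.\<close>
  have above: "y \<in> K (l0 + i)" if "y \<in> forms n (l0 + i)" "?h * y \<in> K (1 + (l0 + i))" for y i
    using that
  proof (induction i arbitrary: y)
    case 0
    then show ?case using base by simp
  next
    case (Suc i)
    have "y \<in> adjoin n 1 h (Suc (l0 + i)) (K (Suc (l0 + i)))"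
      using onto[of "l0 + i"] Suc.prems(1) by auto
    then obtain k z where kz: "y = k + h * z" "k \<in> K (Suc (l0 + i))" "z \<in> forms n (l0 + i)"
      unfolding adjoin_def by (auto simp: lower_forms_def)
    have "h * (?h * z) = ?h * y - ?h * k" by (simp add: kz(1) algebra_simps)
    also have "\<dots> \<in> K (1 + (Suc (l0 + i)))"
      by (rule mp.subspace_diff[OF sub _ graded_idealD(3)[OF K h'f kz(2)]]) (use Suc.prems(2) in simp)
    finally have "h * (?h * z) \<in> K (1 + (1 + (l0 + i)))" by simp
    then have "?h * z \<in> K (1 + (l0 + i))"
      by (rule nonzerodivisorD(2)[OF h mult_in_forms[OF h'f kz(3)]])
    then have "z \<in> K (l0 + i)" by (rule Suc.IH[OF kz(3)])
    then have "h * z \<in> K (1 + (l0 + i))" by (rule graded_idealD(3)[OF K hf])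
    then show ?case using mp.subspace_add[OF sub kz(2)] kz(1) by simp
  qed
  have "nonzerodivisor n K 1 ?h"
    unfolding nonzerodivisor_def
  proof (intro conjI allI ballI impI)
    fix l y assume "y \<in> forms n l" "?h * y \<in> K (1 + l)"
    then show "y \<in> K l" using below[of y l] above[of y "l - l0"] by (cases "l \<le> l0") auto
  qed (rule h'f)
  then show ?thesis using t by blast
qed

text \<open>Let K = J : h^infinity have maximal codimension, and suppose a class \<open>x\<close> of
  K is not in J. Some variable is not nilpotent on \<open>x\<close>, and adding a suitable multiple
  of it to \<open>h\<close> gives \<open>h'\<close>, still regular modulo K. Then J : h'^infinity
  lies in K but misses \<open>x\<close>, so its codimension is larger in some degree.\<close>

theorem exists_linear_nonzerodivisor:
  fixes J :: "nat \<Rightarrow> 'k::field_char_0 mpoly set"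
  assumes J: "graded_ideal n J" and f: "nonzerodivisor n J e f" and e: "0 < e"
    and D: "\<And>l. codim n l (J l) \<le> D"
  shows "\<exists>h. nonzerodivisor n J 1 h"
proof -
  let ?P = "\<lambda>p. fst p \<in> forms n 1" and ?m = "\<lambda>p. codim n (snd p) (torsion n J (fst p) (snd p))"
  have bound: "?m p < Suc D" if "?P p" for p
  proof -
    have "?m p \<le> codim n (snd p) (J (snd p))"
      by (rule codim_antimono[OF subset_torsion[OF J] graded_idealD(2)[OF graded_ideal_torsion[OF J that]]])
    then show ?thesis using D[of "snd p"] by simp
  qed
  \<comment> \<open>The maximum is taken over forms and degrees together; \<open>D\<close> makes it
    exist.\<close>
  have "\<exists>p. ?P p \<and> (\<forall>q. ?P q \<longrightarrow> ?m q \<le> ?m p)"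
    by (rule ex_has_greatest_nat[of ?P "(0, 0)" ?m "Suc D"]) (use bound in auto)
  then obtain p where p: "?P p" "\<And>q. ?P q \<Longrightarrow> ?m q \<le> ?m p" by blast
  obtain h l0 where p_eq: "p = (h, l0)" by (cases p)
  define K where "K = torsion n J h"
  have h: "h \<in> forms n 1" using p(1) p_eq by simp
  have max: "codim n l (torsion n J h' l) \<le> codim n l0 (K l0)" if "h' \<in> forms n 1" for h' l
    using p(2)[of "(h', l)"] that by (simp add: p_eq K_def)
  have K: "graded_ideal n K" unfolding K_def by (rule graded_ideal_torsion[OF J h])
  have hK: "nonzerodivisor n K 1 h" unfolding K_def by (rule nonzerodivisor_torsion[OF h])
  have JK: "J l \<subseteq> K l" for l unfolding K_def by (rule subset_torsion[OF J])
  \<comment> \<open>Multiplication by \<open>h\<close> makes the codimension of K nondecreasing, and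
    it is already maximal in degree \<open>l0\<close>.\<close>
  have const: "codim n l (K l) = codim n l0 (K l0)" if "l0 \<le> l" for l
    using codim_mono_nonzerodivisor[OF K hK that] max[OF h, of l] unfolding K_def by (rule antisym[rotated])
  have "K l \<subseteq> J l" for l
  proof (rule ccontr)
    assume "\<not> K l \<subseteq> J l"
    then obtain x where x: "x \<in> K l" "x \<notin> J l" by blast
    have xf: "x \<in> forms n l" using x(1) graded_idealD(2)[OF K] by blast
    obtain i where i: "i \<le> n" "\<And>j. var i ^ j * x \<notin> J (j + l)"
      using exists_nonnilpotent_variable[OF J f e xf x(2)] by blast
    obtain t where t: "t \<noteq> 0" and h'K: "nonzerodivisor n K 1 (h + scl t (var i))"
      using nonzerodivisor_perturb[OF K hK var_in_forms[OF i(1)] const] by blast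
    let ?h = "h + scl t (var i)"
    define K' where "K' = torsion n J ?h"
    note h'f = nonzerodivisorD(1)[OF h'K]
    have K': "graded_ideal n K'" unfolding K'_def by (rule graded_ideal_torsion[OF J h'f])
    have h'K': "nonzerodivisor n K' 1 ?h" unfolding K'_def by (rule nonzerodivisor_torsion[OF h'f])
    have K'K: "K' l \<subseteq> K l" for l
    proof
      fix y assume "y \<in> K' l"
      then obtain j where y: "y \<in> forms n l" "?h ^ j * y \<in> J (j + l)"
        unfolding K'_def torsion_def by blast
      then have "?h ^ j * y \<in> K (j * 1 + l)" using JK by auto
      then show "y \<in> K l" by (rule nonzerodivisor_power[OF h'K y(1)])
    qed
    have "x \<notin> K' l"
    proof
      assume "x \<in> K' l"
      then obtain b where b: "?h ^ b * x \<in> J (b + l)" unfolding K'_def torsion_def by blast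
      obtain a where a: "h ^ a * x \<in> J (a + l)" using x(1) unfolding K_def torsion_def by blast
      \<comment> \<open>The difference of the new form and \<open>h\<close> is a multiple of the
        variable, which would then be nilpotent on \<open>x\<close>.\<close>
      have "(- h) ^ a * x \<in> J (a + l)"
        using a mp.subspace_neg[OF graded_idealD(1)[OF J] a]
        by (cases "even a") (simp_all add: power_minus_odd)
      from sum_nilpotent[OF J h'f b mp.subspace_neg[OF subspace_forms h] this]
      have "scl t (var i) ^ (b + a) * x \<in> J ((b + a) + l)" by simp
      moreover have "scl t (var i) ^ j = scl (t ^ j) (var i ^ j)" for j
        by (induction j) (simp_all add: scl_mult_left scl_mult_right mult.commute)
      ultimately have "scl (t ^ (b + a)) (var i ^ (b + a) * x) \<in> J ((b + a) + l)"
        by (simp add: scl_mult_left)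
      from mp.subspace_scale[OF graded_idealD(1)[OF J] this, of "inverse (t ^ (b + a))"]
      show False using i(2)[of "b + a"] t by simp
    qed
    \<comment> \<open>\<open>x\<close> may lie below degree \<open>l0\<close>. Its multiple by a
      power of the new form stays outside K' and reaches a degree where the codimension of K is the
      maximum.\<close>
    let ?y = "?h ^ l0 * x"
    have yK: "?y \<in> K (l0 + l)"
      by (rule graded_idealD(3)[OF K power_linear_in_forms[OF h'f] x(1)])
    have "?y \<notin> K' (l0 + l)"
      using nonzerodivisor_power[OF h'K' xf, of l0] \<open>x \<notin> K' l\<close> by auto
    then have "K' (l0 + l) \<noteq> K (l0 + l)" using yK by blast
    then have "mp.dim (K' (l0 + l)) < mp.dim (K (l0 + l))"
      using dim_eq_imp_eq_forms[OF graded_idealD(1)[OF K'] K'K graded_idealD(2)[OF K]]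
      by (meson not_le)
    then have "codim n (l0 + l) (K (l0 + l)) < codim n (l0 + l) (K' (l0 + l))"
      using dim_le_dim_forms[OF graded_idealD(2)[OF K], of "l0 + l"] unfolding codim_def by linarith
    then show False using const[of "l0 + l"] max[OF h'f, of "l0 + l"] unfolding K'_def by simp
  qed
  then have "K = J" using JK by (intro ext) blast
  then show ?thesis using hK by blast
qed

text \<open>The last member is replaced by a linear form and rotated to the front; adjoining that
  form shortens the sequence. The series times \<open>(1 - fps_X) ^ length fs\<close> is unchanged
  in this process, so the finiteness hypothesis persists.\<close>

theorem exists_linear_regular_sequence:
  fixes J :: "nat \<Rightarrow> 'k::field_char_0 mpoly set"
  assumes "graded_ideal n J" "regular n J fs" "finite_support (hilbert_series n J * (1 - fps_X) ^ length fs)"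
  shows "\<exists>J' :: nat \<Rightarrow> 'k mpoly set.
    graded_ideal n J' \<and> hilbert_series n J' = hilbert_series n J * (1 - fps_X) ^ length fs"
  using assms
proof (induction "length fs" arbitrary: fs J)
  case 0
  then have "fs = []" by simp
  then show ?case using 0(2) by (intro exI[of _ J]) simp
next
  case (Suc r)
  obtain gs e f where fs: "fs = gs @ [(e, f)]"
    using Suc.hyps(2) by (cases fs rule: rev_cases) auto
  have len: "length gs = r" using Suc.hyps(2) fs by simp
  define J1 where "J1 = adjoin_list n gs J"
  have gs: "regular n J gs" and f: "0 < e" "nonzerodivisor n J1 e f"
    using Suc.prems(2) unfolding fs regular_append J1_def by auto
  have J1: "graded_ideal n J1"
    unfolding J1_def by (rule graded_ideal_adjoin_list[OF Suc.prems(1) gs])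
  \<comment> \<open>Each factor \<open>1 - fps_X ^ e\<close> is \<open>1 - fps_X\<close> times a
    geometric sum, so what remains is the polynomial of the hypothesis times polynomials.\<close>
  have "hilbert_series n J1 * (1 - fps_X)
      = hilbert_series n J * (1 - fps_X) ^ length fs * (\<Prod>(e, f)\<leftarrow>gs. \<Sum>i<e. fps_X ^ i)"
    using hilbert_series_adjoin_list[OF Suc.prems(1) gs]
    by (simp add: J1_def prod_one_minus_power fs mult.assoc mult.left_commute)
  then have "finite_support (hilbert_series n J1 * (1 - fps_X))"
    using finite_support_mult[OF Suc.prems(3) finite_support_prod_geometric] by simp
  then obtain D where D: "\<And>k. fps_nth (hilbert_series n J1) k \<le> D"
    using bounded_of_finite_support by blast
  have D: "codim n l (J1 l) \<le> nat D" for l using D[of l] by simp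
  obtain h where "nonzerodivisor n J1 1 h"
    using exists_linear_nonzerodivisor[OF J1 f(2,1) D] by blast
  then have "regular n J (gs @ [(1, h)])" using gs by (simp add: regular_append J1_def)
  then have "regular n J ((1, h) # gs)" by (rule regular_rotate[OF Suc.prems(1)])
  then have h: "nonzerodivisor n J 1 h" and gs': "regular n (adjoin_ideal n 1 h J) gs" by auto
  have J2: "graded_ideal n (adjoin_ideal n 1 h J)"
    by (rule graded_ideal_adjoin[OF Suc.prems(1) nonzerodivisorD(1)[OF h]])
  have hs: "hilbert_series n (adjoin_ideal n 1 h J) * (1 - fps_X) ^ length gs
      = hilbert_series n J * (1 - fps_X) ^ length fs"
    using hilbert_series_adjoin[OF Suc.prems(1) h] by (simp add: fs mult.assoc)
  show ?case
    using Suc.hyps(1)[OF len[symmetric] J2 gs'] Suc.prems(3) unfolding hs by blast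
qed

section \<open>Substitution of linear forms\<close>

lemma monomials_0_left: "monomials 0 l = {Poly_Mapping.single 0 l}"
proof -
  have "t = Poly_Mapping.single 0 l" if "t \<in> monomials 0 l" for t
  proof (rule poly_mapping_eqI)
    fix i
    have keys: "Poly_Mapping.keys t \<subseteq> {0}" and deg: "mon_degree t = l"
      using that by (auto simp: monomials_def)
    have "mon_degree t = Poly_Mapping.lookup t 0"
      using mon_degree_superset[OF _ keys] by simp
    then show "Poly_Mapping.lookup t i = Poly_Mapping.lookup (Poly_Mapping.single 0 l) i"
      using keys deg by (cases "i = 0") (auto simp: lookup_single when_def in_keys_iff)
  qed
  moreover have "Poly_Mapping.single 0 l \<in> monomials 0 l" by (simp add: monomials_def)
  ultimately show ?thesis by blast
qed

lemma monomials_0_right: "monomials n 0 = {0}"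
proof -
  have "t = 0" if "t \<in> monomials n 0" for t
    using that by (intro poly_mapping_eqI) (auto simp: monomials_def mon_degree_def in_keys_iff)
  then show ?thesis by (auto simp: monomials_def)
qed

lemma monomials_Suc_Suc:
  "monomials (Suc n) (Suc l) =
     monomials n (Suc l) \<union> (+) (Poly_Mapping.single (Suc n) 1) ` monomials (Suc n) l"
proof (intro equalityI subsetI)
  fix t assume t: "t \<in> monomials (Suc n) (Suc l)"
  show "t \<in> monomials n (Suc l) \<union> (+) (Poly_Mapping.single (Suc n) 1) ` monomials (Suc n) l"
  proof (cases "Suc n \<in> Poly_Mapping.keys t")
    case False
    have "Poly_Mapping.keys t \<subseteq> {0..n}"
    proof
      fix i assume "i \<in> Poly_Mapping.keys t"
      then have "i \<in> {0..Suc n}" "i \<noteq> Suc n" using t False by (auto simp: monomials_def)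
      then show "i \<in> {0..n}" by simp
    qed
    then show ?thesis using t by (simp add: monomials_def)
  next
    case True
    let ?x = "Poly_Mapping.single (Suc n) 1 :: nat \<Rightarrow>\<^sub>0 nat"
    have ts: "t = ?x + (t - ?x)"
      using True by (intro poly_mapping_eqI) (auto simp: lookup_add lookup_minus lookup_single when_def in_keys_iff)
    have "Poly_Mapping.keys (t - ?x) \<subseteq> Poly_Mapping.keys t"
      by (auto simp: in_keys_iff lookup_minus)
    moreover have "mon_degree t = 1 + mon_degree (t - ?x)"
      by (subst ts) (simp add: mon_degree_add)
    ultimately have "t - ?x \<in> monomials (Suc n) l" using t by (auto simp: monomials_def)
    then have "?x + (t - ?x) \<in> (+) ?x ` monomials (Suc n) l" by (rule imageI)
    then show ?thesis using ts by simp
  qed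
next
  fix t assume t: "t \<in> monomials n (Suc l) \<union> (+) (Poly_Mapping.single (Suc n) 1) ` monomials (Suc n) l"
  show "t \<in> monomials (Suc n) (Suc l)"
  proof (cases "t \<in> monomials n (Suc l)")
    case True
    moreover have "{0..n} \<subseteq> {0..Suc n}" by auto
    ultimately show ?thesis unfolding monomials_def by blast
  next
    case False
    then obtain s where "t = Poly_Mapping.single (Suc n) 1 + s" "s \<in> monomials (Suc n) l"
      using t by blast
    then show ?thesis
      using keys_add[of "Poly_Mapping.single (Suc n) 1" s] by (auto simp: monomials_def mon_degree_add)
  qed
qed

lemma card_monomials: "card (monomials n l) = (l + n) choose n"
proof (induction n arbitrary: l)
  case 0
  then show ?case by (simp add: monomials_0_left)
next
  case (Suc n)
  note IH = Suc.IH
  show ?case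
  proof (induction l)
    case 0
    then show ?case by (simp add: monomials_0_right)
  next
    case (Suc l)
    let ?x = "Poly_Mapping.single (Suc n) 1 :: nat \<Rightarrow>\<^sub>0 nat"
    have "monomials n (Suc l) \<inter> (+) ?x ` monomials (Suc n) l = {}"
    proof -
      have "?x + s \<notin> monomials n (Suc l)" for s
      proof
        assume "?x + s \<in> monomials n (Suc l)"
        moreover have "Suc n \<in> Poly_Mapping.keys (?x + s)" by (simp add: in_keys_iff lookup_add)
        ultimately show False by (auto simp: monomials_def)
      qed
      then show ?thesis by blast
    qed
    then have "card (monomials (Suc n) (Suc l))
        = card (monomials n (Suc l)) + card ((+) ?x ` monomials (Suc n) l)"
      unfolding monomials_Suc_Suc by (intro card_Un_disjoint finite_imageI finite_monomials)
    also have "\<dots> = (Suc l + n choose n) + (l + Suc n choose Suc n)"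
      using IH[of "Suc l"] Suc.IH by (simp add: card_image)
    finally show ?case by simp
  qed
qed

section \<open>The homomorphism onto \<open>k[Y]\<close> and its kernel\<close>

definition subst_monomial :: "(nat \<Rightarrow> 'k::field mpoly) \<Rightarrow> (nat \<Rightarrow>\<^sub>0 nat) \<Rightarrow> 'k mpoly" where
  "subst_monomial Y t = (\<Prod>i\<in>Poly_Mapping.keys t. Y i ^ Poly_Mapping.lookup t i)"

text \<open>The algebra homomorphism that sends the variable \<open>var i\<close> to
  \<open>Y i\<close>. On polynomials in \<open>m + 1\<close> variables its image is the ring of
  \<open>form_ring\<close>, and its graded kernel is \<open>relations\<close>.\<close>

definition subst_forms :: "(nat \<Rightarrow> 'k::field mpoly) \<Rightarrow> 'k mpoly \<Rightarrow> 'k mpoly" where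
  "subst_forms Y f =
     (\<Sum>t\<in>Poly_Mapping.keys f. scl (Poly_Mapping.lookup f t) (subst_monomial Y t))"

lemma subst_monomial_superset:
  assumes "finite A" "Poly_Mapping.keys t \<subseteq> A"
  shows "subst_monomial Y t = (\<Prod>i\<in>A. Y i ^ Poly_Mapping.lookup t i)"
  unfolding subst_monomial_def using assms
  by (intro prod.mono_neutral_left) (auto simp: in_keys_iff)

lemma subst_monomial_add: "subst_monomial Y (s + t) = subst_monomial Y s * subst_monomial Y t"
proof -
  let ?A = "Poly_Mapping.keys s \<union> Poly_Mapping.keys t"
  have "subst_monomial Y (s + t) = (\<Prod>i\<in>?A. Y i ^ Poly_Mapping.lookup (s + t) i)"
    by (rule subst_monomial_superset) (simp_all add: keys_add)
  also have "\<dots> = (\<Prod>i\<in>?A. Y i ^ Poly_Mapping.lookup s i) * (\<Prod>i\<in>?A. Y i ^ Poly_Mapping.lookup t i)"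
    by (simp add: lookup_add power_add prod.distrib)
  also have "\<dots> = subst_monomial Y s * subst_monomial Y t"
    by (simp add: subst_monomial_superset[of ?A])
  finally show ?thesis .
qed

lemma subst_monomial_0 [simp]: "subst_monomial Y 0 = 1"
  by (simp add: subst_monomial_def)

lemma subst_monomial_single [simp]: "subst_monomial Y (Poly_Mapping.single i 1) = Y i"
  by (simp add: subst_monomial_def)

lemma subst_forms_superset:
  assumes "finite A" "Poly_Mapping.keys f \<subseteq> A"
  shows "subst_forms Y f = (\<Sum>t\<in>A. scl (Poly_Mapping.lookup f t) (subst_monomial Y t))"
  unfolding subst_forms_def using assms
  by (intro sum.mono_neutral_left) (auto simp: in_keys_iff)

lemma subst_forms_add: "subst_forms Y (f + g) = subst_forms Y f + subst_forms Y g"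
proof -
  let ?A = "Poly_Mapping.keys f \<union> Poly_Mapping.keys g"
  have "subst_forms Y (f + g) = (\<Sum>t\<in>?A. scl (Poly_Mapping.lookup (f + g) t) (subst_monomial Y t))"
    by (rule subst_forms_superset) (simp_all add: keys_add)
  then show ?thesis
    by (simp add: subst_forms_superset[of ?A] lookup_add mp.scale_left_distrib sum.distrib)
qed

lemma subst_forms_scl: "subst_forms Y (scl c f) = scl c (subst_forms Y f)"
proof -
  have "subst_forms Y (scl c f)
      = (\<Sum>t\<in>Poly_Mapping.keys f. scl (Poly_Mapping.lookup (scl c f) t) (subst_monomial Y t))"
    by (rule subst_forms_superset) (simp_all add: keys_scl)
  then show ?thesis by (simp add: subst_forms_def lookup_scl mp.scale_sum_right)
qed

lemma subst_forms_0 [simp]: "subst_forms Y 0 = 0"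
  by (simp add: subst_forms_def)

lemma subst_forms_sum: "subst_forms Y (\<Sum>a\<in>A. f a) = (\<Sum>a\<in>A. subst_forms Y (f a))"
  by (induction A rule: infinite_finite_induct) (simp_all add: subst_forms_add)

lemma subst_forms_single: "subst_forms Y (Poly_Mapping.single t c) = scl c (subst_monomial Y t)"
  by (cases "c = 0") (simp_all add: subst_forms_def)

lemma subst_forms_mult: "subst_forms Y (f * g) = subst_forms Y f * subst_forms Y g"
proof -
  let ?F = "Poly_Mapping.keys f" and ?G = "Poly_Mapping.keys g"
  let ?f = "Poly_Mapping.lookup f" and ?g = "Poly_Mapping.lookup g"
  have "f * g = (\<Sum>s\<in>?F. Poly_Mapping.single s (?f s)) * (\<Sum>t\<in>?G. Poly_Mapping.single t (?g t))"
    by (simp only: poly_mapping_sum_single[symmetric])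
  also have "\<dots> = (\<Sum>s\<in>?F. \<Sum>t\<in>?G. Poly_Mapping.single (s + t) (?f s * ?g t))"
    by (simp add: sum_product mult_single)
  finally have "subst_forms Y (f * g)
      = (\<Sum>s\<in>?F. \<Sum>t\<in>?G. scl (?f s * ?g t) (subst_monomial Y s * subst_monomial Y t))"
    by (simp add: subst_forms_sum subst_forms_single subst_monomial_add)
  also have "\<dots> = subst_forms Y f * subst_forms Y g"
    by (simp add: subst_forms_def sum_product scl_mult_left scl_mult_right mult.commute)
  finally show ?thesis .
qed

lemma subst_monomial_in_forms:
  assumes "\<forall>i\<le>m. Y i \<in> forms n 1"
  shows "t \<in> monomials m l \<Longrightarrow> subst_monomial Y t \<in> forms n l"
proof (induction l arbitrary: t)
  case 0
  then show ?case by (simp add: monomials_0_right one_in_forms)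
next
  case (Suc l)
  obtain i s where split: "i \<le> m" "s \<in> monomials m l" "t = Poly_Mapping.single i 1 + s"
    using Suc.prems by (rule monomial_Suc_split)
  have "Y i * subst_monomial Y s \<in> forms n (1 + l)"
    by (rule mult_in_forms[OF assms[rule_format, OF split(1)] Suc.IH[OF split(2)]])
  then show ?case unfolding split(3) subst_monomial_add subst_monomial_single by simp
qed

lemma subst_in_forms:
  assumes "\<forall>i\<le>m. Y i \<in> forms n 1" "f \<in> forms m l"
  shows "subst_forms Y f \<in> forms n l"
  unfolding subst_forms_def
  using assms(2)
  by (intro mp.subspace_sum[OF subspace_forms] mp.subspace_scale[OF subspace_forms]
      subst_monomial_in_forms[OF assms(1)]) (auto simp: forms_def)

definition relations :: "nat \<Rightarrow> (nat \<Rightarrow> 'k::field mpoly) \<Rightarrow> nat \<Rightarrow> 'k mpoly set" where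
  "relations m Y l = {f \<in> forms m l. subst_forms Y f = 0}"

lemma graded_ideal_relations: "graded_ideal m (relations m Y)"
  unfolding graded_ideal_def
proof (intro conjI allI ballI)
  show "mp.subspace (relations m Y l)" for l
    unfolding relations_def
    by (intro mp.subspaceI)
      (auto simp: subst_forms_add subst_forms_scl mp.subspace_add[OF subspace_forms]
        mp.subspace_scale[OF subspace_forms])
  show "relations m Y l \<subseteq> forms m l" for l by (auto simp: relations_def)
  show "f * g \<in> relations m Y (k + l)" if "f \<in> forms m k" "g \<in> relations m Y l" for k l f g
    using that mult_in_forms by (auto simp: relations_def subst_forms_mult)
qed

lemma dim_subst_forms: "mp.dim (subst_forms Y ` forms m l) = codim m l (relations m Y l)"
proof -
  have "mp.dim (forms m l :: 'a mpoly set)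
      = mp.dim {f \<in> forms m l. subst_forms Y f = 0} + mp.dim (subst_forms Y ` forms m l)"
    by (rule mpp.dim_kernel_plus_dim_image[OF subspace_forms forms_subset_span finite_mono_basis])
      (simp_all add: subst_forms_add subst_forms_scl)
  then show ?thesis by (simp add: codim_def relations_def)
qed

section \<open>Growth of Hilbert functions\<close>

lemma graded_ideal_zero: "graded_ideal n (\<lambda>_. {0})"
  unfolding graded_ideal_def by (simp add: mp.subspace_single_0)

lemma codim_zero: "codim n l ({0} :: 'k::field mpoly set) = (l + n) choose n"
proof -
  have "mp.dim ({0} :: 'k mpoly set) = 0"
    using mp.dim_le_card[of "{0}" "{}"] by simp
  then show ?thesis by (simp add: codim_def dim_forms card_monomials)
qed

text \<open>Bounds the Hilbert function of a hypersurface of degree \<open>e\<close>: by Pascal's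
  rule the difference of the two binomials is a sum of at most \<open>e\<close> terms, each at most
  \<open>(l + p) choose p\<close>.\<close>

lemma binomial_growth:
  "((l + Suc p) choose Suc p)
    \<le> (if e \<le> l then (l - e + Suc p) choose Suc p else 0) + e * ((l + p) choose p)"
proof (induction e)
  case (Suc e)
  show ?case
  proof (cases "Suc e \<le> l")
    case True
    define a where "a = l - Suc e"
    have a: "l - e = Suc a" "l - Suc e = a" using True by (simp_all add: a_def)
    have "((Suc a + Suc p) choose Suc p) = ((a + Suc p) choose Suc p) + ((Suc a + p) choose p)"
      by simp
    moreover have "(Suc a + p) choose p \<le> (l + p) choose p"
      using True by (intro binomial_right_mono) (simp add: a_def)
    ultimately show ?thesis using Suc True a by (simp del: binomial_Suc_Suc)
  next
    case False
    have "1 \<le> (l + p) choose p" by (simp add: Suc_leI zero_less_binomial_iff)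
    then show ?thesis using Suc False by (cases "e = l") auto
  qed
qed simp

text \<open>The polynomial ring is a domain, so \<open>p\<close> is a nonzerodivisor modulo 0, and
  \<open>k[Y]\<close> is a quotient of the coordinate ring of the hypersurface
  \<open>p = 0\<close>.\<close>

lemma relation_growth:
  fixes Y :: "nat \<Rightarrow> 'k::field mpoly"
  assumes "p \<in> relations (Suc r) Y e" "p \<noteq> 0"
  shows "codim (Suc r) l (relations (Suc r) Y l) \<le> e * ((l + r) choose r)"
proof -
  let ?m = "Suc r"
  have pf: "p \<in> forms ?m e" using assms(1) by (simp add: relations_def)
  have nzd: "nonzerodivisor ?m (\<lambda>_. {0}) e p"
    unfolding nonzerodivisor_def using pf assms(2) by auto
  have "adjoin_ideal ?m e p (\<lambda>_. {0}) l \<subseteq> relations ?m Y l"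
    unfolding adjoin_ideal_def
  proof (rule adjoin_subset[OF graded_idealD(1)[OF graded_ideal_relations]])
    show "{0} \<subseteq> relations ?m Y l"
      using mp.subspace_0[OF graded_idealD(1)[OF graded_ideal_relations]] by blast
    fix y :: "'k mpoly" assume y: "y \<in> lower_forms ?m e l"
    have "p * y \<in> forms ?m l" by (rule mult_lower_forms[OF pf y])
    then show "p * y \<in> relations ?m Y l"
      using assms(1) by (simp add: relations_def subst_forms_mult)
  qed
  then have "codim ?m l (relations ?m Y l) \<le> codim ?m l (adjoin_ideal ?m e p (\<lambda>_. {0}) l)"
    by (rule codim_antimono[OF _ graded_idealD(2)[OF graded_ideal_relations]])
  moreover have "codim ?m l (adjoin_ideal ?m e p (\<lambda>_. {0}) l) +
      (if e \<le> l then (l - e + ?m) choose ?m else 0) = (l + ?m) choose ?m"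
    using codim_adjoin_nonzerodivisor[OF graded_ideal_zero nzd, of l]
    by (simp only: codim_zero)
  ultimately show ?thesis using binomial_growth[of l r e] by linarith
qed

lemma codim_adjoin_0:
  assumes "graded_ideal n J" "nonzerodivisor n J e f" "0 < e"
  shows "codim n 0 (adjoin_ideal n e f J 0) = codim n 0 (J 0)"
  using codim_adjoin_nonzerodivisor[OF assms(1,2), of 0] assms(3) by simp

lemma codim_multiple:
  assumes "graded_ideal n J" "nonzerodivisor n J e f"
  shows "codim n l (J l) \<le> codim n (e * i + l) (J (e * i + l))"
proof (induction i)
  case (Suc i)
  have "codim n (e * i + l) (J (e * i + l)) \<le> codim n (e * Suc i + l) (J (e * Suc i + l))"
    using codim_adjoin_nonzerodivisor[OF assms, of "e * Suc i + l"] by simp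
  then show ?case using Suc by simp
qed simp

text \<open>\<open>E\<close> is the product of the degrees of the members. Along multiples of
  \<open>E\<close> the recursion for a nonzerodivisor dominates Pascal's rule.\<close>

lemma regular_sequence_growth:
  "graded_ideal n J \<Longrightarrow> regular n J fs \<Longrightarrow> length fs = Suc r \<Longrightarrow> 0 < codim n 0 (J 0) \<Longrightarrow>
    \<exists>E>0. \<forall>k. (k + r) choose r \<le> codim n (E * k) (J (E * k))"
proof (induction r arbitrary: J fs)
  case 0
  obtain e f where fs: "fs = [(e, f)]" using 0(3) by (cases fs) auto
  have f: "0 < e" "nonzerodivisor n J e f" using 0(2) fs by auto
  show ?case
    using codim_multiple[OF 0(1) f(2), of 0] f(1) 0(4)
    by (intro exI[of _ e]) (auto intro: less_le_trans Suc_leI)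
next
  case (Suc r)
  obtain e f gs where fs: "fs = (e, f) # gs" using Suc.prems(3) by (cases fs) auto
  have f: "0 < e" "nonzerodivisor n J e f" "regular n (adjoin_ideal n e f J) gs"
    using Suc.prems(2) fs by auto
  let ?J' = "adjoin_ideal n e f J"
  have J': "graded_ideal n ?J'"
    by (rule graded_ideal_adjoin[OF Suc.prems(1) nonzerodivisorD(1)[OF f(2)]])
  have "0 < codim n 0 (?J' 0)" using codim_adjoin_0[OF Suc.prems(1) f(2,1)] Suc.prems(4) by simp
  moreover have "length gs = Suc r" using Suc.prems(3) fs by simp
  ultimately obtain E where E: "0 < E" "\<And>k. (k + r) choose r \<le> codim n (E * k) (?J' (E * k))"
    using Suc.IH[OF J' f(3)] by blast
  let ?E = "e * E"
  have "(k + Suc r) choose Suc r \<le> codim n (?E * k) (J (?E * k))" for k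
  proof (induction k)
    case 0
    then show ?case using Suc.prems(4) by simp
  next
    case (Suc k)
    let ?l = "?E * Suc k"
    have el: "e \<le> ?l" using E(1) f(1) by (cases E) auto
    \<comment> \<open>The recursion subtracts \<open>e\<close> once; \<open>E - 1\<close> further
      steps of size \<open>e\<close>, along which the codimension does not increase, lead down to
      \<open>?E * k\<close>.\<close>
    have "?E * Suc k - e = e * (E - 1) + ?E * k" using E(1) by (cases E) (auto simp: algebra_simps)
    then have "codim n (?E * k) (J (?E * k)) \<le> codim n (?l - e) (J (?l - e))"
      using codim_multiple[OF \<open>graded_ideal n J\<close> f(2), of "?E * k" "E - 1"] by simp
    moreover have "(Suc k + r) choose r \<le> codim n ?l (?J' ?l)"
    proof -
      \<comment> \<open>The hypothesis for the quotient concerns multiples of \<open>E\<close>, and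
        \<open>?l\<close> is \<open>E\<close> times \<open>e * Suc k\<close>.\<close>
      have "(Suc k + r) choose r \<le> (e * Suc k + r) choose r"
        using f(1) by (intro binomial_right_mono) (cases e, auto)
      also have "\<dots> \<le> codim n ?l (?J' ?l)" using E(2)[of "e * Suc k"] by (simp add: ac_simps)
      finally show ?thesis .
    qed
    moreover have "codim n ?l (J ?l) = codim n ?l (?J' ?l) + codim n (?l - e) (J (?l - e))"
      using codim_adjoin_nonzerodivisor[OF \<open>graded_ideal n J\<close> f(2), of ?l] el by simp
    moreover have "(Suc k + Suc r) choose Suc r = ((k + Suc r) choose Suc r) + ((Suc k + r) choose r)"
      by simp
    ultimately show ?case using Suc.IH by linarith
  qed
  then show ?case using E(1) f(1) by (intro exI[of _ ?E]) simp
qed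

text \<open>Growth of order \<open>r + 1\<close> beats order \<open>r\<close>, even when the slower
  side is evaluated at \<open>E * k + a\<close>. The scale \<open>E\<close> comes from
  \<open>regular_sequence_growth\<close>, the offset \<open>a\<close> from the degree of an element
  of the ideal.\<close>

lemma binomial_not_bounded:
  "\<exists>k. C * ((E * k + a + r) choose r) < (k + Suc r) choose Suc r"
proof (rule ccontr)
  assume "\<not> ?thesis"
  then have le: "(k + Suc r) choose Suc r \<le> C * ((E * k + a + r) choose r)" for k
    by (simp add: not_less)
  \<comment> \<open>Bounding both binomials by powers of \<open>N\<close> and cancelling
    \<open>N ^ r\<close> leaves \<open>N \<le> B\<close>, which \<open>k = Suc B\<close>
    excludes.\<close>
  define B where "B = C * (E + a + 1) ^ r * Suc r ^ Suc r"
  define k where "k = Suc B"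
  define N where "N = k + Suc r"
  have "real N ^ Suc r / real (Suc r) ^ Suc r \<le> real (N choose Suc r)"
    using binomial_ge_n_over_k_pow_k[of "Suc r" N, where 'a = real]
    by (simp add: N_def power_divide del: of_nat_Suc)
  also have "\<dots> \<le> real (C * ((E * k + a + r) choose r))"
    using le[of k] by (simp only: of_nat_le_iff N_def)
  also have "\<dots> \<le> real (C * ((E + a + 1) * N) ^ r)"
  proof -
    have "(E * k + a + r) choose r \<le> (E * k + a + r) ^ r" by (rule binomial_le_pow) simp
    also have "\<dots> \<le> ((E + a + 1) * N) ^ r"
    proof (rule power_mono)
      have "k \<le> N" "1 \<le> N" by (simp_all add: N_def)
      then have "E * k \<le> E * N" and "a * 1 \<le> a * N"
        using mult_le_mono2[of k N E] mult_le_mono2[of 1 N a] by blast+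
      moreover have "r \<le> 1 * N" by (simp add: N_def)
      ultimately show "E * k + a + r \<le> (E + a + 1) * N" unfolding distrib_right by linarith
    qed simp
    finally show ?thesis by (simp only: of_nat_le_iff mult_le_mono2)
  qed
  finally have "real N ^ Suc r \<le> real (C * ((E + a + 1) * N) ^ r) * real (Suc r) ^ Suc r"
    by (simp only: pos_divide_le_eq zero_less_power of_nat_0_less_iff zero_less_Suc)
  then have "N ^ Suc r \<le> C * ((E + a + 1) * N) ^ r * Suc r ^ Suc r"
    by (simp only: of_nat_le_iff flip: of_nat_mult of_nat_power)
  moreover have "C * ((E + a + 1) * N) ^ r * Suc r ^ Suc r = B * N ^ r"
    by (simp only: B_def power_mult_distrib mult.assoc mult.commute mult.left_commute)
  ultimately have "N * N ^ r \<le> B * N ^ r" by (simp only: power_Suc)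
  moreover have "0 < N ^ r" by (simp add: N_def)
  ultimately have "N \<le> B" by (simp only: mult_le_cancel2)
  then show False by (simp add: N_def k_def)
qed

text \<open>The Hilbert function of the direct sum of the R[-s_i], if \<open>\<rho>\<close> is that
  of R.\<close>

definition shifted_sum :: "nat \<Rightarrow> (nat \<Rightarrow> nat) \<Rightarrow> (nat \<Rightarrow> nat) \<Rightarrow> nat \<Rightarrow> nat" where
  "shifted_sum d s \<rho> l = (\<Sum>i<d. if s i \<le> l then \<rho> (l - s i) else 0)"

lemma shifted_sum_growth:
  assumes "\<And>l. \<rho> l \<le> C * ((l + r) choose r)"
  shows "shifted_sum d s \<rho> l \<le> d * C * ((l + r) choose r)"
proof -
  have "shifted_sum d s \<rho> l \<le> (\<Sum>i<d. C * ((l + r) choose r))"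
    unfolding shifted_sum_def
  proof (rule sum_mono)
    fix i
    have "\<rho> (l - s i) \<le> C * ((l - s i + r) choose r)" by (rule assms)
    also have "\<dots> \<le> C * ((l + r) choose r)" by (intro mult_le_mono2 binomial_right_mono) simp
    finally show "(if s i \<le> l then \<rho> (l - s i) else 0) \<le> C * ((l + r) choose r)" by simp
  qed
  then show ?thesis by simp
qed

text \<open>A single nonzero relation of degree \<open>e\<close> would bound the shifted sum by
  \<open>d * e\<close> times \<open>(l + r) choose r\<close>.\<close>

lemma codim_relations_eq:
  fixes Y :: "nat \<Rightarrow> 'k::field mpoly"
  assumes "\<And>C. \<exists>l. C * ((l + r) choose r) < shifted_sum d s (\<lambda>l. codim (Suc r) l (relations (Suc r) Y l)) l"
  shows "codim (Suc r) l (relations (Suc r) Y l) = (l + Suc r) choose Suc r"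
proof -
  have "p = 0" if p: "p \<in> relations (Suc r) Y e" for p e
  proof (rule ccontr)
    assume "p \<noteq> 0"
    from relation_growth[OF p this]
    have "shifted_sum d s (\<lambda>l. codim (Suc r) l (relations (Suc r) Y l)) l \<le> d * e * ((l + r) choose r)"
      for l by (rule shifted_sum_growth)
    then show False using assms[of "d * e"] by (auto simp: not_less[symmetric])
  qed
  moreover have "0 \<in> relations (Suc r) Y l"
    using mp.subspace_0[OF graded_idealD(1)[OF graded_ideal_relations]] .
  ultimately have "relations (Suc r) Y l = {0}" by blast
  then show ?thesis by (simp only: codim_zero)
qed

text \<open>The expansion of 1/(1 - T)^(n+1), the Hilbert series of a polynomial ring in
  \<open>n + 1\<close> variables.\<close>

definition binomial_series :: "nat \<Rightarrow> int fps" where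
  "binomial_series n = Abs_fps (\<lambda>l. int ((l + n) choose n))"

lemma binomial_series_inverse: "binomial_series n * (1 - fps_X) ^ Suc n = 1"
proof (induction n)
  case 0
  show ?case
    by (rule fps_ext) (simp add: binomial_series_def right_diff_distrib)
next
  case (Suc n)
  have "binomial_series (Suc n) * (1 - fps_X) = binomial_series n"
  proof (rule fps_ext)
    fix l
    show "fps_nth (binomial_series (Suc n) * (1 - fps_X)) l = fps_nth (binomial_series n) l"
      by (cases l) (simp_all add: binomial_series_def right_diff_distrib)
  qed
  then show ?case using Suc by (simp add: mult.assoc[symmetric])
qed

lemma shifted_sum_series:
  assumes "\<And>l. \<rho> l = (l + n) choose n"
  shows "Abs_fps (\<lambda>l. int (shifted_sum d s \<rho> l)) = (\<Sum>i<d. fps_X ^ s i) * binomial_series n"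
  by (rule fps_ext)
    (simp add: shifted_sum_def assms sum_distrib_right fps_sum_nth fps_X_power_mult_nth
      binomial_series_def, auto simp: assms intro!: sum.cong)

section \<open>Homogeneous ideals and their graded pieces\<close>

lemma mpoly_ring_simps [simp]:
  "x \<otimes>\<^bsub>mpoly_ring n\<^esub> y = x * y" "x \<oplus>\<^bsub>mpoly_ring n\<^esub> y = x + y"
  "\<one>\<^bsub>mpoly_ring n\<^esub> = 1" "\<zero>\<^bsub>mpoly_ring n\<^esub> = 0"
  by (simp_all add: mpoly_ring_def)

lemma carrier_mpoly_ring:
  "f \<in> carrier (mpoly_ring n) \<longleftrightarrow> (\<forall>t\<in>Poly_Mapping.keys f. Poly_Mapping.keys t \<subseteq> {0..n})"
  by (simp add: mpoly_ring_def)

lemma carrier_mpoly_ring_add: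
  assumes "f \<in> carrier (mpoly_ring n)" "g \<in> carrier (mpoly_ring n)"
  shows "f + g \<in> carrier (mpoly_ring n)"
  using assms keys_add[of f g] unfolding carrier_mpoly_ring by blast

lemma carrier_mpoly_ring_mult:
  fixes f g :: "'k::comm_ring_1 mpoly"
  assumes "f \<in> carrier (mpoly_ring n)" "g \<in> carrier (mpoly_ring n)"
  shows "f * g \<in> carrier (mpoly_ring n)"
  unfolding carrier_mpoly_ring
proof
  fix t assume "t \<in> Poly_Mapping.keys (f * g)"
  then obtain r s where rs: "t = r + s" "r \<in> Poly_Mapping.keys f" "s \<in> Poly_Mapping.keys g"
    using keys_mult by blast
  then have "Poly_Mapping.keys r \<subseteq> {0..n}" "Poly_Mapping.keys s \<subseteq> {0..n}"
    using assms unfolding carrier_mpoly_ring by blast+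
  then show "Poly_Mapping.keys t \<subseteq> {0..n}" using keys_add[of r s] rs(1) by blast
qed

lemma carrier_mpoly_ring_single_0: "Poly_Mapping.single 0 c \<in> carrier (mpoly_ring n)"
  by (simp add: carrier_mpoly_ring)

lemma carrier_mpoly_ring_uminus: "f \<in> carrier (mpoly_ring n) \<Longrightarrow> - f \<in> carrier (mpoly_ring n)"
  by (simp add: carrier_mpoly_ring in_keys_iff)

lemma carrier_mpoly_ring_0: "0 \<in> carrier (mpoly_ring n)"
  by (simp add: carrier_mpoly_ring)

lemma carrier_mpoly_ring_1: "1 \<in> carrier (mpoly_ring n)"
  by (simp add: carrier_mpoly_ring)

lemma carrier_mpoly_ring_sum:
  "(\<And>i. i \<in> A \<Longrightarrow> f i \<in> carrier (mpoly_ring n)) \<Longrightarrow> (\<Sum>i\<in>A. f i) \<in> carrier (mpoly_ring n)"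
  by (induction A rule: infinite_finite_induct) (auto simp: carrier_mpoly_ring_0 carrier_mpoly_ring_add)

lemma forms_subset_carrier: "forms n l \<subseteq> carrier (mpoly_ring n)"
  unfolding forms_def monomials_def carrier_mpoly_ring[abs_def] mpoly_ring_def by auto

lemma cring_mpoly_ring: "cring (mpoly_ring n :: 'k::comm_ring_1 mpoly ring)"
proof (rule cringI)
  show "abelian_group (mpoly_ring n :: 'k mpoly ring)"
  proof (rule abelian_groupI)
    fix x :: "'k mpoly" assume "x \<in> carrier (mpoly_ring n)"
    then show "\<exists>y\<in>carrier (mpoly_ring n). y \<oplus>\<^bsub>mpoly_ring n\<^esub> x = \<zero>\<^bsub>mpoly_ring n\<^esub>"
      using carrier_mpoly_ring_uminus[of x n] by (intro bexI[of _ "- x"]) simp_all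
  qed (simp_all add: carrier_mpoly_ring_0 carrier_mpoly_ring_add ac_simps)
  show "Group.comm_monoid (mpoly_ring n :: 'k mpoly ring)"
    by (rule comm_monoidI) (simp_all add: carrier_mpoly_ring_1 carrier_mpoly_ring_mult ac_simps)
qed (simp add: distrib_right)

lemma a_inv_mpoly_ring:
  assumes "f \<in> carrier (mpoly_ring n)"
  shows "\<ominus>\<^bsub>mpoly_ring n\<^esub> f = - f"
proof -
  interpret cring "mpoly_ring n :: 'a mpoly ring" by (rule cring_mpoly_ring)
  show ?thesis by (rule minus_equality) (simp_all add: assms carrier_mpoly_ring_uminus)
qed

lemma ideal_mpoly_ringI:
  fixes S :: "'k::comm_ring_1 mpoly set"
  assumes sub: "S \<subseteq> carrier (mpoly_ring n)" and zero: "0 \<in> S"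
    and add: "\<And>x y. x \<in> S \<Longrightarrow> y \<in> S \<Longrightarrow> x + y \<in> S"
    and mult: "\<And>r x. r \<in> carrier (mpoly_ring n) \<Longrightarrow> x \<in> S \<Longrightarrow> r * x \<in> S"
  shows "ideal S (mpoly_ring n)"
proof -
  interpret cring "mpoly_ring n :: 'k mpoly ring" by (rule cring_mpoly_ring)
  have neg: "- x \<in> S" if "x \<in> S" for x
    using mult[OF carrier_mpoly_ring_uminus[OF carrier_mpoly_ring_1] that] by simp
  show ?thesis
  proof (rule idealI[OF ring_axioms])
    show "subgroup S (add_monoid (mpoly_ring n))"
    proof (rule subgroup.intro)
      fix x assume x: "x \<in> S"
      then have "\<ominus>\<^bsub>mpoly_ring n\<^esub> x = - x" using sub by (intro a_inv_mpoly_ring) blast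
      then show "inv\<^bsub>add_monoid (mpoly_ring n)\<^esub> x \<in> S" using neg[OF x] by (simp add: a_inv_def)
    qed (use sub zero add in auto)
    fix a x :: "'k mpoly" assume "a \<in> S" "x \<in> carrier (mpoly_ring n)"
    then have "x * a \<in> S" by (intro mult)
    then show "x \<otimes>\<^bsub>mpoly_ring n\<^esub> a \<in> S" "a \<otimes>\<^bsub>mpoly_ring n\<^esub> x \<in> S"
      by (simp_all add: mult.commute)
  qed
qed

lemma ideal_mpoly_ringD:
  fixes I :: "'k::comm_ring_1 mpoly set"
  assumes "ideal I (mpoly_ring n)"
  shows "I \<subseteq> carrier (mpoly_ring n)" "0 \<in> I" "x \<in> I \<Longrightarrow> y \<in> I \<Longrightarrow> x + y \<in> I"
    "r \<in> carrier (mpoly_ring n) \<Longrightarrow> x \<in> I \<Longrightarrow> r * x \<in> I" "x \<in> I \<Longrightarrow> y \<in> I \<Longrightarrow> x - y \<in> I"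
proof -
  interpret ideal I "mpoly_ring n" by (rule assms)
  show "I \<subseteq> carrier (mpoly_ring n)" by (rule a_subset)
  show "0 \<in> I" using additive_subgroup.zero_closed[OF ideal.axioms(1)[OF assms]] by simp
  show add: "x + y \<in> I" if "x \<in> I" "y \<in> I" for x y
    using additive_subgroup.a_closed[OF ideal.axioms(1)[OF assms] that] by simp
  show mult: "r * x \<in> I" if "r \<in> carrier (mpoly_ring n)" "x \<in> I" for r x
    using ideal.I_l_closed[OF assms that(2,1)] by simp
  show "x - y \<in> I" if "x \<in> I" "y \<in> I"
    using add[OF that(1) mult[OF carrier_mpoly_ring_uminus[OF carrier_mpoly_ring_1] that(2)]] by simp
qed

lemma ideal_sum:
  assumes "ideal I (mpoly_ring n)" "\<And>a. a \<in> A \<Longrightarrow> f a \<in> I"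
  shows "(\<Sum>a\<in>A. f a) \<in> I"
  using assms(2)
  by (induction A rule: infinite_finite_induct) (auto simp: ideal_mpoly_ringD[OF assms(1)])

section \<open>Homogeneous components\<close>

definition component :: "nat \<Rightarrow> 'k::field mpoly \<Rightarrow> 'k mpoly" where
  "component l f = (\<Sum>t | t \<in> Poly_Mapping.keys f \<and> mon_degree t = l.
     Poly_Mapping.single t (Poly_Mapping.lookup f t))"

lemma lookup_component:
  "Poly_Mapping.lookup (component l f) t = (if mon_degree t = l then Poly_Mapping.lookup f t else 0)"
  by (auto simp: component_def lookup_sum lookup_single when_def in_keys_iff)

lemma component_add: "component l (f + g) = component l f + component l g"
  by (rule poly_mapping_eqI) (simp add: lookup_component lookup_add)

lemma component_0 [simp]: "component l 0 = 0"
  by (simp add: component_def)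

lemma component_sum: "component l (\<Sum>a\<in>A. f a) = (\<Sum>a\<in>A. component l (f a))"
  by (induction A rule: infinite_finite_induct) (simp_all add: component_add)

lemma component_in_forms: "f \<in> carrier (mpoly_ring n) \<Longrightarrow> component l f \<in> forms n l"
  by (auto simp: forms_def monomials_def carrier_mpoly_ring in_keys_iff lookup_component split: if_splits)

lemma component_form: "f \<in> forms n l \<Longrightarrow> component k f = (if k = l then f else 0)"
  by (rule poly_mapping_eqI)
    (auto simp: lookup_component forms_def monomials_def in_keys_iff subset_iff)

lemma sum_components: "(\<Sum>l\<in>mon_degree ` Poly_Mapping.keys f. component l f) = f"
proof (rule poly_mapping_eqI)
  fix t
  show "Poly_Mapping.lookup (\<Sum>l\<in>mon_degree ` Poly_Mapping.keys f. component l f) t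
      = Poly_Mapping.lookup f t"
    by (cases "t \<in> Poly_Mapping.keys f") (auto simp: lookup_sum lookup_component in_keys_iff)
qed

definition total :: "nat \<Rightarrow> (nat \<Rightarrow> 'k::field mpoly set) \<Rightarrow> 'k mpoly set" where
  "total n J = {f \<in> carrier (mpoly_ring n). \<forall>l. component l f \<in> J l}"

lemma subset_total:
  assumes J: "graded_ideal n J"
  shows "J l \<subseteq> total n J"
proof
  fix f assume f: "f \<in> J l"
  then have ff: "f \<in> forms n l" using graded_idealD(2)[OF J] by blast
  have "component k f \<in> J k" for k
    unfolding component_form[OF ff] using f mp.subspace_0[OF graded_idealD(1)[OF J]] by simp
  then show "f \<in> total n J" using ff forms_subset_carrier by (auto simp: total_def)
qed

lemma ideal_total:
  fixes J :: "nat \<Rightarrow> 'k::field mpoly set"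
  assumes J: "graded_ideal n J"
  shows "ideal (total n J) (mpoly_ring n)"
proof (rule ideal_mpoly_ringI)
  note sub = graded_idealD(1)[OF J]
  show "total n J \<subseteq> carrier (mpoly_ring n)" by (auto simp: total_def)
  show zero: "0 \<in> total n J" by (simp add: total_def carrier_mpoly_ring_0 mp.subspace_0[OF sub])
  show add: "x + y \<in> total n J" if "x \<in> total n J" "y \<in> total n J" for x y
    using that by (simp add: total_def carrier_mpoly_ring_add component_add mp.subspace_add[OF sub])
  have sum: "(\<Sum>a\<in>A. g a) \<in> total n J" if "\<And>a. a \<in> A \<Longrightarrow> g a \<in> total n J" for A :: "nat set" and g
    using that by (induction A rule: infinite_finite_induct) (auto simp: zero add)
  fix r x :: "'k mpoly" assume r: "r \<in> carrier (mpoly_ring n)" and x: "x \<in> total n J"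
  have "r * x = (\<Sum>a\<in>mon_degree ` Poly_Mapping.keys r. \<Sum>b\<in>mon_degree ` Poly_Mapping.keys x.
      component a r * component b x)"
    by (simp only: sum_product[symmetric] sum_components)
  also have "\<dots> \<in> total n J"
  proof (intro sum)
    fix a b
    have "component a r * component b x \<in> J (a + b)"
      using x by (intro graded_idealD(3)[OF J] component_in_forms[OF r]) (simp add: total_def)
    then show "component a r * component b x \<in> total n J" using subset_total[OF J] by blast
  qed
  finally show "r * x \<in> total n J" .
qed

definition pieces :: "nat \<Rightarrow> 'k::field mpoly set \<Rightarrow> nat \<Rightarrow> 'k mpoly set" where
  "pieces n I l = I \<inter> forms n l"

lemma graded_ideal_pieces:
  assumes I: "ideal I (mpoly_ring n)"
  shows "graded_ideal n (pieces n I)"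
  unfolding graded_ideal_def
proof (intro conjI allI ballI)
  show "mp.subspace (pieces n I l)" for l
    unfolding pieces_def
  proof (rule mp.subspaceI)
    show "scl c x \<in> I \<inter> forms n l" if "x \<in> I \<inter> forms n l" for c x
      using that ideal_mpoly_ringD(4)[OF I carrier_mpoly_ring_single_0]
        mp.subspace_scale[OF subspace_forms] by (auto simp: scl_def)
  qed (auto simp: ideal_mpoly_ringD[OF I] mp.subspace_add[OF subspace_forms])
  show "pieces n I l \<subseteq> forms n l" for l by (simp add: pieces_def)
  show "f * g \<in> pieces n I (k + l)" if "f \<in> forms n k" "g \<in> pieces n I l" for k l f g
    using that ideal_mpoly_ringD(4)[OF I, of f g] forms_subset_carrier mult_in_forms
    unfolding pieces_def by blast
qed

lemma poly_piece_int: "poly_piece n (int l) = forms n l"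
  by (auto simp: poly_piece_def forms_def monomials_def carrier_mpoly_ring)

lemma poly_piece_neg:
  assumes "l < 0"
  shows "poly_piece n l = {0}"
proof
  show "poly_piece n l \<subseteq> {0}"
  proof
    fix f assume f: "f \<in> poly_piece n l"
    have "Poly_Mapping.lookup f t = 0" for t
    proof (rule ccontr)
      assume "Poly_Mapping.lookup f t \<noteq> 0"
      then have "int (mon_degree t) = l" using f by (simp add: poly_piece_def in_keys_iff)
      then show False using assms by simp
    qed
    then have "f = 0" by (intro poly_mapping_eqI) simp
    then show "f \<in> {0}" by simp
  qed
  show "{0} \<subseteq> poly_piece n l" by (simp add: poly_piece_def carrier_mpoly_ring_0)
qed

text \<open>\<open>total n (pieces n I)\<close> is an ideal containing the homogeneous generators of
  \<open>I\<close>; conversely each of its elements is the sum of its components, which lie in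
  \<open>I\<close>.\<close>

lemma total_pieces:
  fixes I :: "'k::field mpoly set"
  assumes "homogeneous_ideal n I"
  shows "total n (pieces n I) = I"
proof -
  interpret cring "mpoly_ring n :: 'k mpoly ring" by (rule cring_mpoly_ring)
  have I: "ideal I (mpoly_ring n)" and gen: "I = Idl\<^bsub>mpoly_ring n\<^esub> {f \<in> I. \<exists>l. f \<in> poly_piece n l}"
    using assms unfolding homogeneous_ideal_def by blast+
  note J = graded_ideal_pieces[OF I]
  have "{f \<in> I. \<exists>l. f \<in> poly_piece n l} \<subseteq> total n (pieces n I)"
  proof safe
    fix f l assume f: "f \<in> I" "f \<in> poly_piece n l"
    show "f \<in> total n (pieces n I)"
    proof (cases "l < 0")
      case True
      then have "f = 0" using f poly_piece_neg by blast
      then show ?thesis using ideal_mpoly_ringD(2)[OF ideal_total[OF J]] by simp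
    next
      case False
      then have "f \<in> poly_piece n (int (nat l))" using f(2) by simp
      then have "f \<in> forms n (nat l)" by (simp only: poly_piece_int)
      then have "f \<in> pieces n I (nat l)" using f(1) by (simp add: pieces_def)
      then show ?thesis using subset_total[OF J] by blast
    qed
  qed
  then have "Idl\<^bsub>mpoly_ring n\<^esub> {f \<in> I. \<exists>l. f \<in> poly_piece n l} \<subseteq> total n (pieces n I)"
    by (rule genideal_minimal[OF ideal_total[OF J]])
  then have "I \<subseteq> total n (pieces n I)" using gen by simp
  moreover have "total n (pieces n I) \<subseteq> I"
  proof
    fix f assume f: "f \<in> total n (pieces n I)"
    have "(\<Sum>l\<in>mon_degree ` Poly_Mapping.keys f. component l f) \<in> I"
      by (rule ideal_sum[OF I]) (use f in \<open>auto simp: total_def pieces_def\<close>)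
    then show "f \<in> I" by (simp only: sum_components)
  qed
  ultimately show ?thesis by blast
qed

section \<open>Regular sequences in the coordinate ring\<close>

lemma coset_eq_iff:
  fixes I :: "'k::comm_ring_1 mpoly set"
  assumes I: "ideal I (mpoly_ring n)"
  shows "I +>\<^bsub>mpoly_ring n\<^esub> x = I +>\<^bsub>mpoly_ring n\<^esub> y \<longleftrightarrow> x - y \<in> I"
proof -
  have coset: "I +>\<^bsub>mpoly_ring n\<^esub> x = (\<lambda>i. i + x) ` I" for x
    unfolding a_r_coset_def' by auto
  note D = ideal_mpoly_ringD[OF I]
  show ?thesis
  proof
    assume eq: "I +>\<^bsub>mpoly_ring n\<^esub> x = I +>\<^bsub>mpoly_ring n\<^esub> y"
    have "0 + x \<in> (\<lambda>i. i + x) ` I" using D(2) by (rule imageI)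
    then obtain i where "x = i + y" "i \<in> I" using eq unfolding coset by auto
    then show "x - y \<in> I" by simp
  next
    assume xy: "x - y \<in> I"
    have yx: "y - x \<in> I" using D(5)[OF D(2) xy] by simp
    have "i + x \<in> (\<lambda>i. i + y) ` I" if "i \<in> I" for i
      using D(3)[OF that xy] by (intro image_eqI[of _ _ "i + (x - y)"]) simp_all
    moreover have "i + y \<in> (\<lambda>i. i + x) ` I" if "i \<in> I" for i
      using D(3)[OF that yx] by (intro image_eqI[of _ _ "i + (y - x)"]) simp_all
    ultimately show "I +>\<^bsub>mpoly_ring n\<^esub> x = I +>\<^bsub>mpoly_ring n\<^esub> y" unfolding coset by blast
  qed
qed

lemma coord_ring_simps:
  fixes I :: "'k::field mpoly set"
  assumes I: "ideal I (mpoly_ring n)"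
  shows "carrier (coord_ring n I) = (\<lambda>f. I +>\<^bsub>mpoly_ring n\<^esub> f) ` carrier (mpoly_ring n)"
    "\<zero>\<^bsub>coord_ring n I\<^esub> = I +>\<^bsub>mpoly_ring n\<^esub> 0" "\<one>\<^bsub>coord_ring n I\<^esub> = I +>\<^bsub>mpoly_ring n\<^esub> 1"
    "x \<in> carrier (mpoly_ring n) \<Longrightarrow> y \<in> carrier (mpoly_ring n) \<Longrightarrow>
      (I +>\<^bsub>mpoly_ring n\<^esub> x) \<oplus>\<^bsub>coord_ring n I\<^esub> (I +>\<^bsub>mpoly_ring n\<^esub> y) = I +>\<^bsub>mpoly_ring n\<^esub> (x + y)"
    "x \<in> carrier (mpoly_ring n) \<Longrightarrow> y \<in> carrier (mpoly_ring n) \<Longrightarrow>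
      (I +>\<^bsub>mpoly_ring n\<^esub> x) \<otimes>\<^bsub>coord_ring n I\<^esub> (I +>\<^bsub>mpoly_ring n\<^esub> y) = I +>\<^bsub>mpoly_ring n\<^esub> (x * y)"
proof -
  interpret ideal I "mpoly_ring n" by (rule I)
  show "carrier (coord_ring n I) = (\<lambda>f. I +>\<^bsub>mpoly_ring n\<^esub> f) ` carrier (mpoly_ring n)"
    by (auto simp: coord_ring_def FactRing_def A_RCOSETS_def')
  show "\<zero>\<^bsub>coord_ring n I\<^esub> = I +>\<^bsub>mpoly_ring n\<^esub> 0"
    by (simp add: coord_ring_def FactRing_def a_r_coset_def')
  show "\<one>\<^bsub>coord_ring n I\<^esub> = I +>\<^bsub>mpoly_ring n\<^esub> 1"
    by (simp add: coord_ring_def FactRing_def)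
  show "(I +>\<^bsub>mpoly_ring n\<^esub> x) \<oplus>\<^bsub>coord_ring n I\<^esub> (I +>\<^bsub>mpoly_ring n\<^esub> y) = I +>\<^bsub>mpoly_ring n\<^esub> (x + y)"
    if "x \<in> carrier (mpoly_ring n)" "y \<in> carrier (mpoly_ring n)"
    using a_rcos_sum[OF that] by (simp add: coord_ring_def FactRing_def)
  show "(I +>\<^bsub>mpoly_ring n\<^esub> x) \<otimes>\<^bsub>coord_ring n I\<^esub> (I +>\<^bsub>mpoly_ring n\<^esub> y) = I +>\<^bsub>mpoly_ring n\<^esub> (x * y)"
    if "x \<in> carrier (mpoly_ring n)" "y \<in> carrier (mpoly_ring n)"
    using rcoset_mult_add[OF that] by (simp add: coord_ring_def FactRing_def)
qed

lemma regular_nth: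
  "regular n J gs \<longleftrightarrow> (\<forall>i<length gs. 0 < fst (gs ! i) \<and>
     nonzerodivisor n (adjoin_list n (take i gs) J) (fst (gs ! i)) (snd (gs ! i)))"
  by (induction n J gs rule: regular.induct) (auto simp: All_less_Suc2)

lemma graded_ideal_adjoin_list':
  "graded_ideal n J \<Longrightarrow> \<forall>(e, f)\<in>set gs. f \<in> forms n e \<Longrightarrow> graded_ideal n (adjoin_list n gs J)"
  by (induction n gs J rule: adjoin_list.induct) (auto intro: graded_ideal_adjoin)

lemma adjoin_list_subset:
  assumes B: "ideal B (mpoly_ring n)"
  shows "(\<And>l. J l \<subseteq> B) \<Longrightarrow> \<forall>(e, f)\<in>set gs. f \<in> B \<Longrightarrow> adjoin_list n gs J l \<subseteq> B"
proof (induction gs arbitrary: J)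
  case (Cons a gs)
  obtain e f where a: "a = (e, f)" by (cases a)
  have "adjoin_ideal n e f J l \<subseteq> B" for l
  proof
    fix z assume "z \<in> adjoin_ideal n e f J l"
    then obtain x y where xy: "z = x + f * y" "x \<in> J l" "y \<in> lower_forms n e l"
      by (rule adjoin_idealE)
    have "y \<in> carrier (mpoly_ring n)" using xy(3) lower_forms_subset forms_subset_carrier by blast
    moreover have "f \<in> B" using Cons.prems(2) a by simp
    ultimately have "y * f \<in> B" by (rule ideal_mpoly_ringD(4)[OF B])
    moreover have "x \<in> B" using Cons.prems(1) xy(2) by blast
    ultimately show "z \<in> B" using ideal_mpoly_ringD(3)[OF B] xy(1) by (simp add: mult.commute)
  qed
  then show ?case using Cons.IH[of "adjoin_ideal n e f J"] Cons.prems(2) a by simp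
qed simp

lemma subset_adjoin_list: "J l \<subseteq> adjoin_list n gs J l"
proof (induction gs arbitrary: J)
  case (Cons a gs)
  obtain e f where a: "a = (e, f)" by (cases a)
  show ?case using Cons.IH[of "adjoin_ideal n e f J"] subset_adjoin_ideal[of J l n e f] a by simp
qed simp

lemma generator_in_adjoin_list:
  "(\<And>l. 0 \<in> J l) \<Longrightarrow> (e, f) \<in> set gs \<Longrightarrow> f \<in> adjoin_list n gs J e"
proof (induction gs arbitrary: J)
  case (Cons a gs)
  obtain e' f' where a: "a = (e', f')" by (cases a)
  show ?case
  proof (cases "(e, f) = a")
    case True
    have "0 + f * 1 \<in> adjoin_ideal n e f J e"
      using Cons.prems(1) by (intro adjoin_idealI) (simp_all add: lower_forms_def one_in_forms)
    then have "f \<in> adjoin_ideal n e f J e" by simp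
    then show ?thesis using subset_adjoin_list[of "adjoin_ideal n e f J" e n gs] True by auto
  next
    case False
    have "0 \<in> adjoin_ideal n e' f' J l" for l using Cons.prems(1) subset_adjoin_ideal by blast
    then show ?thesis using Cons.IH[of "adjoin_ideal n e' f' J"] Cons.prems(2) False a by auto
  qed
qed simp

text \<open>Identifies the dimension quantified inside \<open>ACM\<close>, which fixes the length of
  the regular sequence, with the given one.\<close>

lemma chain_dimension_unique:
  assumes "chain_dimension S m" "chain_dimension S m'"
  shows "m = m'"
proof -
  have le: "a \<le> b" if "chain_dimension S a" "chain_dimension S b" for a b
    using that unfolding chain_dimension_def by fastforce
  show ?thesis using le[OF assms] le[OF assms(2,1)] by simp
qed

text \<open>A member of degree at most 0 would be 0 or a unit. A unit generates the whole ring, and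
  regularity of 0 would put 1 into the ideal of its predecessors; both contradict
  properness.\<close>

lemma regular_sequence_positive_degree:
  fixes I :: "'k::field mpoly set"
  assumes I: "ideal I (mpoly_ring n)" and reg: "regular_sequence (coord_ring n I) fs"
    and i: "i < length fs" and piece: "fs ! i \<in> coord_piece n I l"
  shows "\<exists>e F. 0 < e \<and> F \<in> forms n e \<and> fs ! i = I +>\<^bsub>mpoly_ring n\<^esub> F"
proof -
  let ?A = "coord_ring n I" and ?q = "\<lambda>f. I +>\<^bsub>mpoly_ring n\<^esub> f"
  interpret A: cring ?A
    unfolding coord_ring_def by (rule ideal.quotient_is_cring[OF I cring_mpoly_ring])
  note A_simps = coord_ring_simps[OF I]
  have sub: "set fs \<subseteq> carrier ?A" and proper: "Idl\<^bsub>?A\<^esub> (set fs) \<noteq> carrier ?A"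
    and inj: "\<And>x. x \<in> carrier ?A \<Longrightarrow> fs ! i \<otimes>\<^bsub>?A\<^esub> x \<in> Idl\<^bsub>?A\<^esub> (set (take i fs)) \<Longrightarrow>
      x \<in> Idl\<^bsub>?A\<^esub> (set (take i fs))"
    using reg i unfolding regular_sequence_def by blast+
  note ideal_fs = A.genideal_ideal[OF sub]
  have one: "\<one>\<^bsub>?A\<^esub> \<notin> Idl\<^bsub>?A\<^esub> (set fs)"
    using ideal.one_imp_carrier[OF ideal_fs] proper by blast
  have take_sub: "set (take i fs) \<subseteq> set fs" by (rule set_take_subset)
  have nonzero: "fs ! i \<noteq> \<zero>\<^bsub>?A\<^esub>"
  proof
    assume "fs ! i = \<zero>\<^bsub>?A\<^esub>"
    moreover have t: "ideal (Idl\<^bsub>?A\<^esub> (set (take i fs))) ?A"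
      using take_sub sub by (intro A.genideal_ideal) blast
    ultimately have "fs ! i \<otimes>\<^bsub>?A\<^esub> \<one>\<^bsub>?A\<^esub> \<in> Idl\<^bsub>?A\<^esub> (set (take i fs))"
      using additive_subgroup.zero_closed[OF ideal.axioms(1)[OF t]] by simp
    with A.one_closed have "\<one>\<^bsub>?A\<^esub> \<in> Idl\<^bsub>?A\<^esub> (set (take i fs))" by (rule inj)
    moreover have "Idl\<^bsub>?A\<^esub> (set (take i fs)) \<subseteq> Idl\<^bsub>?A\<^esub> (set fs)"
      using take_sub A.genideal_self[OF sub] by (intro A.genideal_minimal[OF ideal_fs]) blast
    ultimately show False using one by blast
  qed
  obtain F where F: "F \<in> poly_piece n l" "fs ! i = ?q F"
    using piece unfolding coord_piece_def by blast
  have "0 < l"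
  proof (rule ccontr)
    assume "\<not> 0 < l"
    then consider "l < 0" | "l = 0" by linarith
    then show False
    proof cases
      case 1
      then have "F = 0" using F(1) poly_piece_neg by blast
      then show False using nonzero F(2) A_simps(2) by simp
    next
      case 2
      then have "F \<in> poly_piece n (int 0)" using F(1) by simp
      then have "F \<in> forms n 0" by (simp only: poly_piece_int)
      then obtain c where c: "F = Poly_Mapping.single 0 c" using forms_0 by blast
      have "c \<noteq> 0" using nonzero F(2) A_simps(2) c by auto
      let ?d = "Poly_Mapping.single 0 (inverse c) :: 'k mpoly"
      have "?q ?d \<otimes>\<^bsub>?A\<^esub> fs ! i = ?q (?d * F)"
        unfolding F(2) by (rule A_simps(5)) (simp_all add: c carrier_mpoly_ring_single_0)
      also have "?d * F = 1" using \<open>c \<noteq> 0\<close> by (simp add: c mult_single)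
      finally have "?q ?d \<otimes>\<^bsub>?A\<^esub> fs ! i = \<one>\<^bsub>?A\<^esub>" by (simp add: A_simps(3))
      moreover have "?q ?d \<in> carrier ?A" unfolding A_simps(1) by (intro imageI carrier_mpoly_ring_single_0)
      moreover have "fs ! i \<in> Idl\<^bsub>?A\<^esub> (set fs)" using A.genideal_self[OF sub] i nth_mem by blast
      ultimately have "?q ?d \<otimes>\<^bsub>?A\<^esub> fs ! i \<in> Idl\<^bsub>?A\<^esub> (set fs)"
        by (intro ideal.I_l_closed[OF ideal_fs])
      with \<open>?q ?d \<otimes>\<^bsub>?A\<^esub> fs ! i = \<one>\<^bsub>?A\<^esub>\<close> one show False by simp
    qed
  qed
  then have "F \<in> poly_piece n (int (nat l))" using F(1) by simp
  then have "F \<in> forms n (nat l)" by (simp only: poly_piece_int)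
  then show ?thesis using \<open>0 < l\<close> F(2) by (intro exI[of _ "nat l"] exI[of _ F]) simp
qed

text \<open>The members are lifted to forms of positive degree. Ideals generated in the coordinate
  ring then have to be compared with \<open>adjoin_list\<close>, in both directions.\<close>

lemma ACM_regular:
  fixes I :: "'k::field mpoly set"
  assumes acm: "ACM n I" and dim: "has_dimension n I m"
  shows "\<exists>gs. length gs = m + 1 \<and> regular n (pieces n I) gs" "1 \<notin> I"
proof -
  obtain m' fs where m': "has_dimension n I m'" "length fs = m' + 1"
    and piece: "\<And>f. f \<in> set fs \<Longrightarrow> \<exists>l. f \<in> coord_piece n I l"
    and reg: "regular_sequence (coord_ring n I) fs" and hom: "homogeneous_ideal n I"
    using acm unfolding ACM_def subscheme_def by blast
  have len: "length fs = m + 1"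
    using m' dim chain_dimension_unique[of _ m m'] unfolding has_dimension_def by blast
  have I: "ideal I (mpoly_ring n)" using hom unfolding homogeneous_ideal_def by blast
  let ?A = "coord_ring n I" and ?q = "\<lambda>f. I +>\<^bsub>mpoly_ring n\<^esub> f"
  interpret P: cring "mpoly_ring n :: 'k mpoly ring" by (rule cring_mpoly_ring)
  interpret A: cring ?A
    unfolding coord_ring_def by (rule ideal.quotient_is_cring[OF I cring_mpoly_ring])
  note A_simps = coord_ring_simps[OF I]
  have sub: "set fs \<subseteq> carrier ?A" using reg unfolding regular_sequence_def by blast
  show "1 \<notin> I"
  proof
    assume "1 \<in> I"
    then have "\<one>\<^bsub>?A\<^esub> = \<zero>\<^bsub>?A\<^esub>" using coset_eq_iff[OF I, of 1 0] by (simp add: A_simps)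
    then have "\<one>\<^bsub>?A\<^esub> \<in> Idl\<^bsub>?A\<^esub> (set fs)"
      using additive_subgroup.zero_closed[OF ideal.axioms(1)[OF A.genideal_ideal[OF sub]]] by simp
    then show False
      using ideal.one_imp_carrier[OF A.genideal_ideal[OF sub]] reg unfolding regular_sequence_def by blast
  qed
  have "\<forall>i\<in>{..<length fs}. \<exists>p. 0 < fst p \<and> snd p \<in> forms n (fst p) \<and> fs ! i = ?q (snd p)"
  proof
    fix i assume i: "i \<in> {..<length fs}"
    then obtain l where "fs ! i \<in> coord_piece n I l" using piece nth_mem by blast
    with regular_sequence_positive_degree[OF I reg] i obtain e F
      where "0 < e" "F \<in> forms n e" "fs ! i = ?q F" by blast
    then show "\<exists>p. 0 < fst p \<and> snd p \<in> forms n (fst p) \<and> fs ! i = ?q (snd p)"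
      by (intro exI[of _ "(e, F)"]) simp
  qed
  from bchoice[OF this] obtain p where
    p: "\<And>i. i < length fs \<Longrightarrow> 0 < fst (p i) \<and> snd (p i) \<in> forms n (fst (p i)) \<and> fs ! i = ?q (snd (p i))"
    by blast
  define gs where "gs = map p [0..<length fs]"
  have take_gs: "set (take i gs) = p ` {..<i}" if "i < length fs" for i
    using that by (auto simp: gs_def take_map take_upt)
  have take_fs: "set (take i fs) = (\<lambda>j. ?q (snd (p j))) ` {..<i}" if "i < length fs" for i
  proof -
    have "set (take i fs) = (\<lambda>j. fs ! j) ` {..<i}"
      using nth_image[of i fs] that by (simp add: atLeast0LessThan)
    also have "\<dots> = (\<lambda>j. ?q (snd (p j))) ` {..<i}"
      using that p by (intro image_cong) auto
    finally show ?thesis .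
  qed
  let ?J = "pieces n I"
  have J: "graded_ideal n ?J" by (rule graded_ideal_pieces[OF I])
  have nzd: "nonzerodivisor n (adjoin_list n (take i gs) ?J) (fst (p i)) (snd (p i))"
    if i: "i < length fs" for i
    unfolding nonzerodivisor_def
  proof (intro conjI allI ballI impI)
    let ?Ji = "adjoin_list n (take i gs) ?J" and ?a = "Idl\<^bsub>?A\<^esub> (set (take i fs))"
    show Fi: "snd (p i) \<in> forms n (fst (p i))" using p[OF i] by blast
    have gens: "\<forall>(e, f)\<in>set (take i gs). f \<in> forms n e"
      using p i unfolding take_gs[OF i] case_prod_beta by auto
    have Ji: "graded_ideal n ?Ji" by (rule graded_ideal_adjoin_list'[OF J gens])
    have take_sub: "set (take i fs) \<subseteq> carrier ?A" using sub set_take_subset by fast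
    have a: "ideal ?a ?A" by (rule A.genideal_ideal[OF take_sub])
    fix l x assume x: "x \<in> forms n l" and Fx: "snd (p i) * x \<in> ?Ji (fst (p i) + l)"
    have xc: "x \<in> carrier (mpoly_ring n)" and Fc: "snd (p i) \<in> carrier (mpoly_ring n)"
      using x Fi forms_subset_carrier by blast+
    \<comment> \<open>The preimage of the ideal generated by the earlier members. It contains
      \<open>?Ji\<close>, so a relation modulo \<open>?Ji\<close> becomes one in the coordinate
      ring.\<close>
    define B where "B = {r \<in> carrier (mpoly_ring n). ?q r \<in> ?a}"
    have B: "ideal B (mpoly_ring n)"
      unfolding B_def
      by (rule ring_hom_ring.ideal_vimage[OF ideal.rcos_ring_hom_ring[OF I]])
        (use a in \<open>simp add: coord_ring_def\<close>)
    have "?Ji (fst (p i) + l) \<subseteq> B"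
    proof (rule adjoin_list_subset[OF B])
      fix l
      show "?J l \<subseteq> B"
      proof
        fix y assume y: "y \<in> ?J l"
        then have "y \<in> carrier (mpoly_ring n)" "?q y = \<zero>\<^bsub>?A\<^esub>"
          using forms_subset_carrier coset_eq_iff[OF I, of y 0] by (auto simp: pieces_def A_simps)
        then show "y \<in> B"
          using additive_subgroup.zero_closed[OF ideal.axioms(1)[OF a]] by (simp add: B_def)
      qed
    next
      have "snd (p j) \<in> B" if j: "j < i" for j
      proof -
        have "?q (snd (p j)) \<in> ?a"
          using A.genideal_self[OF take_sub] j unfolding take_fs[OF i] by blast
        moreover have "snd (p j) \<in> carrier (mpoly_ring n)"
          using p[of j] i j forms_subset_carrier by fastforce
        ultimately show ?thesis by (simp add: B_def)
      qed
      then show "\<forall>(e, f)\<in>set (take i gs). f \<in> B"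
        unfolding take_gs[OF i] by (auto simp: case_prod_beta)
    qed
    then have "?q (snd (p i) * x) \<in> ?a" using Fx by (auto simp: B_def)
    then have "fs ! i \<otimes>\<^bsub>?A\<^esub> ?q x \<in> ?a" using A_simps(5)[OF Fc xc] p[OF i] by simp
    moreover have "?q x \<in> carrier ?A" unfolding A_simps(1) using xc by (rule imageI)
    ultimately have xa: "?q x \<in> ?a" using reg i unfolding regular_sequence_def by blast
    \<comment> \<open>The converse comparison: a class in \<open>?a\<close> has a representative in
      \<open>total n ?Ji\<close>. It may differ from \<open>x\<close> by an element of
      \<open>I\<close>, which also lies there.\<close>
    have "?a \<subseteq> ?q ` total n ?Ji"
    proof (rule A.genideal_minimal)
      show "ideal (?q ` total n ?Ji) ?A"
        unfolding coord_ring_def by (rule P.ring_ideal_imp_quot_ideal[OF I ideal_total[OF Ji]])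
      have "snd (p j) \<in> total n ?Ji" if j: "j < i" for j
      proof -
        have "(fst (p j), snd (p j)) \<in> set (take i gs)" using j unfolding take_gs[OF i] by simp
        then have "snd (p j) \<in> ?Ji (fst (p j))"
          using mp.subspace_0[OF graded_idealD(1)[OF J]] by (intro generator_in_adjoin_list)
        then show ?thesis using subset_total[OF Ji] by blast
      qed
      then show "set (take i fs) \<subseteq> ?q ` total n ?Ji" unfolding take_fs[OF i] by blast
    qed
    then obtain y where y: "y \<in> total n ?Ji" "?q x = ?q y" using xa by blast
    have "x - y \<in> total n ?J" using coset_eq_iff[OF I] y(2) total_pieces[OF hom] by blast
    then have "x - y \<in> total n ?Ji" using subset_adjoin_list unfolding total_def by blast
    then have "(x - y) + y \<in> total n ?Ji" using y(1) by (rule ideal_mpoly_ringD(3)[OF ideal_total[OF Ji]])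
    then have "component l x \<in> ?Ji l" by (simp add: total_def)
    then show "x \<in> ?Ji l" by (simp add: component_form[OF x])
  qed
  have "regular n ?J gs"
    unfolding regular_nth using nzd p by (simp add: gs_def)
  moreover have "length gs = m + 1" by (simp add: gs_def len)
  ultimately show "\<exists>gs. length gs = m + 1 \<and> regular n ?J gs" by blast
qed

lemma codim_pieces_0_pos:
  fixes I :: "'k::field mpoly set"
  assumes I: "ideal I (mpoly_ring n)" and "1 \<notin> I"
  shows "0 < codim n 0 (pieces n I 0)"
proof -
  have "pieces n I 0 = {0}"
  proof
    show "pieces n I 0 \<subseteq> {0}"
    proof
      fix f assume f: "f \<in> pieces n I 0"
      then obtain c where c: "f = Poly_Mapping.single 0 c" using forms_0 by (auto simp: pieces_def)
      have "c = 0"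
      proof (rule ccontr)
        assume "c \<noteq> 0"
        then have "1 = Poly_Mapping.single 0 (inverse c) * f" by (simp add: c mult_single)
        also have "\<dots> \<in> I"
          using f by (intro ideal_mpoly_ringD(4)[OF I carrier_mpoly_ring_single_0]) (simp add: pieces_def)
        finally show False using assms(2) by blast
      qed
      then show "f \<in> {0}" by (simp add: c)
    qed
    show "{0} \<subseteq> pieces n I 0" using ideal_mpoly_ringD(2)[OF I] by (simp add: pieces_def)
  qed
  then show ?thesis by (simp add: codim_zero)
qed

section \<open>Characteristic sequences and Hilbert functions\<close>

lemma form_ring_simps [simp]:
  "x \<otimes>\<^bsub>form_ring n m Y\<^esub> y = x * y" "x \<oplus>\<^bsub>form_ring n m Y\<^esub> y = x + y"
  "\<zero>\<^bsub>form_ring n m Y\<^esub> = 0"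
  by (simp_all add: form_ring_def mpoly_ring_def)

lemma subst_in_carrier:
  assumes "\<forall>i\<le>m. Y i \<in> forms n 1" "f \<in> carrier (mpoly_ring m)"
  shows "subst_forms Y f \<in> carrier (mpoly_ring n)"
proof -
  have "subst_forms Y f = (\<Sum>l\<in>mon_degree ` Poly_Mapping.keys f. subst_forms Y (component l f))"
    by (simp only: subst_forms_sum[symmetric] sum_components)
  also have "\<dots> \<in> carrier (mpoly_ring n)"
  proof (rule carrier_mpoly_ring_sum)
    fix l
    have "subst_forms Y (component l f) \<in> forms n l"
      by (rule subst_in_forms[OF assms(1) component_in_forms[OF assms(2)]])
    then show "subst_forms Y (component l f) \<in> carrier (mpoly_ring n)"
      using forms_subset_carrier by blast
  qed
  finally show ?thesis .
qed

lemma subst_forms_const: "subst_forms Y (Poly_Mapping.single 0 c) = Poly_Mapping.single 0 c"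
  by (simp add: subst_forms_single scl_def)

lemma subst_forms_var: "subst_forms Y (var i) = Y i"
  using subst_monomial_single[of Y i] by (simp add: var_def subst_forms_single)

lemma carrier_form_ring:
  fixes Y :: "nat \<Rightarrow> 'k::field mpoly"
  assumes Y: "\<forall>i\<le>m. Y i \<in> forms n 1"
  shows "carrier (form_ring n m Y) = subst_forms Y ` carrier (mpoly_ring m)"
proof -
  let ?G = "generate_ring (mpoly_ring n) (constants \<union> Y ` {..m})"
  have "f \<in> subst_forms Y ` carrier (mpoly_ring m)" if "f \<in> ?G" for f
    using that
  proof (induction rule: generate_ring.induct)
    case one
    have "subst_forms Y 1 = 1" using subst_forms_const[of Y 1] by simp
    then show ?case
      using carrier_mpoly_ring_1 by (intro image_eqI[of _ _ 1]) simp_all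
  next
    case (incl h)
    then have "(\<exists>c. h = Poly_Mapping.single 0 c) \<or> (\<exists>i\<le>m. h = Y i)"
      unfolding constants_def by blast
    moreover have "Poly_Mapping.single 0 c \<in> subst_forms Y ` carrier (mpoly_ring m)" for c
      by (rule image_eqI[where f = "subst_forms Y", OF subst_forms_const[symmetric] carrier_mpoly_ring_single_0])
    moreover have "Y i \<in> subst_forms Y ` carrier (mpoly_ring m)" if "i \<le> m" for i
      by (rule image_eqI[where f = "subst_forms Y", OF subst_forms_var[symmetric]
            subsetD[OF forms_subset_carrier var_in_forms[OF that]]])
    ultimately show ?case by metis
  next
    case (a_inv h)
    then obtain f where f: "h = subst_forms Y f" "f \<in> carrier (mpoly_ring m)" by blast
    have "\<ominus>\<^bsub>mpoly_ring n\<^esub> h = - h"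
      using subst_in_carrier[OF Y f(2)] f(1) by (intro a_inv_mpoly_ring) simp
    also have "\<dots> = subst_forms Y (- f)"
      using subst_forms_add[of Y f "- f"] f(1) by (intro minus_unique) simp
    finally show ?case using carrier_mpoly_ring_uminus[OF f(2)] by blast
  next
    case (eng_add h1 h2)
    then obtain f g where fg: "h1 = subst_forms Y f" "f \<in> carrier (mpoly_ring m)"
      "h2 = subst_forms Y g" "g \<in> carrier (mpoly_ring m)" by blast
    show ?case
      unfolding fg(1,3) mpoly_ring_simps
      by (rule image_eqI[where f = "subst_forms Y", OF subst_forms_add[symmetric] carrier_mpoly_ring_add[OF fg(2,4)]])
  next
    case (eng_mult h1 h2)
    then obtain f g where fg: "h1 = subst_forms Y f" "f \<in> carrier (mpoly_ring m)"
      "h2 = subst_forms Y g" "g \<in> carrier (mpoly_ring m)" by blast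
    show ?case
      unfolding fg(1,3) mpoly_ring_simps
      by (rule image_eqI[where f = "subst_forms Y", OF subst_forms_mult[symmetric] carrier_mpoly_ring_mult[OF fg(2,4)]])
  qed
  moreover have "subst_forms Y f \<in> ?G" if f: "f \<in> carrier (mpoly_ring m)" for f
  proof -
    have const: "Poly_Mapping.single 0 c \<in> ?G" for c
      by (rule generate_ring.incl) (auto simp: constants_def)
    have zero: "0 \<in> ?G" using const[of 0] by simp
    have one: "1 \<in> ?G" using const[of 1] by simp
    have mult: "a * b \<in> ?G" if "a \<in> ?G" "b \<in> ?G" for a b
      using generate_ring.eng_mult[OF that] by simp
    have add: "a + b \<in> ?G" if "a \<in> ?G" "b \<in> ?G" for a b
      using generate_ring.eng_add[OF that] by simp
    have pow: "a ^ j \<in> ?G" if "a \<in> ?G" for a j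
      using that by (induction j) (auto simp: one mult)
    have prod: "(\<Prod>i\<in>A. g i) \<in> ?G" if "\<And>i. i \<in> A \<Longrightarrow> g i \<in> ?G" for A :: "nat set" and g
      using that by (induction A rule: infinite_finite_induct) (auto simp: one mult)
    have sum: "(\<Sum>t\<in>A. g t) \<in> ?G" if "\<And>t. t \<in> A \<Longrightarrow> g t \<in> ?G"
      for A :: "(nat \<Rightarrow>\<^sub>0 nat) set" and g
      using that by (induction A rule: infinite_finite_induct) (auto simp: zero add)
    have "scl (Poly_Mapping.lookup f t) (subst_monomial Y t) \<in> ?G" if t: "t \<in> Poly_Mapping.keys f" for t
      unfolding scl_def subst_monomial_def
    proof (intro mult const prod pow)
      fix i assume "i \<in> Poly_Mapping.keys t"
      then have "i \<in> {0..m}" using f t unfolding carrier_mpoly_ring by blast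
      then have "i \<le> m" by simp
      then show "Y i \<in> ?G" by (intro generate_ring.incl) blast
    qed
    then show ?thesis unfolding subst_forms_def by (rule sum)
  qed
  ultimately show ?thesis by (auto simp: form_ring_def)
qed

lemma form_piece_int:
  fixes Y :: "nat \<Rightarrow> 'k::field mpoly"
  assumes Y: "\<forall>i\<le>m. Y i \<in> forms n 1"
  shows "form_piece n m Y (int l) = subst_forms Y ` forms m l"
proof
  show "form_piece n m Y (int l) \<subseteq> subst_forms Y ` forms m l"
  proof
    fix f assume "f \<in> form_piece n m Y (int l)"
    then have f: "f \<in> forms n l" and "f \<in> subst_forms Y ` carrier (mpoly_ring m)"
      by (simp_all add: form_piece_def carrier_form_ring[OF Y] poly_piece_int)
    then obtain g where g: "f = subst_forms Y g" "g \<in> carrier (mpoly_ring m)" by blast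
    let ?L = "mon_degree ` Poly_Mapping.keys g"
    \<comment> \<open>The preimage \<open>g\<close> need not be homogeneous; substitution preserves
      degrees, so its component of degree \<open>l\<close> already maps to \<open>f\<close>.\<close>
    have "f = (\<Sum>a\<in>?L. subst_forms Y (component a g))"
      unfolding g(1) by (simp only: subst_forms_sum[symmetric] sum_components)
    then have "component l f = (\<Sum>a\<in>?L. component l (subst_forms Y (component a g)))"
      by (simp only: component_sum)
    then have "f = (\<Sum>a\<in>?L. component l (subst_forms Y (component a g)))"
      by (simp only: component_form[OF f] refl if_True)
    also have "\<dots> = (\<Sum>a\<in>?L. if l = a then subst_forms Y (component a g) else 0)"
      by (intro sum.cong refl)
        (rule component_form[OF subst_in_forms[OF Y component_in_forms[OF g(2)]]])
    also have "\<dots> = (if l \<in> ?L then subst_forms Y (component l g) else 0)"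
      by (simp only: sum.delta' finite_imageI finite_keys)
    finally have "f = subst_forms Y (component l g) \<or> f = subst_forms Y 0" by (simp split: if_splits)
    then show "f \<in> subst_forms Y ` forms m l"
      using component_in_forms[OF g(2), of l] zero_in_forms[of m l] by blast
  qed
  show "subst_forms Y ` forms m l \<subseteq> form_piece n m Y (int l)"
  proof (rule image_subsetI)
    fix f :: "'k mpoly" assume f: "f \<in> forms m l"
    have "f \<in> carrier (mpoly_ring m)" using f forms_subset_carrier by blast
    then show "subst_forms Y f \<in> form_piece n m Y (int l)"
      using subst_in_forms[OF Y f] by (simp add: form_piece_def carrier_form_ring[OF Y] poly_piece_int)
  qed
qed

lemma form_piece_neg:
  fixes Y :: "nat \<Rightarrow> 'k::field mpoly"
  assumes Y: "\<forall>i\<le>m. Y i \<in> forms n 1" and "l < 0"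
  shows "form_piece n m Y l = {0}"
proof -
  have "subst_forms Y 0 \<in> subst_forms Y ` carrier (mpoly_ring m)"
    using carrier_mpoly_ring_0 by (rule imageI)
  then show ?thesis
    by (auto simp: form_piece_def carrier_form_ring[OF Y] poly_piece_neg[OF assms(2)])
qed

lemma shift_form_piece:
  fixes Y :: "nat \<Rightarrow> 'k::field mpoly"
  assumes Y: "\<forall>i\<le>m. Y i \<in> forms n 1"
  shows "shift (form_piece n m Y) (- int a) (int l)
    = (if a \<le> l then subst_forms Y ` forms m (l - a) else {0})"
proof (cases "a \<le> l")
  case True
  then have "- int a + int l = int (l - a)" by simp
  then show ?thesis using True by (simp only: shift_def form_piece_int[OF Y] if_True)
next
  case False
  then have "- int a + int l < 0" by simp
  then show ?thesis using False form_piece_neg[OF Y] by (simp add: shift_def)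
qed

text \<open>The coordinates of a class in \<open>J/I\<close> with respect to a homogeneous basis, as functions of
  a representing polynomial.\<close>

lemma free_coordinates:
  fixes Y :: "nat \<Rightarrow> 'k::field mpoly"
  assumes I: "ideal I (mpoly_ring n)" and J: "ideal J (mpoly_ring n)"
    and Y: "\<forall>i\<le>m. Y i \<in> forms n 1"
    and iso: "graded_isomorphic (form_ring n m Y) (quotient_module n I J) (quotient_piece n I J)
      (free_module (form_ring n m Y) d) (free_piece (form_piece n m Y) d a)"
    and IJ: "I \<subseteq> J"
  obtains \<psi> where
    "\<forall>x\<in>J. \<forall>y\<in>J. \<forall>i<d. \<psi> (x + y) i = \<psi> x i + \<psi> y i"
    "\<forall>r\<in>carrier (form_ring n m Y). \<forall>x\<in>J. \<forall>i<d. \<psi> (r * x) i = r * \<psi> x i"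
    "\<forall>x\<in>J. (\<forall>i<d. \<psi> x i = 0) \<longleftrightarrow> x \<in> I"
    "\<forall>l. \<psi> ` pieces n J l = (\<Pi>\<^sub>E i\<in>{..<d}. shift (form_piece n m Y) (- int (a i)) (int l))"
proof -
  let ?R = "form_ring n m Y" and ?M = "quotient_module n I J" and ?N = "free_module (form_ring n m Y) d"
  let ?q = "\<lambda>f. I +>\<^bsub>mpoly_ring n\<^esub> f"
  obtain h where h: "h \<in> iso (add_monoid ?M) (add_monoid ?N)"
    and smult: "\<And>r x. r \<in> carrier ?R \<Longrightarrow> x \<in> carrier ?M \<Longrightarrow> h (r \<odot>\<^bsub>?M\<^esub> x) = r \<odot>\<^bsub>?N\<^esub> h x"
    and piece: "\<And>l. h ` quotient_piece n I J l = free_piece (form_piece n m Y) d a l"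
    using iso unfolding graded_isomorphic_def by blast
  have h_hom: "h \<in> hom (add_monoid ?M) (add_monoid ?N)" and h_inj: "inj_on h (carrier ?M)"
    and h_img: "h ` carrier ?M = carrier ?N"
    using h unfolding iso_iff by simp_all
  have M: "carrier ?M = ?q ` J" by (simp add: quotient_module_def)
  have Jc: "x \<in> carrier (mpoly_ring n)" if "x \<in> J" for x using that ideal_mpoly_ringD(1)[OF J] by blast
  have Rc: "r \<in> carrier (mpoly_ring n)" if r: "r \<in> carrier ?R" for r
  proof -
    have "r \<in> subst_forms Y ` carrier (mpoly_ring m)"
      using r by (simp only: carrier_form_ring[OF Y])
    then show ?thesis using subst_in_carrier[OF Y] by blast
  qed
  define \<psi> where "\<psi> x = h (?q x)" for x
  have add: "\<psi> (x + y) i = \<psi> x i + \<psi> y i" if "x \<in> J" "y \<in> J" "i < d" for x y i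
  proof -
    have "?q x \<oplus>\<^bsub>?M\<^esub> ?q y = ?q (x + y)"
      using coord_ring_simps(4)[OF I Jc[OF that(1)] Jc[OF that(2)]] by (simp add: quotient_module_def)
    moreover have "h (?q x \<oplus>\<^bsub>?M\<^esub> ?q y) = h (?q x) \<oplus>\<^bsub>?N\<^esub> h (?q y)"
      using hom_mult[OF h_hom, of "?q x" "?q y"] that M by simp
    ultimately show ?thesis using that(3) by (simp add: \<psi>_def free_module_def)
  qed
  have mult: "\<psi> (r * x) i = r * \<psi> x i" if "r \<in> carrier ?R" "x \<in> J" "i < d" for r x i
  proof -
    have "r \<odot>\<^bsub>?M\<^esub> ?q x = ?q (r * x)"
      using coord_ring_simps(5)[OF I Rc[OF that(1)] Jc[OF that(2)]] by (simp add: quotient_module_def)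
    moreover have "h (r \<odot>\<^bsub>?M\<^esub> ?q x) = r \<odot>\<^bsub>?N\<^esub> h (?q x)"
      using that M by (intro smult) auto
    ultimately show ?thesis using that(3) by (simp add: \<psi>_def free_module_def)
  qed
  have J0: "0 \<in> J" by (rule ideal_mpoly_ringD(2)[OF J])
  have zero: "\<psi> 0 i = 0" if "i < d" for i
  proof -
    have "\<psi> 0 i = \<psi> 0 i + \<psi> 0 i" using add[OF J0 J0 that] unfolding add_0_left .
    then have "\<psi> 0 i + 0 = \<psi> 0 i + \<psi> 0 i" unfolding add_0_right .
    from add_left_imp_eq[OF this] show ?thesis by (rule sym)
  qed
  have ker: "(\<forall>i<d. \<psi> x i = 0) \<longleftrightarrow> x \<in> I" if x: "x \<in> J" for x
  proof
    assume "x \<in> I"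
    then have "?q x = ?q 0" using coset_eq_iff[OF I, of x 0] by simp
    then have "\<psi> x = \<psi> 0" by (simp add: \<psi>_def)
    then show "\<forall>i<d. \<psi> x i = 0" using zero by simp
  next
    assume x0: "\<forall>i<d. \<psi> x i = 0"
    have N: "carrier ?N = {..<d} \<rightarrow>\<^sub>E carrier ?R" by (simp add: free_module_def)
    have "\<psi> x \<in> carrier ?N" "\<psi> 0 \<in> carrier ?N"
      using h_img x J0 M unfolding \<psi>_def by blast+
    then have "\<psi> x = \<psi> 0"
      unfolding N using x0 zero by (intro PiE_ext) auto
    moreover have "?q x \<in> carrier ?M" "?q 0 \<in> carrier ?M" using x J0 M by blast+
    ultimately have "?q x = ?q 0" using h_inj unfolding \<psi>_def by (simp only: inj_on_eq_iff)
    then show "x \<in> I" using coset_eq_iff[OF I, of x 0] by simp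
  qed
  have img: "\<psi> ` pieces n J l = (\<Pi>\<^sub>E i\<in>{..<d}. shift (form_piece n m Y) (- int (a i)) (int l))" for l
  proof -
    have "quotient_piece n I J (int l) = ?q ` pieces n J l"
    proof
      show "quotient_piece n I J (int l) \<subseteq> ?q ` pieces n J l"
      proof
        fix z assume "z \<in> quotient_piece n I J (int l)"
        then obtain x f where xf: "x \<in> J" "z = ?q x" "f \<in> forms n l" "z = ?q f"
          unfolding quotient_piece_def M coord_piece_def poly_piece_int by blast
        \<comment> \<open>A class of J/I that is homogeneous in A/I has a homogeneous representative
          \<open>f\<close>, and \<open>f\<close> lies in J because I does.\<close>
        have "f - x \<in> I" using coset_eq_iff[OF I] xf(2,4) by blast
        then have "(f - x) + x \<in> J" using IJ xf(1) by (intro ideal_mpoly_ringD(3)[OF J]) blast+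
        then have "f \<in> pieces n J l" using xf(3) by (simp add: pieces_def)
        then show "z \<in> ?q ` pieces n J l" using xf(4) by blast
      qed
      show "?q ` pieces n J l \<subseteq> quotient_piece n I J (int l)"
        unfolding quotient_piece_def M coord_piece_def poly_piece_int pieces_def by blast
    qed
    then have "\<psi> ` pieces n J l = h ` quotient_piece n I J (int l)" by (simp add: \<psi>_def image_image)
    then show ?thesis by (simp only: piece free_piece_def)
  qed
  show thesis
  proof (rule that)
    show "\<forall>x\<in>J. \<forall>y\<in>J. \<forall>i<d. \<psi> (x + y) i = \<psi> x i + \<psi> y i"
      by (intro ballI allI impI add)
    show "\<forall>r\<in>carrier ?R. \<forall>x\<in>J. \<forall>i<d. \<psi> (r * x) i = r * \<psi> x i"
      by (intro ballI allI impI mult)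
    show "\<forall>x\<in>J. (\<forall>i<d. \<psi> x i = 0) \<longleftrightarrow> x \<in> I"
      by (intro ballI ker)
    show "\<forall>l. \<psi> ` pieces n J l = (\<Pi>\<^sub>E i\<in>{..<d}. shift (form_piece n m Y) (- int (a i)) (int l))"
      by (intro allI img)
  qed
qed

text \<open>The free module consists of functions and is no subspace of the polynomial ring, so its
  dimension is collected one coordinate at a time. Independence of the forms is still unknown; hence
  the Hilbert function of \<open>k[Y]\<close> appears as the codimension of
  \<open>relations\<close>.\<close>

lemma dim_free_quotient:
  fixes Y :: "nat \<Rightarrow> 'k::field mpoly"
  assumes I: "ideal I (mpoly_ring n)" and J: "ideal J (mpoly_ring n)"
    and Y: "\<forall>i\<le>m. Y i \<in> forms n 1"
    and iso: "graded_isomorphic (form_ring n m Y) (quotient_module n I J) (quotient_piece n I J)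
      (free_module (form_ring n m Y) d) (free_piece (form_piece n m Y) d a)"
    and IJ: "I \<subseteq> J"
  shows "mp.dim (pieces n J l)
    = mp.dim (pieces n I l) + shifted_sum d a (\<lambda>l. codim m l (relations m Y l)) l"
proof -
  obtain \<psi> where
    add': "\<forall>x\<in>J. \<forall>y\<in>J. \<forall>i<d. \<psi> (x + y) i = \<psi> x i + \<psi> y i"
    and mult': "\<forall>r\<in>carrier (form_ring n m Y). \<forall>x\<in>J. \<forall>i<d. \<psi> (r * x) i = r * \<psi> x i"
    and ker: "\<forall>x\<in>J. (\<forall>i<d. \<psi> x i = 0) \<longleftrightarrow> x \<in> I"
    and img': "\<forall>l. \<psi> ` pieces n J l = (\<Pi>\<^sub>E i\<in>{..<d}. shift (form_piece n m Y) (- int (a i)) (int l))"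
    by (rule free_coordinates[OF I J Y iso IJ])
  note add = add'[rule_format] and mult = mult'[rule_format] and img = img'[rule_format]
  define W where "W i = shift (form_piece n m Y) (- int (a i)) (int l)" for i
  have imgW: "\<psi> ` pieces n J l = (\<Pi>\<^sub>E i\<in>{..<d}. W i)"
    unfolding W_def by (rule img)
  have W: "W i = (if a i \<le> l then subst_forms Y ` forms m (l - a i) else {0})" for i
    unfolding W_def by (rule shift_form_piece[OF Y])
  have W0: "0 \<in> W i" for i
    unfolding W using zero_in_forms[of m "l - a i"] subst_forms_0 by (auto intro: image_eqI[of _ _ 0])
  have dimW: "mp.dim (W i) = (if a i \<le> l then codim m (l - a i) (relations m Y (l - a i)) else 0)" for i
    unfolding W using mp.dim_le_card[of "{0 :: 'k mpoly}" "{}"] by (simp add: dim_subst_forms)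
  have const: "Poly_Mapping.single 0 c \<in> carrier (form_ring n m Y)" for c
    unfolding carrier_form_ring[OF Y]
    by (rule image_eqI[of _ _ "Poly_Mapping.single 0 c"])
      (simp_all add: subst_forms_const carrier_mpoly_ring_single_0)
  have scale: "\<psi> (scl c x) i = scl c (\<psi> x i)" if "x \<in> J" "i < d" for c x i
    unfolding scl_def using mult[OF const that] .
  have zero: "\<psi> 0 i = 0" if "i < d" for i
    using ker ideal_mpoly_ringD(2)[OF I] ideal_mpoly_ringD(2)[OF J] that by blast
  note sub = graded_idealD(1)[OF graded_ideal_pieces[OF J], of l]
  have inJ: "x \<in> J" if "x \<in> pieces n J l" for x using that by (simp add: pieces_def)
  \<comment> \<open>A filtration from \<open>pieces n I l\<close> at 0 to
    \<open>pieces n J l\<close> at \<open>d\<close>. Coordinate \<open>j\<close> maps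
    \<open>U (Suc j)\<close> onto \<open>W j\<close> with kernel \<open>U j\<close>.\<close>
  define U where "U j = {x \<in> pieces n J l. \<forall>i. j \<le> i \<and> i < d \<longrightarrow> \<psi> x i = 0}" for j
  have subU: "mp.subspace (U j)" for j
    unfolding U_def
  proof (rule mp.subspaceI)
    show "0 \<in> {x \<in> pieces n J l. \<forall>i. j \<le> i \<and> i < d \<longrightarrow> \<psi> x i = 0}"
      using mp.subspace_0[OF sub] zero by simp
  next
    fix x y
    assume "x \<in> {x \<in> pieces n J l. \<forall>i. j \<le> i \<and> i < d \<longrightarrow> \<psi> x i = 0}"
      "y \<in> {x \<in> pieces n J l. \<forall>i. j \<le> i \<and> i < d \<longrightarrow> \<psi> x i = 0}"
    then show "x + y \<in> {x \<in> pieces n J l. \<forall>i. j \<le> i \<and> i < d \<longrightarrow> \<psi> x i = 0}"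
      using mp.subspace_add[OF sub] by (auto simp: add inJ)
  next
    fix c x
    assume "x \<in> {x \<in> pieces n J l. \<forall>i. j \<le> i \<and> i < d \<longrightarrow> \<psi> x i = 0}"
    then show "scl c x \<in> {x \<in> pieces n J l. \<forall>i. j \<le> i \<and> i < d \<longrightarrow> \<psi> x i = 0}"
      using mp.subspace_scale[OF sub] by (auto simp: scale inJ)
  qed
  have "mp.dim (U j) = mp.dim (pieces n I l) + (\<Sum>i<j. mp.dim (W i))" if "j \<le> d" for j
    using that
  proof (induction j)
    case 0
    have "U 0 = pieces n I l"
      using ker IJ unfolding U_def pieces_def by auto
    then show ?case by simp
  next
    case (Suc j)
    have j: "j < d" using Suc.prems by simp
    have "U (Suc j) \<subseteq> mp.span (mono_basis n l)"
      by (rule subset_forms_span) (auto simp: U_def pieces_def)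
    then have "mp.dim (U (Suc j))
        = mp.dim {x \<in> U (Suc j). \<psi> x j = 0} + mp.dim ((\<lambda>x. \<psi> x j) ` U (Suc j))"
      by (intro mpp.dim_kernel_plus_dim_image[OF subU _ finite_mono_basis])
        (auto simp: U_def inJ add scale j)
    moreover have "{x \<in> U (Suc j). \<psi> x j = 0} = U j"
    proof -
      have "(\<forall>i. j \<le> i \<and> i < d \<longrightarrow> \<psi> x i = 0)
          \<longleftrightarrow> (\<forall>i. Suc j \<le> i \<and> i < d \<longrightarrow> \<psi> x i = 0) \<and> \<psi> x j = 0" for x
        using j by (metis Suc_leI Suc_leD le_neq_implies_less le_refl)
      then show ?thesis unfolding U_def by blast
    qed
    moreover have "(\<lambda>x. \<psi> x j) ` U (Suc j) = W j"
    proof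
      show "(\<lambda>x. \<psi> x j) ` U (Suc j) \<subseteq> W j"
      proof (rule image_subsetI)
        fix x assume "x \<in> U (Suc j)"
        then have "x \<in> pieces n J l" by (simp add: U_def)
        then have "\<psi> x \<in> (\<Pi>\<^sub>E i\<in>{..<d}. W i)" unfolding imgW[symmetric] by (rule imageI)
        then show "\<psi> x j \<in> W j" using j by (simp add: PiE_mem)
      qed
      show "W j \<subseteq> (\<lambda>x. \<psi> x j) ` U (Suc j)"
      proof
        fix w assume w: "w \<in> W j"
        let ?v = "\<lambda>i\<in>{..<d}. if i = j then w else 0"
        have "?v \<in> (\<Pi>\<^sub>E i\<in>{..<d}. W i)" using w W0 by auto
        then have "?v \<in> \<psi> ` pieces n J l" by (simp only: imgW)
        then obtain x where x: "?v = \<psi> x" "x \<in> pieces n J l" by (rule imageE)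
        have \<psi>x: "\<psi> x i = (if i = j then w else 0)" if "i < d" for i
          using that by (simp flip: x(1))
        then have "x \<in> U (Suc j)" using x(2) by (simp add: U_def)
        moreover have "w = \<psi> x j" using \<psi>x[OF j] by simp
        ultimately show "w \<in> (\<lambda>x. \<psi> x j) ` U (Suc j)" by (rule rev_image_eqI)
      qed
    qed
    ultimately show ?case using Suc.IH j by simp
  qed
  then have "mp.dim (U d) = mp.dim (pieces n I l) + (\<Sum>i<d. mp.dim (W i))" by simp
  moreover have "U d = pieces n J l" by (auto simp: U_def)
  ultimately show ?thesis by (simp add: shifted_sum_def dimW)
qed

text \<open>Since the coordinate ring is torsion-free over \<open>k[Y]\<close>, a nonzero ideal \<open>J/I\<close> contains a
  shifted copy of \<open>k[Y]\<close>.\<close>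

lemma dim_ideal_ge_form_ring:
  fixes Y :: "nat \<Rightarrow> 'k::field mpoly"
  assumes I: "ideal I (mpoly_ring n)" and J: "ideal J (mpoly_ring n)"
    and Y: "\<forall>i\<le>m. Y i \<in> forms n 1"
    and iso: "graded_isomorphic (form_ring n m Y) (quotient_module n I (carrier (mpoly_ring n)))
      (quotient_piece n I (carrier (mpoly_ring n)))
      (free_module (form_ring n m Y) d) (free_piece (form_piece n m Y) d a)"
    and IJ: "I \<subseteq> J" and g: "g \<in> pieces n J b" "g \<notin> I"
  shows "mp.dim (pieces n I (k + b)) + codim m k (relations m Y k) \<le> mp.dim (pieces n J (k + b))"
proof -
  let ?P = "carrier (mpoly_ring n) :: 'k mpoly set"
  interpret P: cring "mpoly_ring n :: 'k mpoly ring" by (rule cring_mpoly_ring)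
  have IP: "I \<subseteq> ?P" by (rule ideal_mpoly_ringD(1)[OF I])
  obtain \<psi> where
    "\<forall>x\<in>?P. \<forall>y\<in>?P. \<forall>i<d. \<psi> (x + y) i = \<psi> x i + \<psi> y i"
    and mult': "\<forall>r\<in>carrier (form_ring n m Y). \<forall>x\<in>?P. \<forall>i<d. \<psi> (r * x) i = r * \<psi> x i"
    and ker': "\<forall>x\<in>?P. (\<forall>i<d. \<psi> x i = 0) \<longleftrightarrow> x \<in> I"
    and "\<forall>l. \<psi> ` pieces n ?P l = (\<Pi>\<^sub>E i\<in>{..<d}. shift (form_piece n m Y) (- int (a i)) (int l))"
    by (rule free_coordinates[OF I P.oneideal Y iso IP])
  note mult = mult'[rule_format] and ker = bspec[OF ker']
  have gf: "g \<in> forms n b" and gJ: "g \<in> J" using g(1) by (simp_all add: pieces_def)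
  then have gP: "g \<in> ?P" using forms_subset_carrier by blast
  \<comment> \<open>A nonzero coordinate of \<open>g\<close> detects torsion: coordinates are
    polynomials, and the polynomial ring is a domain.\<close>
  obtain i where i: "i < d" "\<psi> g i \<noteq> 0" using ker[OF gP] g(2) by blast
  have torsion_free: "subst_forms Y f = 0" if f: "f \<in> forms m k" "subst_forms Y f * g \<in> I" for f
  proof -
    have "subst_forms Y f \<in> subst_forms Y ` carrier (mpoly_ring m)"
      using f(1) forms_subset_carrier by blast
    then have "subst_forms Y f \<in> carrier (form_ring n m Y)"
      by (simp only: carrier_form_ring[OF Y])
    then have "\<psi> (subst_forms Y f * g) i = subst_forms Y f * \<psi> g i" using gP i(1) by (rule mult)
    moreover have "\<psi> (subst_forms Y f * g) i = 0" using ker[of "subst_forms Y f * g"] f(2) IP i(1) by blast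
    ultimately show ?thesis using i(2) by simp
  qed
  note GI = graded_ideal_pieces[OF I] and GJ = graded_ideal_pieces[OF J]
  obtain \<pi> where lin: "Vector_Spaces.linear scl scl \<pi>" and k\<pi>: "{x. \<pi> x = 0} = pieces n I (k + b)"
    using exists_linear_with_kernel[OF graded_idealD(1)[OF GI]] .
  interpret \<pi>: Vector_Spaces.linear scl scl \<pi> by (rule lin)
  have Jspan: "pieces n J (k + b) \<subseteq> mp.span (mono_basis n (k + b))"
    by (rule subset_forms_span[OF graded_idealD(2)[OF GJ]])
  have 1: "mp.dim (pieces n J (k + b))
      = mp.dim {x \<in> pieces n J (k + b). \<pi> x = 0} + mp.dim (\<pi> ` pieces n J (k + b))"
    by (rule mpp.dim_kernel_plus_dim_image[OF graded_idealD(1)[OF GJ] Jspan finite_mono_basis])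
      (simp_all add: \<pi>.add \<pi>.scale)
  let ?f = "\<lambda>f. \<pi> (subst_forms Y f * g)"
  have 2: "mp.dim (forms m k :: 'k mpoly set)
      = mp.dim {f \<in> forms m k. ?f f = 0} + mp.dim (?f ` forms m k)"
    by (rule mpp.dim_kernel_plus_dim_image[OF subspace_forms forms_subset_span finite_mono_basis])
      (simp_all add: subst_forms_add subst_forms_scl distrib_right scl_mult_left \<pi>.add \<pi>.scale)
  have prod: "subst_forms Y f * g \<in> pieces n J (k + b)" if "f \<in> forms m k" for f
    by (rule graded_idealD(3)[OF GJ subst_in_forms[OF Y that] g(1)])
  have "{x \<in> pieces n J (k + b). \<pi> x = 0} = pieces n I (k + b)"
    using k\<pi> IJ unfolding pieces_def by blast
  \<comment> \<open>The map sending \<open>f\<close> to the class of \<open>f(Y) g\<close> thus has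
    exactly the relations as kernel, so its image is a copy of \<open>k[Y]\<close> in degree
    \<open>k + b\<close>.\<close>
  moreover have "{f \<in> forms m k. ?f f = 0} = relations m Y k"
  proof -
    have "?f f = 0 \<longleftrightarrow> subst_forms Y f = 0" if f: "f \<in> forms m k" for f
    proof
      assume "?f f = 0"
      then have "subst_forms Y f * g \<in> I" using k\<pi> unfolding pieces_def by blast
      then show "subst_forms Y f = 0" by (rule torsion_free[OF f])
    qed (simp add: \<pi>.zero)
    then show ?thesis unfolding relations_def by blast
  qed
  moreover have "mp.dim (?f ` forms m k) \<le> mp.dim (\<pi> ` pieces n J (k + b))"
  proof (rule mp.dim_mono_finite)
    show "?f ` forms m k \<subseteq> mp.span (\<pi> ` pieces n J (k + b))"
      using prod mp.span_superset by blast
    have "\<pi> ` pieces n J (k + b) \<subseteq> \<pi> ` mp.span (mono_basis n (k + b))" using Jspan by blast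
    also have "\<dots> = mp.span (\<pi> ` mono_basis n (k + b))" by (rule \<pi>.span_image[symmetric])
    finally show "\<pi> ` pieces n J (k + b) \<subseteq> mp.span (\<pi> ` mono_basis n (k + b))" .
  qed (simp add: finite_mono_basis)
  ultimately have "mp.dim (pieces n J (k + b)) = mp.dim (pieces n I (k + b)) + mp.dim (\<pi> ` pieces n J (k + b))"
    "mp.dim (forms m k :: 'k mpoly set) \<le> mp.dim (relations m Y k) + mp.dim (\<pi> ` pieces n J (k + b))"
    using 1 2 by simp_all
  then show ?thesis unfolding codim_def by linarith
qed

section \<open>Generating functions of the counts and comparison of Hilbert series\<close>

lemma count_series:
  fixes d :: nat
  shows "Abs_fps (\<lambda>i. int (card {j. j < d \<and> s j \<le> i})) * (1 - fps_X) = (\<Sum>j<d. fps_X ^ s j)"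
proof (rule fps_ext)
  fix i
  have card: "int (card {j. j < d \<and> s j \<le> i}) = (\<Sum>j<d. if s j \<le> i then 1 else 0)" for i
  proof -
    have "{j. j < d \<and> s j \<le> i} = {j \<in> {..<d}. s j \<le> i}" by auto
    then have "int (card {j. j < d \<and> s j \<le> i}) = (\<Sum>j\<in>{j \<in> {..<d}. s j \<le> i}. 1)" by simp
    also have "\<dots> = (\<Sum>j<d. if s j \<le> i then 1 else 0)" by (rule sum.inter_filter) simp
    finally show ?thesis .
  qed
  show "fps_nth (Abs_fps (\<lambda>i. int (card {j. j < d \<and> s j \<le> i})) * (1 - fps_X)) i
      = fps_nth (\<Sum>j<d. fps_X ^ s j) i"
  proof (cases i)
    case 0
    then show ?thesis
      by (auto simp: right_diff_distrib card fps_sum_nth fps_X_power_nth intro!: sum.cong)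
  next
    case (Suc i')
    have "(\<Sum>j<d. if s j \<le> Suc i' then 1 else 0 :: int) - (\<Sum>j<d. if s j \<le> i' then 1 else 0)
        = (\<Sum>j<d. if s j = Suc i' then 1 else 0)"
      unfolding sum_subtractf[symmetric] by (intro sum.cong) auto
    then show ?thesis
      using Suc by (auto simp: right_diff_distrib card fps_sum_nth fps_X_power_nth intro!: sum.cong)
  qed
qed

theorem mainTheorem6:
  fixes n m d :: nat
    and IX IY :: "'k::{alg_closed_field, field_char_0} mpoly set"
    and ms ns :: "nat \<Rightarrow> nat"
  assumes "1 \<le> m"
    and "ACM n IX"
    and "has_pure_dimension n IX m"
    and "has_degree n IX d"
    and "characteristic_sequence n IX m d ms"
    and "ACM_hypersurface n IX m IY"
    and "relative_characteristic_sequence n IX m d IY ns"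
  shows "zero_sequence
    (\<lambda>i. int (card {j. j < d \<and> ms j \<le> i}) - int (card {j. j < d \<and> ns j \<le> i}))"
proof (cases "d = 0")
  \<comment> \<open>For \<open>d = 0\<close> both counts vanish. Otherwise index 0 exists, and
    \<open>ns 0\<close> will be the degree of a nonzero class of the ideal.\<close>
  case True
  then show ?thesis by (simp add: zero_sequence_def macaulay_up_def)
next
  case False
  obtain r where m: "m = Suc r" using assms(1) by (cases m) auto
  let ?P = "carrier (mpoly_ring n) :: 'k mpoly set"
  interpret P: cring "mpoly_ring n :: 'k mpoly ring" by (rule cring_mpoly_ring)
  have hX: "homogeneous_ideal n IX" using assms(2) unfolding ACM_def subscheme_def by blast
  have acmY: "ACM n IY" and XY: "IX \<subseteq> IY" and dimY: "has_dimension n IY (m - 1)"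
    using assms(6) unfolding ACM_hypersurface_def has_pure_dimension_def by blast+
  have hY: "homogeneous_ideal n IY" using acmY unfolding ACM_def subscheme_def by blast
  have dimX: "has_dimension n IX m" using assms(3) unfolding has_pure_dimension_def by blast
  have I: "ideal IX (mpoly_ring n)" and J: "ideal IY (mpoly_ring n)"
    using hX hY unfolding homogeneous_ideal_def by blast+
  have IP: "IX \<subseteq> ?P" by (rule ideal_mpoly_ringD(1)[OF I])
  note GI = graded_ideal_pieces[OF I] and GJ = graded_ideal_pieces[OF J]
  have piece1: "poly_piece n 1 = (forms n 1 :: 'k mpoly set)"
    using poly_piece_int[of n 1, where 'a = 'k] by simp
  obtain Y where avY: "avoiding_forms n IX m Y"
    and isoX: "graded_isomorphic (form_ring n m Y) (quotient_module n IX ?P) (quotient_piece n IX ?P)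
      (free_module (form_ring n m Y) d) (free_piece (form_piece n m Y) d ms)"
    using assms(5) unfolding characteristic_sequence_def by blast
  obtain Z where avZ: "avoiding_forms n IX m Z"
    and isoY: "graded_isomorphic (form_ring n m Z) (quotient_module n IX IY) (quotient_piece n IX IY)
      (free_module (form_ring n m Z) d) (free_piece (form_piece n m Z) d ns)"
    using assms(7) unfolding relative_characteristic_sequence_def by blast
  have Y: "\<forall>i\<le>m. Y i \<in> forms n 1" and Z: "\<forall>i\<le>m. Z i \<in> forms n 1"
    using avY avZ unfolding avoiding_forms_def piece1 by blast+
  \<comment> \<open>The two sequences may come from different linear forms, so the independence of
    \<open>Y\<close> and of \<open>Z\<close> is shown separately.\<close>
  let ?rY = "\<lambda>l. codim m l (relations m Y l)" and ?rZ = "\<lambda>l. codim m l (relations m Z l)"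
  have codimX: "codim n l (pieces n IX l) = shifted_sum d ms ?rY l" for l
  proof -
    have "pieces n ?P l = forms n l" using forms_subset_carrier by (auto simp: pieces_def)
    then show ?thesis
      using dim_free_quotient[OF I P.oneideal Y isoX IP, of l] by (simp add: codim_def[of n])
  qed
  have dimYX: "mp.dim (pieces n IY l) = mp.dim (pieces n IX l) + shifted_sum d ns ?rZ l" for l
    by (rule dim_free_quotient[OF I J Z isoY XY])
  have rY: "?rY l = (l + m) choose m" for l
  proof -
    obtain gs where gs: "length gs = Suc m" "regular n (pieces n IX) gs"
      using ACM_regular(1)[OF assms(2) dimX] by auto
    obtain E where E: "\<And>k. (k + m) choose m \<le> codim n (E * k) (pieces n IX (E * k))"
      using regular_sequence_growth[OF GI gs(2,1) codim_pieces_0_pos[OF I ACM_regular(2)[OF assms(2) dimX]]]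
      by blast
    have "\<exists>l. C * ((l + r) choose r)
        < shifted_sum d ms (\<lambda>l. codim (Suc r) l (relations (Suc r) Y l)) l" for C
    proof -
      obtain k where "C * ((E * k + 0 + r) choose r) < (k + Suc r) choose Suc r"
        using binomial_not_bounded[of C E 0 r] by blast
      also have "\<dots> \<le> shifted_sum d ms ?rY (E * k)" using E[of k] codimX[of "E * k"] m by simp
      finally show ?thesis unfolding m by (intro exI[of _ "E * k"]) simp
    qed
    then show ?thesis unfolding m by (rule codim_relations_eq)
  qed
  \<comment> \<open>Forms of degree 0 admit no relation, whatever \<open>Z\<close> is. This produces
    a class outside \<open>IX\<close> before the independence of \<open>Z\<close> is known.\<close>
  have rZ0: "?rZ 0 = 1"
  proof -
    have "f = 0" if f: "f \<in> relations m Z 0" for f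
    proof -
      obtain c where "f = Poly_Mapping.single 0 c" using f forms_0[of f m] by (auto simp: relations_def)
      then show ?thesis using f subst_forms_const[of Z c] by (simp add: relations_def)
    qed
    moreover have "0 \<in> relations m Z 0" by (simp add: relations_def)
    ultimately have "relations m Z 0 = {0}" by blast
    then show ?thesis by (simp add: codim_zero)
  qed
  obtain g where g: "g \<in> pieces n IY (ns 0)" "g \<notin> IX"
  proof -
    have "?rZ 0 \<le> shifted_sum d ns ?rZ (ns 0)"
      unfolding shifted_sum_def using False
      by (intro order_trans[OF _ member_le_sum[of 0 "{..<d}"
            "\<lambda>i. if ns i \<le> ns 0 then ?rZ (ns 0 - ns i) else 0"]]) auto
    then have "pieces n IY (ns 0) \<noteq> pieces n IX (ns 0)"
      using dimYX[of "ns 0"] rZ0 by auto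
    then show thesis using XY that unfolding pieces_def by blast
  qed
  have rZ: "?rZ l = (l + m) choose m" for l
  proof -
    have "\<exists>l. C * ((l + r) choose r)
        < shifted_sum d ns (\<lambda>l. codim (Suc r) l (relations (Suc r) Z l)) l" for C
    proof -
      \<comment> \<open>The copy of \<open>k[Y]\<close> generated by \<open>g\<close> makes the
        ideal grow with order \<open>m\<close>; it starts in degree \<open>ns 0\<close>, hence scale
        1 and offset \<open>ns 0\<close>.\<close>
      obtain k where "C * ((1 * k + ns 0 + r) choose r) < (k + Suc r) choose Suc r"
        using binomial_not_bounded[of C 1 "ns 0" r] by blast
      also have "\<dots> \<le> shifted_sum d ns ?rZ (k + ns 0)"
        using dim_ideal_ge_form_ring[OF I J Y isoX XY g, of k] dimYX[of "k + ns 0"] rY[of k] m by simp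
      finally show ?thesis unfolding m by (intro exI[of _ "k + ns 0"]) simp
    qed
    then show ?thesis unfolding m by (rule codim_relations_eq)
  qed
  let ?c = "\<lambda>i. int (card {j. j < d \<and> ms j \<le> i})" and ?d = "\<lambda>i. int (card {j. j < d \<and> ns j \<le> i})"
  define S where "S = Abs_fps (\<lambda>i. ?c i - ?d i)"
  have S: "S * (1 - fps_X) = (\<Sum>j<d. fps_X ^ ms j) - (\<Sum>j<d. fps_X ^ ns j)"
  proof -
    have "S = Abs_fps ?c - Abs_fps ?d" unfolding S_def by (rule fps_ext) simp
    then show ?thesis by (simp only: left_diff_distrib count_series)
  qed
  have hsX: "hilbert_series n (pieces n IX) = (\<Sum>j<d. fps_X ^ ms j) * binomial_series m"
    unfolding hilbert_series_def codimX by (rule shifted_sum_series) (rule rY)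
  have "hilbert_series n (pieces n IY)
      = hilbert_series n (pieces n IX) - Abs_fps (\<lambda>l. int (shifted_sum d ns ?rZ l))"
  proof (rule fps_ext)
    fix l
    show "fps_nth (hilbert_series n (pieces n IY)) l
        = fps_nth (hilbert_series n (pieces n IX) - Abs_fps (\<lambda>l. int (shifted_sum d ns ?rZ l))) l"
      using dimYX[of l] dim_le_dim_forms[OF graded_idealD(2)[OF GJ], of l] by (simp add: codim_def[of n])
  qed
  also have "Abs_fps (\<lambda>l. int (shifted_sum d ns ?rZ l)) = (\<Sum>j<d. fps_X ^ ns j) * binomial_series m"
    by (rule shifted_sum_series) (rule rZ)
  finally have hsY: "hilbert_series n (pieces n IY) = S * (1 - fps_X) * binomial_series m"
    unfolding hsX S by (simp only: left_diff_distrib)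
  \<comment> \<open>The factor \<open>1 - fps_X\<close> already present in \<open>hsY\<close> raises
    the exponent \<open>m\<close> to \<open>Suc m\<close>, which cancels
    \<open>binomial_series m\<close>.\<close>
  have hs: "hilbert_series n (pieces n IY) * (1 - fps_X) ^ m = S"
  proof -
    have "hilbert_series n (pieces n IY) * (1 - fps_X) ^ m
        = S * (binomial_series m * (1 - fps_X) ^ Suc m)"
      unfolding hsY by (simp add: mult_ac)
    then show ?thesis by (simp only: binomial_series_inverse mult_1_right)
  qed
  have "finite_support S"
    unfolding finite_support_def
  proof (intro exI allI impI)
    \<comment> \<open>The sum of all entries bounds each of them, so from there on both counts equal
      \<open>d\<close>.\<close>
    fix k assume k: "(\<Sum>j<d. ms j + ns j) \<le> k"
    have "ms j \<le> k \<and> ns j \<le> k" if "j < d" for j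
      using member_le_sum[of j "{..<d}" "\<lambda>j. ms j + ns j"] that k by simp
    then have "{j. j < d \<and> ms j \<le> k} = {j. j < d \<and> ns j \<le> k}" by blast
    then show "fps_nth S k = 0" by (simp add: S_def)
  qed
  obtain gs where gs: "length gs = m" "regular n (pieces n IY) gs"
    using ACM_regular(1)[OF acmY dimY] m by auto
  obtain J' :: "nat \<Rightarrow> 'k mpoly set" where J': "graded_ideal n J'" "hilbert_series n J' = S"
    using exists_linear_regular_sequence[OF GJ gs(2)] \<open>finite_support S\<close> unfolding gs(1) hs by blast
  have codimJ': "?c i - ?d i = int (codim n i (J' i))" for i
  proof -
    have "fps_nth S i = int (codim n i (J' i))" unfolding J'(2)[symmetric] by simp
    then show ?thesis by (simp add: S_def)
  qed
  \<comment> \<open>Nonnegativity is immediate once the differences are codimensions, and the growth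
    condition is Macaulay's bound for \<open>J'\<close>.\<close>
  show ?thesis
    unfolding zero_sequence_def codimJ'
    using macaulay_bound[OF J'(1)] by (simp add: macaulay_up_eq_mac_up)
qed

end
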